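(* Let $A=U^T\Delta U$ be a symmetric oscillatory matrix of order $n\ge2$, where $U$ is unit upper triangular and $\Delta$ is positive diagonal. There is a symmetric basic oscillatory matrix $B$ of order $n$ such that $e_k(A)\le e_k(B)$ for every $1\le k<n$. Moreover, $$e_k(A)+e_{n-k}(A)\le n\qquad(1\le k<n),$$ and $$\sum_{k=1}^{n-1}e_k(A)+\ell(U)\le\binom n2+n-1.$$ Equality in the last inequality holds if and only if $$\ell(U^2)-\ell(U)=\#\{k:1\le k<n,\ \Delta_{L_k,R_k}(A)=0\}.$$ In particular, $\sum_{k=1}^{n-1}e_k(A)\le\binom n2$. Equality in this last bound holds if and only if $A$ is basic oscillatory; it is also equivalent to having $e_k(A)+e_{n-k}(A)=n$ for every $1\le k<n$.
   Context: All matrices are real. A matrix is totally nonnegative (TN) if all its minors are nonnegative and totally positive (TP) if all its minors are positive. A square TN matrix is oscillatory if some positive integer power of it is TP. For an oscillatory matrix $A$ of order $n$ and $1\le k\le n$, $e_k(A)=\min\{m\ge1:\text{all minors of order }k\text{ of }A^m\text{ are positive}\}$. $\Delta_{I,J}(A)$ denotes the determinant of the submatrix of $A$ in rows $I$ and columns $J$; $L_k=\{1,\ldots,k\}$ and $R_k=\{n-k+1,\ldots,n\}$. (The positive diagonal matrix $\Delta$ in $A=U^T\Delta U$ is a diagonal matrix with positive diagonal entries.) For $1\le i<n$ and $a>0$, $x_i(a)=I+aE_{i,i+1}$, where $E_{ij}$ has a single nonzero entry one in position $(i,j)$; these are the positive elementary upper factors. For a unit upper triangular TN matrix $U$, $\ell(U)$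 is the least number $s$ of factors in a representation $U=x_{q_1}(a_1)\cdots x_{q_s}(a_s)$ with all $a_j>0$ (the empty product is allowed; every unit upper triangular TN matrix has such a representation). In a factorization $A=U^T\Delta U$ of a symmetric oscillatory matrix $A$ with $U$ unit upper triangular and $\Delta$ a diagonal matrix with positive diagonal entries, which is unique and exists for every symmetric oscillatory $A$, the matrix $U$ is TN. Every nonsingular TN matrix factors as $A=U_-^T\Delta U_+$ with $\Delta$ positive diagonal and each of $U_-,U_+$ a product of factors $x_i(a)$, $a\ge0$ (zero parameters giving identity factors), with indices in the fixed order $(n-1);\ (n-2,n-1);\ \ldots;\ (1,2,\ldots,n-1)$. A nonsingular TN matrix is basic oscillatory if it admits such a factorization in which, in each of $U_-$ and $U_+$, each index $1,\ldots,n-1$ has exactly one positive parameter. *)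

theory Defs
  imports "Jordan_Normal_Form.DL_Submatrix" "Jordan_Normal_Form.Gauss_Jordan_Elimination"
    "Jordan_Normal_Form.Determinant"
begin

text \<open>Rows and columns of matrices are numbered from 0, as in the matrix library. Hence the
  mathematical row or column \<open>i\<close> (\<open>1 \<le> i \<le> n\<close>) is \<open>i - 1\<close> here, the sets
  \<open>L\<^sub>k = {1,\<dots>,k}\<close> and \<open>R\<^sub>k = {n-k+1,\<dots>,n}\<close> become \<open>{..<k}\<close> and \<open>{n-k..<n}\<close>, and the elementary
  factors \<open>x\<^sub>1,\<dots>,x\<^sub>n\<^sub>-\<^sub>1\<close> are numbered \<open>0,\<dots>,n-2\<close>. Orders of minors are not shifted.\<close>

definition minor :: "real mat \<Rightarrow> nat set \<Rightarrow> nat set \<Rightarrow> real" where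
  "minor A I J = det (submatrix A I J)"

definition minors :: "nat \<Rightarrow> real mat \<Rightarrow> real set" where
  "minors k A = {minor A I J | I J.
     I \<subseteq> {..<dim_row A} \<and> J \<subseteq> {..<dim_col A} \<and> card I = k \<and> card J = k}"

definition totally_nonnegative :: "real mat \<Rightarrow> bool" where
  "totally_nonnegative A \<longleftrightarrow> (\<forall>k\<ge>1. \<forall>x\<in>minors k A. 0 \<le> x)"

definition totally_positive :: "real mat \<Rightarrow> bool" where
  "totally_positive A \<longleftrightarrow> (\<forall>k\<ge>1. \<forall>x\<in>minors k A. 0 < x)"

definition oscillatory :: "real mat \<Rightarrow> bool" where
  "oscillatory A \<longleftrightarrow>
     square_mat A \<and> totally_nonnegative A \<and> (\<exists>m\<ge>1. totally_positive (A ^\<^sub>m m))"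

definition minor_exponent :: "nat \<Rightarrow> real mat \<Rightarrow> nat" where
  "minor_exponent k A = (LEAST m. 1 \<le> m \<and> (\<forall>x\<in>minors k (A ^\<^sub>m m). 0 < x))"

definition unit_upper_triangular :: "real mat \<Rightarrow> bool" where
  "unit_upper_triangular U \<longleftrightarrow>
     square_mat U \<and> upper_triangular U \<and> (\<forall>i<dim_row U. U $$ (i, i) = 1)"

text \<open>\<open>addrow_mat n a i j\<close> with \<open>i \<noteq> j\<close> is the identity of order \<open>n\<close> plus \<open>a\<close> in position \<open>(i, j)\<close>.\<close>

definition elem_upper :: "nat \<Rightarrow> nat \<Rightarrow> real \<Rightarrow> real mat" where
  "elem_upper n i a = addrow_mat n a i (Suc i)"

definition upper_product :: "nat \<Rightarrow> (nat \<times> real) list \<Rightarrow> real mat" where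
  "upper_product n fs = foldr (\<lambda>(i, a) M. elem_upper n i a * M) fs (1\<^sub>m n)"

definition upper_length :: "real mat \<Rightarrow> nat" where
  "upper_length U = (LEAST s. \<exists>fs. length fs = s
     \<and> (\<forall>(i, a)\<in>set fs. Suc i < dim_row U \<and> 0 < a)
     \<and> U = upper_product (dim_row U) fs)"

text \<open>The order \<open>(n-1); (n-2,n-1); \<dots>; (1,2,\<dots>,n-1)\<close> of the factors in the factorization of a
  nonsingular totally nonnegative matrix, with the indices shifted by one.\<close>

definition factor_order :: "nat \<Rightarrow> nat list" where
  "factor_order n = concat (map (\<lambda>p. [p..<n - 1]) (rev [0..<n - 1]))"

text \<open>\<open>as\<close> lists nonnegative parameters for the factors in this order, such that each
  index has exactly one positive parameter.\<close>

definition basic_parameters :: "nat \<Rightarrow> real list \<Rightarrow> bool" where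
  "basic_parameters n as \<longleftrightarrow>
     length as = length (factor_order n) \<and> (\<forall>a\<in>set as. 0 \<le> a)
     \<and> (\<forall>i<n - 1. \<exists>!j. j < length as \<and> factor_order n ! j = i \<and> 0 < as ! j)"

definition basic_oscillatory :: "real mat \<Rightarrow> bool" where
  "basic_oscillatory A \<longleftrightarrow>
     invertible_mat A \<and> totally_nonnegative A
     \<and> (\<exists>as bs d. let n = dim_row A in
          basic_parameters n as \<and> basic_parameters n bs \<and> (\<forall>i<n. 0 < d i)
          \<and> A = transpose_mat (upper_product n (zip (factor_order n) as)) * mat_diag n d
                * upper_product n (zip (factor_order n) bs))"

end

(* A factorization of U into elementary factors turns minors into combinatorics: the minor of U in
   rows I and columns J is positive iff the word of indices can move I to J, a letter i moving i to
   i + 1 when that place is free. From the first k indices the word reaches exactly the sets below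
   the result of greedy moves, and up-moves can be commuted past the down-moves coming from the
   transposed factors. Hence e_k(A) is the number of greedy passes of the word that take the first
   k indices to the last k.

   Greedy moves act on permutations by the Demazure product, and the length of the resulting
   permutation is l(U). Since appending and prepending a further copy of the word give the same
   product, compare them: the (m+1)-st copy, appended, moves every set that has not yet arrived,
   while a prepended letter i changes only the image of the first i indices and, when it does, raises
   the length by one. So the length grows in each pass by at least the number of unfinished k, and summing over
   the passes gives the inequality. As descents persist, fewer and fewer letters act in later
   passes, so equality is decided by the second pass.

   The bound e_k + e_(n-k) <= n is a last-passage estimate in which the cost of a path depends only
   on its end points. *)

theory Submission
  imports Defs
begin

section \<open>Subsets under the monotone action of a word\<close>

text \<open>Where the bound comes from: let u_m be the number of unfinished k after m passes and g_m
  the gain in length when one more copy is prepended. Every e_k is at most n, so summing u_m over m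
  < n gives the sum of the e_k, while summing g_m gives the length of the order-reversing
  permutation, n choose 2. For m = 0 both are known exactly, u_0 = n - 1 and g_0 = l(U); the terms
  from m = 1 on are compared by u_m <= g_m. Moreover g_1 = l(U^2) - l(U), and u_1 counts the
  vanishing corner minors, the last of their order to become positive. The obstacle is that words
  are not unique, whereas exponents and length belong to the matrix. The permutation of a word is
  read off from the positive minors in leading rows, and subtraction-free braid relations shorten
  any word to a reduced one. That U has a word at all follows from the signs of its minors in
  leading rows, as a limit of strictly positive cases. B keeps one copy of each letter of a word of
  A. In the basic case each letter occurs once, and commutations produce the prescribed
  order.\<close>

definition act :: "nat \<Rightarrow> nat set \<Rightarrow> nat set" where
  "act i J = (if i \<in> J \<and> Suc i \<notin> J then insert (Suc i) (J - {i}) else J)"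

text \<open>A relation and not a function, because a minor of \<open>M * elem_upper n i a\<close> is
  a sum of two terms: one keeps the column set, the other replaces column i + 1 by column i. Either
  may be the nonzero one.\<close>

definition up :: "nat \<Rightarrow> (nat set \<times> nat set) set" where
  "up i = {(J, K). K = J \<or> K = act i J}"

definition reach :: "nat list \<Rightarrow> (nat set \<times> nat set) set" where
  "reach ws = foldr (\<lambda>i R. up i O R) ws Id"

definition acts :: "nat list \<Rightarrow> nat set \<Rightarrow> nat set" where
  "acts ws = fold act ws"

definition height :: "nat set \<Rightarrow> nat \<Rightarrow> nat" where
  "height J j = card (J \<inter> {j..})"

text \<open>The Gale order, that is, the componentwise comparison of the sorted elements. Counting
  the elements from j upwards avoids sorting: a move of letter i changes only the count at i +
  1.\<close>

definition gale_le :: "nat set \<Rightarrow> nat set \<Rightarrow> bool" where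
  "gale_le J M \<longleftrightarrow> finite J \<and> finite M \<and> card J = card M \<and> (\<forall>j. height J j \<le> height M j)"

lemma reach_Nil [simp]: "reach [] = Id"
  and reach_Cons [simp]: "reach (i # ws) = up i O reach ws"
  by (simp_all add: reach_def)

lemma acts_Nil [simp]: "acts [] M = M"
  and acts_Cons [simp]: "acts (i # ws) M = acts ws (act i M)"
  by (simp_all add: acts_def)

lemma acts_append [simp]: "acts (us @ vs) M = acts vs (acts us M)"
  by (simp add: acts_def)

lemma finite_act [simp]: "finite (act i J) \<longleftrightarrow> finite J"
  by (simp add: act_def)

lemma card_act [simp]: "card (act i J) = card J"
proof (cases "finite J \<and> i \<in> J \<and> Suc i \<notin> J")
  case True
  then have "act i J = insert (Suc i) (J - {i})" by (simp add: act_def)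
  also have "card \<dots> = Suc (card (J - {i}))" using True by (intro card_insert_disjoint) auto
  also have "\<dots> = card J" by (rule card.remove[symmetric]) (use True in auto)
  finally show ?thesis .
next
  case False
  then show ?thesis by (cases "finite J") (auto simp: act_def)
qed

lemma act_subset: "J \<subseteq> {..<n} \<Longrightarrow> Suc i < n \<Longrightarrow> act i J \<subseteq> {..<n}"
  by (auto simp: act_def)

lemma height_step: "finite J \<Longrightarrow> height J j = height J (Suc j) + (if j \<in> J then 1 else 0)"
proof -
  assume "finite J"
  have "J \<inter> {j..} = (if j \<in> J then insert j (J \<inter> {Suc j..}) else J \<inter> {Suc j..})"
    by (auto simp: not_less_eq_eq Suc_le_eq intro: le_neq_implies_less)
  moreover have "j \<notin> J \<inter> {Suc j..}" by simp
  ultimately show ?thesis using \<open>finite J\<close> unfolding height_def by auto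
qed

lemma height_0: "height J 0 = card J"
  by (simp add: height_def)

lemma height_act:
  assumes "finite J"
  shows "height (act i J) j = height J j + (if j = Suc i \<and> i \<in> J \<and> Suc i \<notin> J then 1 else 0)"
proof (cases "i \<in> J \<and> Suc i \<notin> J")
  case False
  then have "act i J = J" by (auto simp: act_def)
  then show ?thesis using False by auto
next
  case True
  then have a: "act i J = insert (Suc i) (J - {i})" by (simp add: act_def)
  consider "j \<le> i" | "j = Suc i" | "j > Suc i" by linarith
  then show ?thesis
  proof cases
    case 1
    define B where "B = J \<inter> {j..}"
    have B: "finite B" "i \<in> B" "Suc i \<notin> B" using True assms 1 by (auto simp: B_def)
    have "act i J \<inter> {j..} = insert (Suc i) (B - {i})" using a 1 by (auto simp: B_def)
    then have "height (act i J) j = card (insert (Suc i) (B - {i}))" by (simp only: height_def)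
    also have "\<dots> = Suc (card (B - {i}))" using B by (intro card_insert_disjoint) auto
    also have "\<dots> = card B" by (rule card.remove[symmetric]) (use B in auto)
    also have "\<dots> = height J j" by (simp only: B_def height_def)
    finally show ?thesis using 1 by simp
  next
    case 2
    define B where "B = J \<inter> {j..}"
    have B: "finite B" "Suc i \<notin> B" using True assms by (auto simp: B_def)
    have "act i J \<inter> {j..} = insert (Suc i) B" unfolding a B_def 2 by fastforce
    then have "height (act i J) j = card (insert (Suc i) B)" by (simp only: height_def)
    also have "\<dots> = Suc (card B)" using B by (intro card_insert_disjoint) auto
    also have "card B = height J j" by (simp only: B_def height_def)
    finally show ?thesis using 2 True by simp
  next
    case 3
    then have "act i J \<inter> {j..} = J \<inter> {j..}" unfolding a by fastforce
    then have "height (act i J) j = height J j" by (simp only: height_def)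
    then show ?thesis using 3 by simp
  qed
qed

lemma gale_refl: "finite J \<Longrightarrow> gale_le J J"
  by (simp add: gale_le_def)

lemma gale_trans: "gale_le J K \<Longrightarrow> gale_le K M \<Longrightarrow> gale_le J M"
  unfolding gale_le_def by (metis order_trans)

lemma height_inject:
  assumes "finite J" "finite M" "\<And>j. height J j = height M j"
  shows "J = M"
proof -
  have "j \<in> J \<longleftrightarrow> j \<in> M" for j
    using height_step[OF assms(1), of j] height_step[OF assms(2), of j] assms(3)[of j] assms(3)[of "Suc j"]
    by (auto split: if_splits)
  then show ?thesis by auto
qed

lemma gale_antisym: "gale_le J M \<Longrightarrow> gale_le M J \<Longrightarrow> J = M"
  unfolding gale_le_def by (metis height_inject order_antisym)

lemma gale_act: "finite J \<Longrightarrow> gale_le J (act i J)"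
  by (simp add: gale_le_def height_act)

lemma gale_act_mono: "gale_le J M \<Longrightarrow> gale_le (act i J) (act i M)"
proof -
  assume le: "gale_le J M"
  then have f: "finite J" "finite M" and c: "card J = card M" and h: "height J j \<le> height M j" for j
    by (auto simp: gale_le_def)
  have "height (act i J) j \<le> height (act i M) j" for j
  proof (cases "j = Suc i")
    case True
    \<comment> \<open>If J moves and M does not, equality of heights at i + 1 is impossible: the
      inequality at i would put i into M, hence also i + 1, and then the inequality at i + 2 would
      fail.\<close>
    have "\<not> (i \<in> M \<and> Suc i \<notin> M) \<Longrightarrow> i \<in> J \<Longrightarrow> Suc i \<notin> J \<Longrightarrow> Suc (height J (Suc i)) \<le> height M (Suc i)"
      using h[of i] h[of "Suc i"] h[of "Suc (Suc i)"] height_step[OF f(1), of i] height_step[OF f(1), of "Suc i"]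
        height_step[OF f(2), of i] height_step[OF f(2), of "Suc i"] by (auto split: if_splits)
    then show ?thesis
      using h[of j] True unfolding height_act[OF f(1)] height_act[OF f(2)] by auto
  next
    case False
    then show ?thesis using h[of j] by (simp add: height_act f)
  qed
  with f c show ?thesis by (simp add: gale_le_def)
qed

lemma gale_acts: "finite J \<Longrightarrow> gale_le J (acts ws J)"
proof (induction ws arbitrary: J)
  case (Cons i ws)
  then have "gale_le (act i J) (acts ws (act i J))" by simp
  with gale_act[OF Cons.prems, of i] show ?case unfolding acts_Cons by (rule gale_trans)
qed (simp add: gale_refl)

lemma gale_acts_mono: "gale_le J M \<Longrightarrow> gale_le (acts ws J) (acts ws M)"
  by (induction ws arbitrary: J M) (auto intro: gale_act_mono)

lemma finite_acts [simp]: "finite (acts ws J) \<longleftrightarrow> finite J"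
  by (induction ws arbitrary: J) auto

lemma card_acts [simp]: "card (acts ws J) = card J"
  by (induction ws arbitrary: J) auto

lemma acts_subset: "J \<subseteq> {..<n} \<Longrightarrow> \<forall>i\<in>set ws. Suc i < n \<Longrightarrow> acts ws J \<subseteq> {..<n}"
proof (induction ws arbitrary: J)
  case (Cons i ws)
  then show ?case using act_subset[of J n i] by auto
qed simp

text \<open>The violated inequality can only be the one at i + 1, where J exceeds M by one. The
  inequalities at i and i + 2 then force i + 1 into J and i out of it, so the move can be undone in
  J, which removes the excess.\<close>

lemma gale_le_act_cases:
  assumes "gale_le J (act i M)" "\<not> gale_le J M"
  obtains K where "gale_le K M" "J = act i K"
proof -
  from assms have f: "finite J" "finite M" and c: "card J = card M"
    and h: "height J j \<le> height (act i M) j" for j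
    by (auto simp: gale_le_def)
  from assms(2) f c obtain j where j: "height J j > height M j" by (auto simp: gale_le_def not_le)
  with h[of j] height_act[OF f(2), of i j] have j': "j = Suc i" and iM: "i \<in> M" "Suc i \<notin> M"
    and e: "height J (Suc i) = Suc (height M (Suc i))"
    by (auto split: if_splits)
  have SJ: "Suc i \<in> J"
    using height_step[OF f(1), of "Suc i"] height_step[OF f(2), of "Suc i"] h[of "Suc (Suc i)"] e iM
      height_act[OF f(2), of i "Suc (Suc i)"]
    by (auto split: if_splits)
  have iJ: "i \<notin> J"
    using height_step[OF f(1), of i] height_step[OF f(2), of i] h[of i] e iM
      height_act[OF f(2), of i i]
    by (auto split: if_splits)
  define K where "K = insert i (J - {Suc i})"
  have JK: "J = act i K" using SJ iJ by (auto simp: K_def act_def)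
  have fK: "finite K" using f(1) by (simp add: K_def)
  have cK: "card K = card M" using c card_act[of i K] unfolding JK[symmetric] by simp
  have "height K l \<le> height M l" for l
  proof -
    have "i \<in> K" "Suc i \<notin> K" using iJ SJ by (auto simp: K_def)
    then show ?thesis
      using h[of l] height_act[OF fK, of i l] height_act[OF f(2), of i l] e unfolding JK[symmetric]
      by (auto split: if_splits)
  qed
  with fK cK f have "gale_le K M" by (simp add: gale_le_def)
  with JK that show thesis by blast
qed

text \<open>Principal lower sets go to principal lower sets. Hence what a word reaches from such a
  set is recorded by one maximal element in place of a relation.\<close>

lemma up_Image_downset: "up i `` {J. gale_le J M} = {J. gale_le J (act i M)}"
proof (intro equalityI subsetI)
  fix K assume "K \<in> up i `` {J. gale_le J M}"
  then obtain J where J: "gale_le J M" "K = J \<or> K = act i J" by (auto simp: up_def)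
  have "gale_le M (act i M)" using J(1) gale_act by (simp add: gale_le_def)
  with J show "K \<in> {J. gale_le J (act i M)}"
    using gale_act_mono[of J M i] gale_trans[of J M "act i M"] by auto
next
  fix K assume "K \<in> {J. gale_le J (act i M)}"
  then have K: "gale_le K (act i M)" by simp
  show "K \<in> up i `` {J. gale_le J M}"
  proof (cases "gale_le K M")
    case True
    then show ?thesis by (auto simp: up_def)
  next
    case False
    with K obtain J where "gale_le J M" "K = act i J" by (rule gale_le_act_cases)
    then show ?thesis by (auto simp: up_def)
  qed
qed

lemma reach_Image_downset: "reach ws `` {J. gale_le J M} = {J. gale_le J (acts ws M)}"
proof (induction ws arbitrary: M)
  case (Cons i ws)
  have "reach (i # ws) `` {J. gale_le J M} = reach ws `` (up i `` {J. gale_le J M})"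
    by (simp only: reach_Cons relcomp_Image)
  then show ?case unfolding up_Image_downset Cons.IH by simp
qed simp

text \<open>Nothing lies below the first k places, so this single starting set is itself a lower set
  and \<open>reach_Image_downset\<close> applies to it.\<close>

lemma gale_le_lower: "gale_le J {..<k} \<longleftrightarrow> J = {..<k}"
proof
  assume a: "gale_le J {..<k}"
  have "{..<k} \<inter> {k..} = {}" by auto
  then have "height {..<k} k = 0" by (simp add: height_def)
  moreover from a have "height J k \<le> height {..<k} k" "finite J" "card J = k" by (auto simp: gale_le_def)
  ultimately have "card (J \<inter> {k..}) = 0" by (simp add: height_def)
  with \<open>finite J\<close> have "J \<inter> {k..} = {}" by auto
  then have "J \<subseteq> {..<k}" by (auto simp: disjoint_iff)
  with \<open>card J = k\<close> show "J = {..<k}" by (simp add: card_subset_eq)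
qed (simp add: gale_refl)

lemma reach_lower: "({..<k}, J) \<in> reach ws \<longleftrightarrow> gale_le J (acts ws {..<k})"
  using reach_Image_downset[of ws "{..<k}"] by (auto simp: gale_le_lower)

lemma height_le:
  assumes "J \<subseteq> {..<n}" shows "height J j \<le> card J" "height J j \<le> n - j"
proof -
  have "finite J" using assms finite_subset by blast
  then show "height J j \<le> card J" by (simp add: height_def card_mono)
  have "J \<inter> {j..} \<subseteq> {j..<n}" using assms by auto
  then show "height J j \<le> n - j" unfolding height_def using card_mono[of "{j..<n}"] by fastforce
qed

lemma height_top: "height {n - k..<n} j = min (min k n) (n - j)"
proof -
  have "{n - k..<n} \<inter> {j..} = {max (n - k) j..<n}" by auto
  then show ?thesis by (simp add: height_def)
qed

lemma gale_le_top: "J \<subseteq> {..<n} \<Longrightarrow> card J = k \<Longrightarrow> gale_le J {n - k..<n}"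
  using height_le[of J n] card_mono[of "{..<n}" J] finite_subset[of J "{..<n}"]
  by (auto simp: gale_le_def height_top)

lemma gale_top_eq: "J \<subseteq> {..<n} \<Longrightarrow> card J = k \<Longrightarrow> gale_le {n - k..<n} J \<Longrightarrow> J = {n - k..<n}"
  by (simp add: gale_antisym gale_le_top)

section \<open>Interchanging up-moves and down-moves\<close>

text \<open>A diamond property. Two distinct letters that both move an element of M are not
  adjacent, since one would need a place full and the other the same place free. They act on
  disjoint pairs of places and commute.\<close>

lemma up_commute: "(up i)\<inverse> O up j \<subseteq> up j O (up i)\<inverse>"
proof
  fix x assume "x \<in> (up i)\<inverse> O up j"
  then obtain J L M where x: "x = (J, L)" and J: "J = M \<or> J = act i M" and L: "L = M \<or> L = act j M"
    by (auto simp: up_def)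
  have "\<exists>K. (K = J \<or> K = act j J) \<and> (K = L \<or> K = act i L)"
  proof -
    consider "J = M" | "L = M" | "J = L" | "J \<noteq> M" "L \<noteq> M" "J = act i M" "L = act j M" "i \<noteq> j"
      using J L by blast
    then show ?thesis
    proof cases
      case 1
      show ?thesis by (rule exI[of _ L]) (use L 1 in blast)
    next
      case 2
      show ?thesis by (rule exI[of _ J]) (use J 2 in blast)
    next
      case 3
      then show ?thesis by blast
    next
      case 4
      note JL = 4(1)[unfolded 4(3)] 4(2)[unfolded 4(4)] 4(3,4)
      note ij = 4(5)
      from JL(1,2) have m: "i \<in> M" "Suc i \<notin> M" "j \<in> M" "Suc j \<notin> M" by (auto simp: act_def split: if_splits)
      from m ij have J': "J = insert (Suc i) (M - {i})" "j \<in> J" "Suc j \<notin> J"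
        unfolding JL(3) by (auto simp: act_def)
      from m ij have L': "L = insert (Suc j) (M - {j})" "i \<in> L" "Suc i \<notin> L"
        unfolding JL(4) by (auto simp: act_def)
      have "insert (Suc j) (J - {j}) = insert (Suc i) (L - {i})" unfolding J'(1) L'(1) using m ij by auto
      then have "act j J = act i L" using J'(2,3) L'(2,3) by (simp only: act_def simp_thms if_True)
      then show ?thesis by blast
    qed
  qed
  then show "x \<in> up j O (up i)\<inverse>" by (auto simp: x up_def)
qed

lemma up_reach_commute: "(up i)\<inverse> O reach ws \<subseteq> reach ws O (up i)\<inverse>"
proof (induction ws)
  case (Cons j ws)
  have "(up i)\<inverse> O (up j O reach ws) = ((up i)\<inverse> O up j) O reach ws" by (simp add: O_assoc)
  also have "\<dots> \<subseteq> (up j O (up i)\<inverse>) O reach ws" by (rule relcomp_mono[OF up_commute order_refl])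
  also have "\<dots> = up j O ((up i)\<inverse> O reach ws)" by (simp add: O_assoc)
  also have "\<dots> \<subseteq> up j O (reach ws O (up i)\<inverse>)" by (rule relcomp_mono[OF order_refl Cons])
  finally show ?case by (simp add: O_assoc)
qed simp

lemma reach_commute: "(reach us)\<inverse> O reach ws \<subseteq> reach ws O (reach us)\<inverse>"
proof (induction us)
  case (Cons j us)
  have "(reach (j # us))\<inverse> O reach ws = (reach us)\<inverse> O ((up j)\<inverse> O reach ws)"
    by (simp add: O_assoc converse_relcomp)
  also have "\<dots> \<subseteq> (reach us)\<inverse> O (reach ws O (up j)\<inverse>)" by (rule relcomp_mono[OF order_refl up_reach_commute])
  also have "\<dots> = ((reach us)\<inverse> O reach ws) O (up j)\<inverse>" by (simp add: O_assoc)
  also have "\<dots> \<subseteq> (reach ws O (reach us)\<inverse>) O (up j)\<inverse>" by (rule relcomp_mono[OF Cons order_refl])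
  finally show ?case by (simp add: O_assoc converse_relcomp)
qed simp

section \<open>Repeated passes of a word\<close>

definition wpow :: "nat \<Rightarrow> nat list \<Rightarrow> nat list" where
  "wpow m ws = concat (replicate m ws)"

lemma wpow_0 [simp]: "wpow 0 ws = []"
  and wpow_Suc: "wpow (Suc m) ws = ws @ wpow m ws"
  by (simp_all add: wpow_def)

lemma wpow_Suc': "wpow (Suc m) ws = wpow m ws @ ws"
  by (induction m) (simp_all add: wpow_Suc)

lemma set_wpow: "set (wpow m ws) \<subseteq> set ws"
  by (induction m) (auto simp: wpow_Suc)

lemma reach_append: "reach (us @ vs) = reach us O reach vs"
  by (induction us) (simp_all add: O_assoc)

text \<open>Supplies positivity: a route through m downward copies followed by m upward copies can
  be interleaved into m alternations, which is the form in which the factors occur in a power of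
  A.\<close>

lemma reach_alternating:
  "(reach (wpow m ws))\<inverse> O reach (wpow m ws) \<subseteq> ((reach ws)\<inverse> O reach ws) ^^ m"
proof (induction m)
  case (Suc m)
  let ?R = "reach ws" and ?S = "reach (wpow m ws)"
  have "(reach (wpow (Suc m) ws))\<inverse> O reach (wpow (Suc m) ws) = (?S\<inverse> O ?R\<inverse>) O (?S O ?R)"
    by (subst (1) wpow_Suc, subst wpow_Suc') (simp add: reach_append converse_relcomp)
  also have "\<dots> = ?S\<inverse> O (?R\<inverse> O ?S) O ?R" by (simp add: O_assoc)
  also have "\<dots> \<subseteq> ?S\<inverse> O (?S O ?R\<inverse>) O ?R" by (intro relcomp_mono reach_commute order_refl)
  also have "\<dots> = (?S\<inverse> O ?S) O (?R\<inverse> O ?R)" by (simp add: O_assoc)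
  also have "\<dots> \<subseteq> (?R\<inverse> O ?R) ^^ m O (?R\<inverse> O ?R)" by (rule relcomp_mono[OF Suc order_refl])
  finally show ?case by simp
qed simp

text \<open>The converse bound: a downward pass stays below the maximum already attained, so from
  the lowest set m alternations reach nothing that m upward passes do not.\<close>

lemma alternating_downset:
  "(((reach ws)\<inverse> O reach ws) ^^ m) `` {{..<k}} \<subseteq> {J. gale_le J (acts (wpow m ws) {..<k})}"
proof (induction m)
  case (Suc m)
  let ?D = "{J. gale_le J (acts (wpow m ws) {..<k})}"
  have down: "gale_le J K" if "(J, K) \<in> reach vs" "finite K" for vs J K
    using that
  proof (induction vs arbitrary: J)
    case (Cons i vs)
    then obtain J' where J': "(J, J') \<in> up i" "(J', K) \<in> reach vs" by auto
    then have le: "gale_le J' K" using Cons by blast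
    then have "finite J" using J'(1) by (auto simp: up_def gale_le_def)
    then have "gale_le J J'" using J'(1) gale_act[of J i] by (auto simp: up_def gale_refl)
    then show ?case using le by (rule gale_trans)
  qed (simp add: gale_refl)
  have "(((reach ws)\<inverse> O reach ws) ^^ Suc m) `` {{..<k}}
      = reach ws `` ((reach ws)\<inverse> `` ((((reach ws)\<inverse> O reach ws) ^^ m) `` {{..<k}}))"
    by (simp add: relcomp_Image)
  also have "\<dots> \<subseteq> reach ws `` ((reach ws)\<inverse> `` ?D)" using Suc by (intro Image_mono) auto
  also have "\<dots> \<subseteq> reach ws `` ?D"
  proof (intro Image_mono order_refl subsetI)
    fix J assume "J \<in> (reach ws)\<inverse> `` ?D"
    then obtain K where K: "(J, K) \<in> reach ws" "gale_le K (acts (wpow m ws) {..<k})" by auto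
    then have "gale_le J K" using down[OF K(1)] by (simp add: gale_le_def)
    then show "J \<in> ?D" using K(2) gale_trans by simp
  qed
  also have "\<dots> = {J. gale_le J (acts (wpow (Suc m) ws) {..<k})}"
    by (simp add: reach_Image_downset wpow_Suc')
  finally show ?case .
qed (auto simp: gale_refl)

section \<open>Fixed sets and arrival at the top\<close>

text \<open>Moves only raise a set, so every intermediate set is squeezed between M and the final
  value M.\<close>

lemma acts_fixed:
  assumes "acts ws M = M" "finite M" "i \<in> set ws"
  shows "act i M = M"
  using assms
proof (induction ws)
  case (Cons j ws)
  have "gale_le (act j M) M" using gale_acts[of "act j M" ws] Cons.prems by simp
  then have "act j M = M" using gale_act[of M j] Cons.prems gale_antisym by blast
  with Cons show ?case by auto
qed simp

lemma upward_closed_eq_top: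
  assumes "M \<subseteq> {..<n}" "\<And>i. Suc i < n \<Longrightarrow> i \<in> M \<Longrightarrow> Suc i \<in> M"
  shows "M = {n - card M..<n}"
proof (cases "M = {}")
  case False
  have f: "finite M" using assms(1) finite_subset by blast
  have min: "Min M \<in> M" using False f by simp
  have "Min M + d < n \<Longrightarrow> Min M + d \<in> M" for d
    by (induction d) (use min assms(2) in auto)
  then have "{Min M..<n} \<subseteq> M" by (metis atLeastLessThan_iff le_Suc_ex subsetI)
  moreover have "M \<subseteq> {Min M..<n}" using assms(1) f by auto
  ultimately have M: "M = {Min M..<n}" by auto
  then have "card M = n - Min M" by (metis card_atLeastLessThan)
  moreover have "Min M < n" using min assms(1) by auto
  ultimately show ?thesis using M by simp
qed simp

lemma acts_fixed_full:
  assumes "acts ws M = M" "M \<subseteq> {..<n}" "{..<n - 1} \<subseteq> set ws"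
  shows "M = {n - card M..<n}"
proof (rule upward_closed_eq_top[OF assms(2)])
  fix i assume i: "Suc i < n" "i \<in> M"
  have "act i M = M" by (rule acts_fixed[OF assms(1)]) (use assms i finite_subset[of M "{..<n}"] in auto)
  with i show "Suc i \<in> M" by (auto simp: act_def split: if_splits)
qed

lemma acts_wpow_top_mono:
  assumes "acts (wpow m ws) {..<k} = {n - k..<n}" "m \<le> m'" "k \<le> n" "\<forall>i\<in>set ws. Suc i < n"
  shows "acts (wpow m' ws) {..<k} = {n - k..<n}"
  using assms(2)
proof (induction rule: dec_induct)
  case (step l)
  have "gale_le {n - k..<n} (acts (wpow (Suc l) ws) {..<k})"
    using gale_acts[of "{n - k..<n}" ws] step by (simp add: wpow_Suc')
  moreover have "acts (wpow (Suc l) ws) {..<k} \<subseteq> {..<n}"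
    using assms set_wpow[of "Suc l" ws] by (intro acts_subset) auto
  ultimately show ?case using gale_top_eq by simp
qed (fact assms)

section \<open>Exponents of words\<close>

text \<open>Only what precedes the first z counts, so for two different letters of the word this
  compares first occurrences. That suffices for an upper bound on the number of passes, because
  repetitions only help.\<close>

definition before :: "nat list \<Rightarrow> nat \<Rightarrow> nat \<Rightarrow> bool" where
  "before ws y z \<longleftrightarrow> y \<in> set (takeWhile (\<lambda>x. x \<noteq> z) ws)"

definition drift :: "nat list \<Rightarrow> nat \<Rightarrow> nat" where
  "drift ws i = card {j. j < i \<and> before ws (Suc j) j}"

lemma drift_Suc: "drift ws (Suc i) = drift ws i + (if before ws (Suc i) i then 1 else 0)"
proof -
  have "{j. j < Suc i \<and> before ws (Suc j) j} =
      (if before ws (Suc i) i then insert i {j. j < i \<and> before ws (Suc j) j} else {j. j < i \<and> before ws (Suc j) j})"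
    by (auto simp: less_Suc_eq)
  then show ?thesis by (simp add: drift_def)
qed

lemma drift_mono: "i \<le> j \<Longrightarrow> drift ws i \<le> drift ws j"
  by (induction rule: dec_induct) (auto simp: drift_Suc)

lemma drift_diff: "i \<le> j \<Longrightarrow> drift ws j \<le> drift ws i + (j - i)"
  by (induction rule: dec_induct) (auto simp: drift_Suc)

lemma before_first:
  assumes "y \<notin> set xs"
  shows "before (xs @ y # ys) z y \<longleftrightarrow> z \<in> set xs"
    and "z \<noteq> y \<Longrightarrow> before (xs @ y # ys) y z \<longleftrightarrow> z \<notin> set xs"
proof -
  have "takeWhile (\<lambda>x. x \<noteq> y) (xs @ y # ys) = xs"
    using assms by (induction xs) auto
  then show "before (xs @ y # ys) z y \<longleftrightarrow> z \<in> set xs" by (simp add: before_def)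
  show "before (xs @ y # ys) y z \<longleftrightarrow> z \<notin> set xs" if "z \<noteq> y"
    using assms that unfolding before_def by (induction xs) auto
qed

text \<open>The \<open>p\<close>-th move from \<open>i\<close> to \<open>i + 1\<close> waits for the \<open>p\<close>-th move of letter \<open>i - 1\<close> (supplying the
  element) and the \<open>(p - 1)\<close>-st move of letter \<open>i + 1\<close> (freeing the place), each costing an extra pass
  if that letter is read later in the word. Both costs are differences of \<open>drift\<close>, so the move
  happens by pass \<open>p + drift i - drift (k - 1)\<close>. The number of moves is the height at \<open>i + 1\<close>.\<close>

definition front :: "nat \<Rightarrow> nat \<Rightarrow> nat list \<Rightarrow> nat \<Rightarrow> nat \<Rightarrow> int" where
  "front n k ws m i = min (min (int k) (int n - int (Suc i))) (int m - int (drift ws i) + int (drift ws (k - 1)))"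

text \<open>Induction inside a pass: a letter in \<open>xs\<close> has had its turn and satisfies
  the bound for m + 1, any other still the bound for m. When y is read for the first time, either it
  moves and gains one; or place y is empty, and the height at y + 1 equals the one at y, controlled
  by letter y - 1; or place y + 1 is full, and the height there exceeds by one that at y + 2,
  controlled by letter y + 1. The increment of \<open>drift\<close> records whether this neighbour
  has already been read.\<close>

lemma front_step:
  assumes J: "J \<subseteq> {..<n}" "card J = k" and y: "Suc y < n" and ws: "ws = xs @ y # ys"
    and inv: "\<And>i. Suc i < n \<Longrightarrow> int (height J (Suc i)) \<ge> front n k ws (if i \<in> set xs then Suc m else m) i"
    and i: "Suc i < n"
  shows "int (height (act y J) (Suc i)) \<ge> front n k ws (if i \<in> set (xs @ [y]) then Suc m else m) i"
proof -
  have f: "finite J" using J(1) finite_subset by blast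
  have mono: "height J (Suc i) \<le> height (act y J) (Suc i)" by (simp add: height_act f)
  show ?thesis
  proof (cases "i = y \<and> y \<notin> set xs")
    case False
    then show ?thesis using inv[OF i] mono by auto
  next
    case True
    then have iy: "i = y" and new: "y \<notin> set xs" by auto
    have goal: "int (height (act y J) (Suc y)) \<ge> front n k ws (Suc m) y"
    proof -
      consider (move) "y \<in> J" "Suc y \<notin> J" | (out) "y \<notin> J" | (blocked) "Suc y \<in> J" by blast
      then show ?thesis
      proof cases
        case move
        then have "int (height (act y J) (Suc y)) = int (height J (Suc y)) + 1" by (simp add: height_act f)
        moreover have "int (height J (Suc y)) \<ge> front n k ws m y" using inv[OF y] new by simp
        ultimately show ?thesis by (auto simp: front_def)
      next
        case out
        then have e: "height (act y J) (Suc y) = height J y"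
          using height_step[OF f, of y] by (simp add: height_act f)
        show ?thesis
        proof (cases y)
          case 0
          then show ?thesis using e J by (simp add: height_0 front_def)
        next
          case (Suc x)
          have "int (height J y) \<ge> front n k ws (if x \<in> set xs then Suc m else m) x"
            using inv[of x] y Suc by simp
          moreover have "drift ws y = drift ws x + (if x \<in> set xs then 0 else 1)"
            using before_first(2)[OF new, of x ys] Suc ws by (simp add: drift_Suc)
          ultimately show ?thesis unfolding e using Suc by (auto simp: front_def split: if_splits)
        qed
      next
        case blocked
        then have e: "height (act y J) (Suc y) = height J (Suc (Suc y)) + 1"
          using height_step[OF f, of "Suc y"] by (simp add: height_act f)
        show ?thesis
        proof (cases "Suc (Suc y) < n")
          case False
          then show ?thesis unfolding e using y by (simp add: front_def)
        next
          case True
          have "int (height J (Suc (Suc y))) \<ge> front n k ws (if Suc y \<in> set xs then Suc m else m) (Suc y)"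
            using inv[of "Suc y"] True by simp
          moreover have "drift ws (Suc y) = drift ws y + (if Suc y \<in> set xs then 1 else 0)"
            using before_first(1)[OF new, of ys "Suc y"] ws by (simp add: drift_Suc)
          ultimately show ?thesis unfolding e by (auto simp: front_def split: if_splits)
        qed
      qed
    qed
    then show ?thesis using iy by simp
  qed
qed

lemma front_pass:
  assumes J: "J \<subseteq> {..<n}" "card J = k" and ws: "ws = xs @ zs" "\<forall>i\<in>set ws. Suc i < n"
    and inv: "\<And>i. Suc i < n \<Longrightarrow> int (height J (Suc i)) \<ge> front n k ws m i"
    and i: "Suc i < n"
  shows "int (height (acts xs J) (Suc i)) \<ge> front n k ws (if i \<in> set xs then Suc m else m) i"
  using ws(1) i
proof (induction xs arbitrary: zs i rule: rev_induct)
  case Nil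
  then show ?case using inv by simp
next
  case (snoc y xs)
  have y: "Suc y < n" using snoc.prems ws(2) by simp
  have "acts xs J \<subseteq> {..<n}" using acts_subset[OF J(1), of xs] ws(2) snoc.prems(1) by auto
  from front_step[OF this _ y, of k ws xs zs m i] show ?case
    using snoc.IH[of "y # zs"] snoc.prems J by simp
qed

lemma full_valid: "set ws = {..<n - 1} \<Longrightarrow> \<forall>i\<in>set ws. Suc i < n"
  by (simp add: less_diff_conv)

lemma acts_wpow_subset:
  assumes "k \<le> n" "set ws = {..<n - 1}"
  shows "acts (wpow m ws) {..<k} \<subseteq> {..<n}"
proof (rule acts_subset)
  show "{..<k} \<subseteq> {..<n}" using assms by simp
  show "\<forall>i\<in>set (wpow m ws). Suc i < n" using set_wpow[of m ws] full_valid[OF assms(2)] by blast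
qed

lemma front_passes:
  assumes k: "k \<le> n" and ws: "set ws = {..<n - 1}" and i: "Suc i < n"
  shows "int (height (acts (wpow m ws) {..<k}) (Suc i)) \<ge> front n k ws m i"
  using i
proof (induction m arbitrary: i)
  \<comment> \<open>Initially the height at i + 1 is k - (i + 1), cut off at zero. That
    \<open>drift\<close> never decreases and grows by at most one per letter is exactly what the
    bound requires here.\<close>
  case 0
  have "{..<k} \<inter> {Suc i..} = {Suc i..<k}" by auto
  then have h: "height {..<k} (Suc i) = k - Suc i" by (simp add: height_def)
  show ?case
  proof (cases "i < k")
    case True
    then have "i \<le> k - 1" by simp
    from drift_diff[OF this, of ws] True
    have "int (drift ws (k - 1)) - int (drift ws i) \<le> int k - int (Suc i)" by linarith
    with True h show ?thesis by (simp add: front_def)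
  next
    case False
    then have "k - 1 \<le> i" by simp
    from drift_mono[OF this, of ws] False h show ?thesis by (simp add: front_def)
  qed
next
  case (Suc m)
  have sub: "acts (wpow m ws) {..<k} \<subseteq> {..<n}"
    using k by (intro acts_wpow_subset[OF _ ws]) simp
  note v = full_valid[OF ws]
  have "int (height (acts ws (acts (wpow m ws) {..<k})) (Suc i)) \<ge> front n k ws (if i \<in> set ws then Suc m else m) i"
    by (rule front_pass[OF sub card_acts[THEN trans, OF card_lessThan] append_Nil2[symmetric] v Suc.IH Suc.prems])
  moreover have "i \<in> set ws" using Suc.prems unfolding ws by simp
  ultimately show ?case by (simp only: wpow_Suc' acts_append if_True)
qed

text \<open>The critical index is n - k - 1, the last move into the lowest place of the top block.
  For smaller i the full height k is needed as well but \<open>drift\<close> is no larger; for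
  larger i \<open>drift\<close> gains at most one per step while the required height loses
  one.\<close>

lemma acts_wpow_top:
  assumes k: "1 \<le> k" "k < n" and ws: "set ws = {..<n - 1}"
    and m: "m + drift ws (k - 1) = k + drift ws (n - k - 1)"
  shows "acts (wpow m ws) {..<k} = {n - k..<n}"
proof (rule gale_top_eq)
  let ?J = "acts (wpow m ws) {..<k}"
  show sub: "?J \<subseteq> {..<n}"
    using k by (intro acts_wpow_subset[OF _ ws]) simp
  show card: "card ?J = k" by simp
  have "height {n - k..<n} j \<le> height ?J j" for j
  proof (cases j)
    case 0
    then show ?thesis using k by (simp add: height_0)
  next
    case (Suc i)
    show ?thesis
    proof (cases "Suc i < n")
      case True
      have "int (height ?J (Suc i)) \<ge> front n k ws m i" using front_passes[of k n ws i m] k ws True by simp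
      moreover have "front n k ws m i \<ge> min (int k) (int n - int (Suc i))"
      proof (cases "i \<le> n - k - 1")
        case True
        then show ?thesis using drift_mono[OF True, of ws] m by (simp add: front_def)
      next
        case False
        then show ?thesis using drift_diff[of "n - k - 1" i ws] m k by (simp add: front_def)
      qed
      ultimately show ?thesis using Suc k True by (simp add: height_top)
    next
      case False
      then show ?thesis using Suc by (simp add: height_top)
    qed
  qed
  then show "gale_le {n - k..<n} ?J" using k by (simp add: gale_le_def)
qed

section \<open>The exponent of a word\<close>

definition expo :: "nat \<Rightarrow> nat list \<Rightarrow> nat \<Rightarrow> nat" where
  "expo n ws k = (LEAST m. 1 \<le> m \<and> acts (wpow m ws) {..<k} = {n - k..<n})"

lemma expo_le:
  assumes k: "1 \<le> k" "k < n" and ws: "set ws = {..<n - 1}"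
  shows "expo n ws k + drift ws (k - 1) \<le> k + drift ws (n - k - 1)"
proof -
  define m where "m = k + drift ws (n - k - 1) - drift ws (k - 1)"
  have "drift ws (k - 1) < k + drift ws (n - k - 1)"
  proof (cases "k \<le> n - k")
    case True
    then have "k - 1 \<le> n - k - 1" by simp
    from drift_mono[OF this, of ws] show ?thesis using k by linarith
  next
    case False
    then have "n - k - 1 \<le> k - 1" by simp
    from drift_diff[OF this, of ws] show ?thesis using k False by linarith
  qed
  then have m: "m + drift ws (k - 1) = k + drift ws (n - k - 1)" "1 \<le> m" by (auto simp: m_def)
  have "expo n ws k \<le> m"
    unfolding expo_def by (rule Least_le) (use m acts_wpow_top[OF k ws] in auto)
  with m show ?thesis by simp
qed

text \<open>For k the bound in \<open>expo_le\<close> has \<open>drift\<close> at k - 1 on one side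
  and at n - k - 1 on the other. For n - k the two change sides, so they cancel in the sum.\<close>

lemma expo_add_le:
  assumes k: "1 \<le> k" "k < n" and ws: "set ws = {..<n - 1}"
  shows "expo n ws k + expo n ws (n - k) \<le> n"
proof -
  have eq: "n - (n - k) - 1 = k - 1" using k by simp
  have "expo n ws (n - k) + drift ws (n - k - 1) \<le> (n - k) + drift ws (k - 1)"
    using expo_le[of "n - k" n ws, unfolded eq] k ws by simp
  with expo_le[OF assms] show ?thesis using k by linarith
qed

lemma expo_works:
  assumes k: "1 \<le> k" "k < n" and ws: "set ws = {..<n - 1}"
  shows "1 \<le> expo n ws k" "acts (wpow (expo n ws k) ws) {..<k} = {n - k..<n}"
proof -
  have "drift ws (k - 1) \<le> k + drift ws (n - k - 1)" using expo_le[OF assms] by simp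
  then obtain m where "m + drift ws (k - 1) = k + drift ws (n - k - 1)" by (metis add.commute le_iff_add)
  then have m: "acts (wpow m ws) {..<k} = {n - k..<n}" using acts_wpow_top[OF assms] by simp
  moreover have "acts (wpow (Suc m) ws) {..<k} = {n - k..<n}"
    by (rule acts_wpow_top_mono[OF m _ _ full_valid[OF ws]]) (use k in simp_all)
  ultimately have "\<exists>m. 1 \<le> m \<and> acts (wpow m ws) {..<k} = {n - k..<n}" by (intro exI[of _ "Suc m"]) simp
  from LeastI_ex[OF this] show "1 \<le> expo n ws k" "acts (wpow (expo n ws k) ws) {..<k} = {n - k..<n}"
    by (simp_all add: expo_def)
qed

lemma wpow_top_iff:
  assumes k: "1 \<le> k" "k < n" and ws: "set ws = {..<n - 1}"
  shows "acts (wpow m ws) {..<k} = {n - k..<n} \<longleftrightarrow> expo n ws k \<le> m"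
proof
  assume a: "acts (wpow m ws) {..<k} = {n - k..<n}"
  have "m \<noteq> 0"
  proof
    assume "m = 0"
    with a have "{..<k} = {n - k..<n}" by simp
    moreover have "0 \<in> {..<k}" using k by simp
    ultimately show False using k by auto
  qed
  with a show "expo n ws k \<le> m" unfolding expo_def by (intro Least_le) simp
next
  assume "expo n ws k \<le> m"
  then show "acts (wpow m ws) {..<k} = {n - k..<n}"
    by (rule acts_wpow_top_mono[OF expo_works(2)[OF assms] _ _ full_valid[OF ws]]) (use k in simp_all)
qed

text \<open>\<open>remdups\<close> omits all copies but the last. Omitting a letter leaves a lower
  set, and the remaining moves preserve the order.\<close>

lemma gale_acts_remdups: "gale_le J M \<Longrightarrow> gale_le (acts (remdups ws) J) (acts ws M)"
proof (induction ws arbitrary: J M)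
  case (Cons i ws)
  show ?case
  proof (cases "i \<in> set ws")
    case True
    have "gale_le J (act i M)" using gale_trans[OF Cons.prems gale_act] Cons.prems by (simp add: gale_le_def)
    then show ?thesis using Cons.IH True by simp
  next
    case False
    then show ?thesis using Cons.IH[OF gale_act_mono[OF Cons.prems]] by simp
  qed
qed simp

lemma gale_wpow_remdups: "gale_le J M \<Longrightarrow> gale_le (acts (wpow m (remdups ws)) J) (acts (wpow m ws) M)"
  by (induction m) (simp_all add: wpow_Suc' gale_acts_remdups)

text \<open>This is the comparison with the dominating matrix B, whose word contains each letter
  once.\<close>

lemma expo_remdups:
  assumes k: "1 \<le> k" "k < n" and ws: "set ws = {..<n - 1}"
  shows "expo n ws k \<le> expo n (remdups ws) k"
proof -
  have ws': "set (remdups ws) = {..<n - 1}" using ws by simp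
  define m where "m = expo n (remdups ws) k"
  have "gale_le (acts (wpow m (remdups ws)) {..<k}) (acts (wpow m ws) {..<k})"
    by (rule gale_wpow_remdups[OF gale_refl]) simp
  then have le: "gale_le {n - k..<n} (acts (wpow m ws) {..<k})"
    using expo_works(2)[OF k ws'] by (simp add: m_def)
  have "acts (wpow m ws) {..<k} \<subseteq> {..<n}"
    using k by (intro acts_wpow_subset[OF _ ws]) simp
  from gale_top_eq[OF this _ le] have "acts (wpow m ws) {..<k} = {n - k..<n}" by simp
  then show ?thesis unfolding m_def by (rule wpow_top_iff[OF assms, THEN iffD1])
qed

section \<open>Permutations and the length inequality\<close>

text \<open>Demazure products with an adjacent transposition: \<open>val_step\<close> acts on
  values, \<open>pos_step\<close> on positions, in both cases only if this adds an inversion. In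
  \<open>perm\<close> an appended letter acts on values; by \<open>perm_Cons\<close> a prepended one
  acts on positions.\<close>

definition val_step :: "nat \<Rightarrow> (nat \<Rightarrow> nat) \<Rightarrow> nat \<Rightarrow> nat" where
  "val_step j p = (if inv_into UNIV p j < inv_into UNIV p (Suc j) then transpose j (Suc j) \<circ> p else p)"

definition pos_step :: "nat \<Rightarrow> (nat \<Rightarrow> nat) \<Rightarrow> nat \<Rightarrow> nat" where
  "pos_step i p = (if p i < p (Suc i) then p \<circ> transpose i (Suc i) else p)"

definition perm :: "nat list \<Rightarrow> nat \<Rightarrow> nat" where
  "perm ws = fold val_step ws id"

lemma bij_val_step: "bij p \<Longrightarrow> bij (val_step j p)"
  by (simp add: val_step_def bij_comp)

lemma bij_fold_val_step: "bij p \<Longrightarrow> bij (fold val_step ws p)"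
  by (induction ws arbitrary: p) (simp_all add: bij_val_step)

lemma bij_perm: "bij (perm ws)"
  by (simp add: perm_def bij_fold_val_step)

lemma transpose_less:
  assumes "a \<noteq> b" "\<not> (a = j \<and> b = Suc j)" "\<not> (a = Suc j \<and> b = j)"
  shows "transpose j (Suc j) a < transpose j (Suc j) b \<longleftrightarrow> a < b"
  using assms by (auto simp: transpose_def)

text \<open>This is the associativity of the Demazure product. The two steps interfere only if the
  positions i and i + 1 carry the values j and j + 1. In increasing order both make the same swap
  and the second one is idle; in decreasing order neither acts. Otherwise each step leaves the
  comparison made by the other unchanged.\<close>

lemma pos_val_commute:
  assumes p: "bij p"
  shows "pos_step i (val_step j p) = val_step j (pos_step i p)"
proof -
  let ?s = "transpose j (Suc j)" and ?t = "transpose i (Suc i)"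
  define a b c d where "a = p i" and "b = p (Suc i)" and "c = inv_into UNIV p j" and "d = inv_into UNIV p (Suc j)"
  note defs = a_def b_def c_def d_def
  have ab: "a \<noteq> b" unfolding defs using p by (metis bij_is_inj injD n_not_Suc_n)
  have cd: "c \<noteq> d" unfolding defs using p by (metis bij_inv_eq_iff n_not_Suc_n)
  have inv_s: "inv_into UNIV (?s \<circ> p) = inv_into UNIV p \<circ> ?s" using p by (simp add: o_inv_distrib)
  have inv_t: "inv_into UNIV (p \<circ> ?t) = ?t \<circ> inv_into UNIV p" using p by (simp add: o_inv_distrib)
  have key: "x = inv_into UNIV p y \<longleftrightarrow> p x = y" for x y using p by (metis bij_inv_eq_iff)
  have ac: "c = i \<longleftrightarrow> a = j" "d = Suc i \<longleftrightarrow> b = Suc j" "c = Suc i \<longleftrightarrow> b = j" "d = i \<longleftrightarrow> a = Suc j"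
    unfolding defs by (metis key)+
  show ?thesis
  proof (cases "(a = j \<and> b = Suc j) \<or> (a = Suc j \<and> b = j)")
    case True
    then show ?thesis
    proof
      assume h: "a = j \<and> b = Suc j"
      then have "c = i" "d = Suc i" using ac by auto
      then have 1: "val_step j p = ?s \<circ> p" by (simp add: val_step_def c_def[symmetric] d_def[symmetric])
      have 2: "pos_step i p = p \<circ> ?t" using h by (simp add: pos_step_def a_def[symmetric] b_def[symmetric])
      have 3: "?s \<circ> p = p \<circ> ?t"
      proof
        fix x
        consider "x = i" | "x = Suc i" | "p x \<noteq> j" "p x \<noteq> Suc j" "x \<noteq> i" "x \<noteq> Suc i"
          using h p unfolding a_def b_def by (metis bij_is_inj inj_eq)
        then show "(?s \<circ> p) x = (p \<circ> ?t) x"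
          using h by cases (auto simp: a_def b_def)
      qed
      have 4: "(?s \<circ> p) i = Suc j" "(?s \<circ> p) (Suc i) = j" using h by (auto simp: a_def b_def)
      have 5: "inv_into UNIV (p \<circ> ?t) j = Suc i" "inv_into UNIV (p \<circ> ?t) (Suc j) = i"
        unfolding inv_t using \<open>c = i\<close> \<open>d = Suc i\<close> by (auto simp: c_def d_def)
      show ?thesis unfolding 1 2 using 3 4 5 by (simp add: pos_step_def val_step_def)
    next
      assume h: "a = Suc j \<and> b = j"
      then have "c = Suc i" "d = i" using ac by auto
      then have 1: "val_step j p = p" by (simp add: val_step_def c_def[symmetric] d_def[symmetric])
      have 2: "pos_step i p = p" using h by (simp add: pos_step_def a_def[symmetric] b_def[symmetric])
      show ?thesis using 1 2 by simp
    qed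
  next
    case False
    then have s: "?s a < ?s b \<longleftrightarrow> a < b" using ab by (intro transpose_less) auto
    have t: "?t c < ?t d \<longleftrightarrow> c < d" using False ac cd by (intro transpose_less) auto
    have 1: "(?s \<circ> p) i < (?s \<circ> p) (Suc i) \<longleftrightarrow> p i < p (Suc i)" using s by (simp add: a_def b_def)
    have 2: "inv_into UNIV (p \<circ> ?t) j < inv_into UNIV (p \<circ> ?t) (Suc j) \<longleftrightarrow> inv_into UNIV p j < inv_into UNIV p (Suc j)"
      unfolding inv_t using t by (simp add: c_def d_def)
    show ?thesis
      using 1 2 by (cases "p i < p (Suc i)"; cases "inv_into UNIV p j < inv_into UNIV p (Suc j)") (simp_all add: pos_step_def val_step_def o_assoc)
  qed
qed

lemma perm_Nil [simp]: "perm [] = id"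
  by (simp add: perm_def)

lemma perm_append: "perm (us @ vs) = fold val_step vs (perm us)"
  by (simp add: perm_def)

text \<open>On the identity a value step and a position step agree. Commuting the position step
  through the value steps of \<open>ws\<close> makes the first letter the last to act.\<close>

lemma perm_Cons: "perm (i # ws) = pos_step i (perm ws)"
proof -
  have "bij p \<Longrightarrow> fold val_step ws (pos_step i p) = pos_step i (fold val_step ws p)" for p
    by (induction ws arbitrary: p) (simp_all add: pos_val_commute[symmetric] bij_val_step)
  from this[of id] have "fold val_step ws (pos_step i id) = pos_step i (perm ws)" by (simp add: perm_def)
  moreover have "pos_step i id = val_step i id" by (simp add: pos_step_def val_step_def)
  ultimately show ?thesis by (simp add: perm_def)
qed

text \<open>A permutation is viewed as the flag of its images of \<open>{..<k}\<close>. If j stands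
  before j + 1, each member of the flag containing j + 1 also contains j, and the swap is the greedy
  move on all members at once; otherwise that move is idle on all of them.\<close>

lemma val_step_image:
  assumes p: "bij p"
  shows "val_step j p ` {..<k} = act j (p ` {..<k})"
proof -
  define M where "M = p ` {..<k}"
  have mem: "x \<in> M \<longleftrightarrow> inv_into UNIV p x < k" for x
  proof
    assume "x \<in> M"
    then show "inv_into UNIV p x < k" using inv_f_f[OF bij_is_inj[OF p]] by (auto simp: M_def)
  next
    assume "inv_into UNIV p x < k"
    then show "x \<in> M" using surj_f_inv_f[OF bij_is_surj[OF p], of x]
      unfolding M_def by (intro rev_image_eqI[of "inv_into UNIV p x"]) auto
  qed
  let ?s = "transpose j (Suc j)"
  have img: "?s ` M = {x. ?s x \<in> M}"
    by (auto intro!: rev_image_eqI)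
  have ne: "inv_into UNIV p j \<noteq> inv_into UNIV p (Suc j)" using p by (metis bij_inv_eq_iff n_not_Suc_n)
  show ?thesis
  proof (cases "inv_into UNIV p j < inv_into UNIV p (Suc j)")
    case True
    then have imp: "Suc j \<in> M \<Longrightarrow> j \<in> M" by (simp add: mem)
    have "val_step j p ` {..<k} = ?s ` M" using True by (simp add: val_step_def M_def image_comp)
    also have "\<dots> = act j M"
      unfolding img using imp by (auto simp: act_def transpose_def split: if_splits)
    finally show ?thesis by (simp add: M_def)
  next
    case False
    then have "j \<in> M \<Longrightarrow> Suc j \<in> M" using ne by (simp add: mem)
    then have "act j M = M" by (auto simp: act_def)
    then show ?thesis using False by (simp add: val_step_def M_def)
  qed
qed

lemma fold_val_step_image: "bij p \<Longrightarrow> fold val_step ws p ` {..<k} = acts ws (p ` {..<k})"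
  by (induction ws arbitrary: p) (simp_all add: val_step_image bij_val_step)

lemma perm_image: "perm ws ` {..<k} = acts ws {..<k}"
  by (simp add: perm_def fold_val_step_image)

lemma pos_step_image:
  assumes "Suc i = k \<Longrightarrow> \<not> p i < p (Suc i)"
  shows "pos_step i p ` {..<k} = p ` {..<k}"
proof (cases "p i < p (Suc i)")
  case True
  then have "Suc i \<noteq> k" using assms by blast
  then have "transpose i (Suc i) ` {..<k} = {..<k}"
    by (auto simp: transpose_def image_iff split: if_splits)
  then show ?thesis using True by (metis image_comp pos_step_def)
qed (simp add: pos_step_def)

section \<open>Ascents, inversions and length\<close>

definition ascent :: "nat \<Rightarrow> (nat \<Rightarrow> nat) \<Rightarrow> bool" where
  "ascent i p \<longleftrightarrow> p i < p (Suc i)"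

text \<open>A value step alters only the comparison of j with j + 1, and it swaps them only if j
  stands first. So it can create a descent but never undo one.\<close>

lemma descent_val_step:
  assumes p: "bij p" and "\<not> ascent i p"
  shows "\<not> ascent i (val_step j p)"
proof -
  have ne: "p i \<noteq> p (Suc i)" using p by (metis bij_is_inj injD n_not_Suc_n)
  then have lt: "p (Suc i) < p i" using assms by (simp add: ascent_def)
  show ?thesis
  proof (cases "inv_into UNIV p j < inv_into UNIV p (Suc j)")
    case True
    have "\<not> (p (Suc i) = j \<and> p i = Suc j)"
    proof
      assume "p (Suc i) = j \<and> p i = Suc j"
      then have "inv_into UNIV p j = Suc i" "inv_into UNIV p (Suc j) = i" using p by (metis bij_inv_eq_iff)+
      with True show False by simp
    qed
    then have "transpose j (Suc j) (p (Suc i)) < transpose j (Suc j) (p i)"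
      using lt ne by (subst transpose_less) auto
    then show ?thesis using True by (simp add: val_step_def ascent_def)
  next
    case False
    then show ?thesis using assms by (simp add: val_step_def)
  qed
qed

lemma descent_fold_val_step:
  "bij p \<Longrightarrow> \<not> ascent i p \<Longrightarrow> \<not> ascent i (fold val_step ws p)"
  by (induction ws arbitrary: p) (simp_all add: descent_val_step bij_val_step)

definition inversions :: "nat \<Rightarrow> (nat \<Rightarrow> nat) \<Rightarrow> (nat \<times> nat) set" where
  "inversions n p = {(a, b). a < b \<and> b < n \<and> p b < p a}"

lemma finite_inversions: "finite (inversions n p)"
  by (rule finite_subset[of _ "{..<n} \<times> {..<n}"]) (auto simp: inversions_def)

lemma card_inversions_swap:
  assumes i: "Suc i < n" and asc: "p i < p (Suc i)"
  shows "card (inversions n (p \<circ> transpose i (Suc i))) = Suc (card (inversions n p))"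
proof -
  let ?t = "transpose i (Suc i)"
  let ?f = "\<lambda>(a, b). (?t a, ?t b)"
  have inj: "inj_on ?f (inversions n p)"
    by (rule inj_onI) (auto simp: transpose_eq_iff)
  have lt: "?t a < ?t b \<longleftrightarrow> a < b" if "a \<noteq> b" "(a, b) \<noteq> (i, Suc i)" "(b, a) \<noteq> (i, Suc i)" for a b
    using that by (intro transpose_less) auto
  have bound: "?t b < n \<longleftrightarrow> b < n" for b using i by (auto simp: transpose_def)
  have "inversions n (p \<circ> ?t) = insert (i, Suc i) (?f ` inversions n p)"
  proof (intro equalityI subsetI)
    fix x assume x: "x \<in> inversions n (p \<circ> ?t)"
    obtain a b where ab: "x = (a, b)" by (cases x)
    show "x \<in> insert (i, Suc i) (?f ` inversions n p)"
    proof (cases "(a, b) = (i, Suc i)")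
      case False
      have *: "a < b" "b < n" "p (?t b) < p (?t a)" using x ab by (auto simp: inversions_def)
      then have "(?t a, ?t b) \<in> inversions n p" using lt[of a b] bound False by (auto simp: inversions_def)
      moreover have "x = ?f (?t a, ?t b)" by (simp add: ab)
      ultimately show ?thesis by blast
    qed (simp add: ab)
  next
    fix x assume x: "x \<in> insert (i, Suc i) (?f ` inversions n p)"
    show "x \<in> inversions n (p \<circ> ?t)"
    proof (cases "x = (i, Suc i)")
      case True
      then show ?thesis using i asc by (simp add: inversions_def)
    next
      case False
      then obtain a b where ab: "x = (?t a, ?t b)" "a < b" "b < n" "p b < p a"
        using x by (auto simp: inversions_def)
      have "(a, b) \<noteq> (i, Suc i)" using ab asc by auto
      then show ?thesis using ab lt[of a b] bound by (auto simp: inversions_def)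
    qed
  qed
  moreover have "(i, Suc i) \<notin> ?f ` inversions n p"
  proof
    assume "(i, Suc i) \<in> ?f ` inversions n p"
    then obtain a b where "i = ?t a" "Suc i = ?t b" "a < b" by (auto simp: inversions_def)
    then have "a = Suc i" "b = i" by (metis transpose_involutory transpose_apply_first transpose_apply_second)+
    with \<open>a < b\<close> show False by simp
  qed
  ultimately show ?thesis by (simp add: finite_inversions card_image[OF inj])
qed

definition perm_length :: "nat \<Rightarrow> nat list \<Rightarrow> nat" where
  "perm_length n ws = card (inversions n (perm ws))"

lemma perm_length_Nil [simp]: "perm_length n [] = 0"
proof -
  have "inversions n id = {}" by (auto simp: inversions_def)
  then show ?thesis by (simp add: perm_length_def)
qed

lemma perm_length_Cons:
  "Suc i < n \<Longrightarrow> perm_length n (i # ws) = perm_length n ws + (if ascent i (perm ws) then 1 else 0)"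
  by (simp add: perm_length_def perm_Cons pos_step_def ascent_def card_inversions_swap)

lemma perm_length_le: "\<forall>i\<in>set ws. Suc i < n \<Longrightarrow> perm_length n ws \<le> length ws"
  by (induction ws) (simp_all add: perm_length_Cons)

lemma inj_image_last: "inj p \<Longrightarrow> p ` {..<Suc k} - p ` {..<k} = {p k :: nat}" for p :: "nat \<Rightarrow> nat"
  by (auto simp: lessThan_Suc inj_eq)

lemma perm_eqI:
  assumes "\<And>k. acts us {..<k} = acts vs {..<k}"
  shows "perm us = perm vs"
proof
  fix k
  have eq: "perm us ` {..<m} = perm vs ` {..<m}" for m using assms by (simp add: perm_image)
  have "{perm us k} = {perm vs k}"
    using inj_image_last[OF bij_is_inj[OF bij_perm[of us]], of k]
      inj_image_last[OF bij_is_inj[OF bij_perm[of vs]], of k] eq by metis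
  then show "perm us k = perm vs k" by simp
qed


section \<open>Letters that lengthen a word when prepended\<close>

text \<open>Prepending \<open>ws\<close> to \<open>us\<close> adds its letters from right to left,
  and a position belongs to this set if its letter acts at its turn. Positions are recorded instead
  of letters, so that the cardinality is the gain in length even if letters repeat.\<close>

definition effective :: "nat list \<Rightarrow> nat list \<Rightarrow> nat set" where
  "effective ws us = {t. t < length ws \<and> ascent (ws ! t) (perm (drop (Suc t) ws @ us))}"

lemma finite_effective: "finite (effective ws us)"
  by (simp add: effective_def)

lemma effective_Cons:
  "effective (i # ws) us = (if ascent i (perm (ws @ us)) then {0} else {}) \<union> Suc ` effective ws us"
proof -
  have "t \<in> effective (i # ws) us \<longleftrightarrow>
      t \<in> (if ascent i (perm (ws @ us)) then {0} else {}) \<union> Suc ` effective ws us" for t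
    by (cases t) (auto simp: effective_def)
  then show ?thesis by blast
qed

lemma perm_length_append:
  assumes "\<forall>i\<in>set ws. Suc i < n"
  shows "perm_length n (ws @ us) = perm_length n us + card (effective ws us)"
  using assms
proof (induction ws)
  case Nil
  then show ?case by (simp add: effective_def)
next
  case (Cons i ws)
  have "card (effective (i # ws) us) = (if ascent i (perm (ws @ us)) then 1 else 0) + card (effective ws us)"
    unfolding effective_Cons
    by (subst card_Un_disjoint) (auto simp: finite_effective card_image)
  then show ?case using Cons by (simp add: perm_length_Cons)
qed

text \<open>Appending preserves descents, so a position that is idle in front of \<open>us\<close>
  is idle in front of every continuation. Thus a letter acting at no more than one position in the
  second pass does so in all later passes too.\<close>

lemma effective_antimono: "effective ws (us @ vs) \<subseteq> effective ws us"
proof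
  fix t assume t: "t \<in> effective ws (us @ vs)"
  have "perm (drop (Suc t) ws @ us @ vs) = fold val_step vs (perm (drop (Suc t) ws @ us))"
    using perm_append[of "drop (Suc t) ws @ us" vs] by simp
  then show "t \<in> effective ws us"
    using t descent_fold_val_step[OF bij_perm[of "drop (Suc t) ws @ us"], of "ws ! t" vs]
    by (auto simp: effective_def)
qed

lemma image_unchanged:
  assumes "i \<notin> (!) ws ` effective ws us"
  shows "perm (ws @ us) ` {..<Suc i} = perm us ` {..<Suc i}"
  using assms
proof (induction ws)
  case (Cons j ws)
  have "i \<notin> (!) ws ` effective ws us"
  proof
    assume "i \<in> (!) ws ` effective ws us"
    then obtain t where "t \<in> effective ws us" "i = ws ! t" by auto
    then have "Suc t \<in> effective (j # ws) us" "i = (j # ws) ! Suc t" by (auto simp: effective_Cons)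
    with Cons.prems show False by blast
  qed
  then have IH: "perm (ws @ us) ` {..<Suc i} = perm us ` {..<Suc i}" by (rule Cons.IH)
  have "perm ((j # ws) @ us) ` {..<Suc i} = perm (ws @ us) ` {..<Suc i}"
    unfolding append_Cons perm_Cons
  proof (rule pos_step_image)
    assume "Suc j = Suc i"
    show "\<not> perm (ws @ us) j < perm (ws @ us) (Suc j)"
    proof
      assume "perm (ws @ us) j < perm (ws @ us) (Suc j)"
      then have "0 \<in> effective (j # ws) us" by (simp add: effective_Cons ascent_def)
      then have "(j # ws) ! 0 \<in> (!) (j # ws) ` effective (j # ws) us" by (rule imageI)
      with Cons.prems \<open>Suc j = Suc i\<close> show False by simp
    qed
  qed
  with IH show ?case by simp
qed simp

definition unfinished :: "nat \<Rightarrow> nat list \<Rightarrow> nat set" where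
  "unfinished n us = {i. Suc i < n \<and> acts us {..<Suc i} \<noteq> {n - Suc i..<n}}"

lemma perm_lt:
  assumes "\<forall>i\<in>set ws. Suc i < n" "x < n"
  shows "perm ws x < n"
proof -
  have "perm ws x \<in> perm ws ` {..<n}" using assms by simp
  then show ?thesis unfolding perm_image using acts_subset[of "{..<n}" n ws] assms(1) by blast
qed

text \<open>Once \<open>us\<close> takes the first i + 1 places to the top block, so does every word
  ending in \<open>us\<close>, by monotonicity. Then position i carries a value in the block and
  position i + 1 one below it: a descent, at which letter i is idle.\<close>

lemma letters_effective_subset:
  assumes ws: "\<forall>i\<in>set ws. Suc i < n" and us: "\<forall>i\<in>set us. Suc i < n"
  shows "(!) ws ` effective ws us \<subseteq> unfinished n us"
proof
  fix i assume "i \<in> (!) ws ` effective ws us"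
  then obtain t where t: "t < length ws" "i = ws ! t" and asc: "ascent i (perm (drop (Suc t) ws @ us))"
    by (auto simp: effective_def)
  let ?vs = "drop (Suc t) ws"
  have i: "Suc i < n" using t ws by simp
  have vs: "\<forall>i\<in>set (?vs @ us). Suc i < n" using ws us by (auto dest: in_set_dropD)
  have "acts us {..<Suc i} \<noteq> {n - Suc i..<n}"
  proof
    assume top: "acts us {..<Suc i} = {n - Suc i..<n}"
    have "gale_le (acts us {..<Suc i}) (acts us (acts ?vs {..<Suc i}))"
      by (intro gale_acts_mono gale_acts) simp
    then have "gale_le {n - Suc i..<n} (acts (?vs @ us) {..<Suc i})" by (simp add: top)
    moreover have "acts (?vs @ us) {..<Suc i} \<subseteq> {..<n}" using vs i by (intro acts_subset) auto
    ultimately have "acts (?vs @ us) {..<Suc i} = {n - Suc i..<n}" by (intro gale_top_eq) simp_all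
    then have img: "perm (?vs @ us) ` {..<Suc i} = {n - Suc i..<n}" by (simp add: perm_image)
    have "perm (?vs @ us) i \<in> perm (?vs @ us) ` {..<Suc i}" by simp
    then have 1: "n - Suc i \<le> perm (?vs @ us) i" unfolding img by simp
    have "perm (?vs @ us) (Suc i) \<notin> perm (?vs @ us) ` {..<Suc i}"
      using bij_is_inj[OF bij_perm[of "?vs @ us"]] by (auto simp: inj_eq)
    moreover have "perm (?vs @ us) (Suc i) < n" using perm_lt[OF vs i] .
    ultimately have "perm (?vs @ us) (Suc i) < n - Suc i" unfolding img by simp
    with 1 asc show False by (simp add: ascent_def)
  qed
  with i show "i \<in> unfinished n us" by (simp add: unfinished_def)
qed

text \<open>If letter \<open>i\<close> were never effective when prepended, the image of \<open>{..i}\<close> would be unchanged; but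
  the same word arises by appending, and a set fixed by all letters is the top one.\<close>

lemma letters_effective:
  assumes ws: "set ws = {..<n - 1}"
  shows "(!) ws ` effective ws (wpow m ws) = unfinished n (wpow m ws)"
proof (intro equalityI subsetI)
  note v = full_valid[OF ws]
  have v': "\<forall>i\<in>set (wpow m ws). Suc i < n" using v set_wpow[of m ws] by blast
  show "i \<in> unfinished n (wpow m ws)" if "i \<in> (!) ws ` effective ws (wpow m ws)" for i
    using letters_effective_subset[OF v v'] that by blast
  fix i assume i: "i \<in> unfinished n (wpow m ws)"
  then have in': "Suc i < n" by (simp add: unfinished_def)
  show "i \<in> (!) ws ` effective ws (wpow m ws)"
  proof (rule ccontr)
    assume "i \<notin> (!) ws ` effective ws (wpow m ws)"
    then have "perm (ws @ wpow m ws) ` {..<Suc i} = perm (wpow m ws) ` {..<Suc i}" by (rule image_unchanged)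
    then have "acts (ws @ wpow m ws) {..<Suc i} = acts (wpow m ws) {..<Suc i}" unfolding perm_image .
    moreover have "ws @ wpow m ws = wpow m ws @ ws" using wpow_Suc[of m ws] wpow_Suc'[of m ws] by simp
    ultimately have fix': "acts ws (acts (wpow m ws) {..<Suc i}) = acts (wpow m ws) {..<Suc i}" by simp
    have sub: "acts (wpow m ws) {..<Suc i} \<subseteq> {..<n}" using in' by (intro acts_wpow_subset[OF _ ws]) simp
    have "acts (wpow m ws) {..<Suc i} = {n - card (acts (wpow m ws) {..<Suc i})..<n}"
      by (rule acts_fixed_full[OF fix' sub]) (simp add: ws)
    with i show False by (simp add: unfinished_def)
  qed
qed

lemma card_unfinished_le:
  assumes "set ws = {..<n - 1}"
  shows "card (unfinished n (wpow m ws)) \<le> card (effective ws (wpow m ws))"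
  unfolding letters_effective[OF assms, symmetric] by (rule card_image_le[OF finite_effective])

text \<open>The letters at effective positions are exactly the unfinished ones, so equal counts mean
  that no letter acts at two positions.\<close>

lemma card_unfinished_eq:
  assumes "set ws = {..<n - 1}"
  shows "card (unfinished n (wpow m ws)) = card (effective ws (wpow m ws))
    \<longleftrightarrow> inj_on ((!) ws) (effective ws (wpow m ws))"
  unfolding letters_effective[OF assms, symmetric]
  using card_image eq_card_imp_inj_on[OF finite_effective] by blast

section \<open>Summation over passes\<close>

lemma perm_length_top:
  assumes top: "\<And>k. k \<le> n \<Longrightarrow> acts us {..<k} = {n - k..<n}"
  shows "perm_length n us = n choose 2"
proof -
  let ?p = "perm us"
  have p: "?p k = n - Suc k" if k: "k < n" for k
  proof -
    have "?p ` {..<Suc k} - ?p ` {..<k} = {?p k}"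
      by (rule inj_image_last[OF bij_is_inj[OF bij_perm]])
    moreover have "?p ` {..<Suc k} - ?p ` {..<k} = {n - Suc k..<n} - {n - k..<n}"
      unfolding perm_image using top[of k] top[of "Suc k"] k by simp
    moreover have "{n - Suc k..<n} - {n - k..<n} = {n - Suc k}" using k by auto
    ultimately show ?thesis by simp
  qed
  have "inversions n ?p = (\<Union>b\<in>{..<n}. (\<lambda>a. (a, b)) ` {..<b})"
    using p by (auto simp: inversions_def)
  also have "card \<dots> = (\<Sum>b\<in>{..<n}. card ((\<lambda>a. (a, b)) ` {..<b}))"
    by (rule card_UN_disjoint) auto
  also have "\<dots> = (\<Sum>b<n. b)" by (intro sum.cong refl) (simp add: card_image inj_on_def)
  also have "\<dots> = n choose 2" by (induction n) (simp_all add: numeral_2_eq_2)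
  finally show ?thesis by (simp add: perm_length_def)
qed

text \<open>Double counting of pairs: k is unfinished after m passes exactly when m is less than its
  exponent. Stopping at n passes loses nothing, because \<open>expo_add_le\<close> bounds each
  exponent by n.\<close>

lemma sum_expo:
  assumes ws: "set ws = {..<n - 1}"
  shows "(\<Sum>k=1..n - 1. expo n ws k) = (\<Sum>m<n. card (unfinished n (wpow m ws)))"
proof -
  have "expo n ws (Suc i) = (\<Sum>m<n. if i \<in> unfinished n (wpow m ws) then 1 else 0)" if i: "Suc i < n" for i
  proof -
    have iff: "i \<in> unfinished n (wpow m ws) \<longleftrightarrow> m < expo n ws (Suc i)" for m
      using wpow_top_iff[OF _ i ws, of m] i unfolding unfinished_def by (simp add: not_le[symmetric])
    have "expo n ws (Suc i) \<le> n" using expo_add_le[OF _ i ws] by simp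
    then have "{m. m < n \<and> i \<in> unfinished n (wpow m ws)} = {..<expo n ws (Suc i)}" unfolding iff by auto
    moreover have "(\<Sum>m<n. if i \<in> unfinished n (wpow m ws) then 1 else 0)
        = card {m. m < n \<and> i \<in> unfinished n (wpow m ws)}"
      by (simp add: sum.If_cases Int_def)
    ultimately show ?thesis by simp
  qed
  then have "(\<Sum>i<n - 1. expo n ws (Suc i)) = (\<Sum>i<n - 1. \<Sum>m<n. if i \<in> unfinished n (wpow m ws) then 1 else 0)"
    by (intro sum.cong) auto
  also have "\<dots> = (\<Sum>m<n. \<Sum>i<n - 1. if i \<in> unfinished n (wpow m ws) then 1 else 0)" by (rule sum.swap)
  also have "\<dots> = (\<Sum>m<n. card (unfinished n (wpow m ws)))"
  proof (intro sum.cong refl)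
    fix m
    have "{..<n - 1} \<inter> {i. i \<in> unfinished n (wpow m ws)} = unfinished n (wpow m ws)"
      by (auto simp: unfinished_def)
    then show "(\<Sum>i<n - 1. if i \<in> unfinished n (wpow m ws) then 1 else 0) = card (unfinished n (wpow m ws))"
      by (simp add: sum.If_cases)
  qed
  also have "(\<Sum>i<n - 1. expo n ws (Suc i)) = (\<Sum>k=1..n - 1. expo n ws k)"
    by (rule sum.reindex_bij_witness[of _ "\<lambda>k. k - 1" Suc]) auto
  finally show ?thesis .
qed

lemma sum_effective:
  assumes ws: "set ws = {..<n - 1}"
  shows "perm_length n (wpow M ws) = (\<Sum>m<M. card (effective ws (wpow m ws)))"
proof (induction M)
  case (Suc M)
  then show ?case using perm_length_append[OF full_valid[OF ws], of "wpow M ws"] by (simp add: wpow_Suc)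
qed simp

lemma acts_wpow_n:
  assumes ws: "set ws = {..<n - 1}" and k: "k \<le> n"
  shows "acts (wpow n ws) {..<k} = {n - k..<n}"
proof (cases "1 \<le> k \<and> k < n")
  case True
  then have k': "1 \<le> k" "k < n" by auto
  have "expo n ws k \<le> n" using expo_add_le[OF k' ws] by linarith
  then show ?thesis by (rule wpow_top_iff[OF k' ws, THEN iffD2])
next
  case False
  have "acts (wpow n ws) {..<k} \<subseteq> {..<n}" by (rule acts_wpow_subset[OF k ws])
  moreover have "card (acts (wpow n ws) {..<k}) = k" by simp
  ultimately have "acts (wpow n ws) {..<k} = {n - k..<n}"
    if "k = n" using that by (metis card_lessThan card_subset_eq diff_self_eq_0 finite_lessThan lessThan_atLeast0)
  moreover have "acts (wpow n ws) {..<0} = {}" by (metis card_0_eq card_acts finite_acts finite_lessThan lessThan_0 card.empty)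
  moreover have "k = 0 \<or> k = n" using False k by auto
  ultimately show ?thesis by auto
qed

lemma perm_length_wpow_n:
  assumes ws: "set ws = {..<n - 1}"
  shows "perm_length n (wpow n ws) = n choose 2"
  by (rule perm_length_top[OF acts_wpow_n[OF ws]])

lemma unfinished_Nil: "unfinished n [] = {..<n - 1}"
proof -
  have "{..<Suc i} \<noteq> {n - Suc i..<n}" if "Suc i < n" for i
  proof
    assume eq: "{..<Suc i} = {n - Suc i..<n}"
    have "0 \<in> {..<Suc i}" by simp
    then show False unfolding eq using that by simp
  qed
  then show ?thesis by (auto simp: unfinished_def less_diff_conv)
qed

theorem expo_sum:
  assumes n: "2 \<le> n" and ws: "set ws = {..<n - 1}"
  shows "(\<Sum>k=1..n - 1. expo n ws k) + perm_length n ws \<le> (n choose 2) + (n - 1)"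
    and "(\<Sum>k=1..n - 1. expo n ws k) + perm_length n ws = (n choose 2) + (n - 1)
      \<longleftrightarrow> inj_on ((!) ws) (effective ws ws)"
    and "n - 1 \<le> perm_length n ws"
proof -
  let ?e = "\<lambda>m. card (effective ws (wpow m ws))" and ?u = "\<lambda>m. card (unfinished n (wpow m ws))"
  have w1: "wpow 1 ws = ws" by (simp add: wpow_def)
  have split: "(\<Sum>m<n. f m) = f 0 + (\<Sum>m\<in>{1..<n}. f m)" for f :: "nat \<Rightarrow> nat"
    using n sum.atLeast_Suc_lessThan[of 0 n f] by (simp add: lessThan_atLeast0)
  have e0: "?e 0 = perm_length n ws" using perm_length_append[OF full_valid[OF ws], of "[]"] by simp
  have u0: "?u 0 = n - 1" by (simp add: unfinished_Nil)
  have le: "?u m \<le> ?e m" for m by (rule card_unfinished_le[OF ws])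
  have S: "(\<Sum>k=1..n - 1. expo n ws k) = (n - 1) + (\<Sum>m\<in>{1..<n}. ?u m)"
    unfolding sum_expo[OF ws] split u0 ..
  have C: "(n choose 2) = perm_length n ws + (\<Sum>m\<in>{1..<n}. ?e m)"
    unfolding perm_length_wpow_n[OF ws, symmetric] sum_effective[OF ws] split e0 ..
  have "(\<Sum>m\<in>{1..<n}. ?u m) \<le> (\<Sum>m\<in>{1..<n}. ?e m)" by (intro sum_mono le)
  then show "(\<Sum>k=1..n - 1. expo n ws k) + perm_length n ws \<le> (n choose 2) + (n - 1)"
    unfolding S C by simp
  show "n - 1 \<le> perm_length n ws" using le[of 0] unfolding e0 u0 .
  have "(\<Sum>k=1..n - 1. expo n ws k) + perm_length n ws = (n choose 2) + (n - 1)
      \<longleftrightarrow> (\<Sum>m\<in>{1..<n}. ?u m) = (\<Sum>m\<in>{1..<n}. ?e m)"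
    unfolding S C by auto
  also have "\<dots> \<longleftrightarrow> (\<forall>m\<in>{1..<n}. ?u m = ?e m)"
  proof
    assume eq: "(\<Sum>m\<in>{1..<n}. ?u m) = (\<Sum>m\<in>{1..<n}. ?e m)"
    show "\<forall>m\<in>{1..<n}. ?u m = ?e m"
    proof (rule ccontr)
      assume "\<not> (\<forall>m\<in>{1..<n}. ?u m = ?e m)"
      then obtain m where "m \<in> {1..<n}" "?u m < ?e m" using le by (metis order_le_neq_trans)
      then have "(\<Sum>m\<in>{1..<n}. ?u m) < (\<Sum>m\<in>{1..<n}. ?e m)"
        by (intro sum_strict_mono_ex1) (use le in auto)
      with eq show False by simp
    qed
  qed simp
  also have "\<dots> \<longleftrightarrow> (\<forall>m\<in>{1..<n}. inj_on ((!) ws) (effective ws (wpow m ws)))"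
    by (simp only: card_unfinished_eq[OF ws])
  also have "\<dots> \<longleftrightarrow> inj_on ((!) ws) (effective ws ws)"
  proof
    assume "\<forall>m\<in>{1..<n}. inj_on ((!) ws) (effective ws (wpow m ws))"
    then have "inj_on ((!) ws) (effective ws (wpow 1 ws))" using n by auto
    then show "inj_on ((!) ws) (effective ws ws)" by (simp only: w1)
  next
    assume inj: "inj_on ((!) ws) (effective ws ws)"
    have "inj_on ((!) ws) (effective ws (wpow m ws))" if m: "m \<in> {1..<n}" for m
    proof -
      obtain l where "m = Suc l" using m by (cases m) auto
      then have "effective ws (wpow m ws) \<subseteq> effective ws ws"
        using effective_antimono[of ws ws "wpow l ws"] by (simp add: wpow_Suc)
      with inj show ?thesis by (rule inj_on_subset)
    qed
    then show "\<forall>m\<in>{1..<n}. inj_on ((!) ws) (effective ws (wpow m ws))" by blast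
  qed
  finally show "(\<Sum>k=1..n - 1. expo n ws k) + perm_length n ws = (n choose 2) + (n - 1)
      \<longleftrightarrow> inj_on ((!) ws) (effective ws ws)" .
qed

lemma expo_sum_eq_iff:
  assumes n: "2 \<le> n" and ws: "set ws = {..<n - 1}"
  shows "(\<Sum>k=1..n - 1. expo n ws k) + perm_length n ws = (n choose 2) + (n - 1)
    \<longleftrightarrow> int (perm_length n (ws @ ws)) - int (perm_length n ws) = int (card (unfinished n ws))"
proof -
  have "wpow 1 ws = ws" by (simp add: wpow_def)
  then have "card (unfinished n ws) = card (effective ws ws) \<longleftrightarrow> inj_on ((!) ws) (effective ws ws)"
    using card_unfinished_eq[OF ws, of 1] by simp
  then show ?thesis
    unfolding expo_sum(2)[OF assms] perm_length_append[OF full_valid[OF ws]] by auto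
qed

lemma expo_sum_distinct:
  assumes n: "2 \<le> n" and ws: "set ws = {..<n - 1}" and d: "distinct ws"
  shows "(\<Sum>k=1..n - 1. expo n ws k) + perm_length n ws = (n choose 2) + (n - 1)"
  unfolding expo_sum(2)[OF n ws]
  by (rule inj_onI) (use d in \<open>auto simp: effective_def nth_eq_iff_index_eq\<close>)

section \<open>Minors of products of elementary factors\<close>

text \<open>An increasing enumeration of a set is unique, so minors may be written with whatever
  index function is convenient in place of \<open>pick\<close>.\<close>

lemma pick_eq:
  assumes mono: "\<And>a b. a < b \<Longrightarrow> b < k \<Longrightarrow> f a < f b" and img: "f ` {..<k} = J" and p: "p < k"
  shows "pick J p = f p"
proof -
  have inj: "inj_on f {..<k}" by (rule inj_onI) (metis lessThan_iff mono nat_neq_iff)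
  have "{a \<in> J. a < f p} = f ` {..<p}"
  proof (intro equalityI subsetI)
    fix a assume "a \<in> {a \<in> J. a < f p}"
    then obtain b where b: "b < k" "a = f b" "f b < f p" using img by auto
    then have "b < p" using mono[of p b] p by (metis less_asym nat_neq_iff)
    with b show "a \<in> f ` {..<p}" by simp
  next
    fix a assume "a \<in> f ` {..<p}"
    then show "a \<in> {a \<in> J. a < f p}" using mono[of _ p] p img by auto
  qed
  moreover have "card (f ` {..<p}) = p"
    using inj_on_subset[OF inj, of "{..<p}"] p by (simp add: card_image)
  moreover have "f p \<in> J" using img p by auto
  ultimately show ?thesis using pick_card_in_set[of "f p" J] by simp
qed

lemma pick_image: "finite J \<Longrightarrow> card J = k \<Longrightarrow> pick J ` {..<k} = J"
proof -
  assume J: "finite J" "card J = k"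
  have "inj_on (pick J) {..<k}"
    by (rule inj_onI) (metis J(2) lessThan_iff nat_neq_iff pick_mono_le)
  then have "card (pick J ` {..<k}) = card J" using J by (simp add: card_image)
  moreover have "pick J ` {..<k} \<subseteq> J" using pick_in_set_le J by auto
  ultimately show ?thesis using J by (simp add: card_subset_eq)
qed

lemma minor_eq:
  assumes A: "A \<in> carrier_mat m n" and I: "I \<subseteq> {..<m}" "card I = k" and J: "J \<subseteq> {..<n}" "card J = k"
  shows "minor A I J = det (mat k k (\<lambda>(a, b). A $$ (pick I a, pick J b)))"
proof -
  have "{i. i < dim_row A \<and> i \<in> I} = I" "{j. j < dim_col A \<and> j \<in> J} = J" using A I J by auto
  then show ?thesis using I J by (simp add: minor_def submatrix_def)
qed

lemma minor_eq':
  assumes A: "A \<in> carrier_mat m n"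
    and I: "I \<subseteq> {..<m}" and f: "\<And>a b. a < b \<Longrightarrow> b < k \<Longrightarrow> f a < f b" "f ` {..<k} = I"
    and J: "J \<subseteq> {..<n}" and g: "\<And>a b. a < b \<Longrightarrow> b < k \<Longrightarrow> g a < g b" "g ` {..<k} = J"
  shows "minor A I J = det (mat k k (\<lambda>(a, b). A $$ (f a, g b)))"
proof -
  have "inj_on f {..<k}" by (rule inj_onI) (metis lessThan_iff f(1) nat_neq_iff)
  then have cI: "card I = k" using f(2) by (metis card_image card_lessThan)
  have "inj_on g {..<k}" by (rule inj_onI) (metis lessThan_iff g(1) nat_neq_iff)
  then have cJ: "card J = k" using g(2) by (metis card_image card_lessThan)
  have "mat k k (\<lambda>(a, b). A $$ (pick I a, pick J b)) = mat k k (\<lambda>(a, b). A $$ (f a, g b))"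
    by (rule cong_mat) (auto simp: pick_eq[OF f] pick_eq[OF g])
  then show ?thesis using minor_eq[OF A I cI J cJ] by simp
qed

lemma det_col_add:
  fixes A B C :: "'a :: comm_ring_1 mat"
  assumes A: "A \<in> carrier_mat k k" and B: "B \<in> carrier_mat k k" and C: "C \<in> carrier_mat k k"
    and p: "p < k"
    and other: "\<And>i j. i < k \<Longrightarrow> j < k \<Longrightarrow> j \<noteq> p \<Longrightarrow> A $$ (i, j) = B $$ (i, j) \<and> C $$ (i, j) = B $$ (i, j)"
    and col: "\<And>i. i < k \<Longrightarrow> A $$ (i, p) = B $$ (i, p) + c * C $$ (i, p)"
  shows "det A = det B + c * det C"
proof -
  have "mat_delete A i p = mat_delete B i p" "mat_delete C i p = mat_delete B i p" if "i < k" for i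
    using that A B C other p by (auto simp: mat_delete_def intro!: cong_mat)
  then have cof: "cofactor A i p = cofactor B i p" "cofactor C i p = cofactor B i p" if "i < k" for i
    using that by (auto simp: cofactor_def)
  have "det A = (\<Sum>i<k. A $$ (i, p) * cofactor A i p)" by (rule laplace_expansion_column[OF A p])
  also have "\<dots> = (\<Sum>i<k. B $$ (i, p) * cofactor B i p + c * (C $$ (i, p) * cofactor C i p))"
    by (intro sum.cong refl) (simp add: col cof algebra_simps)
  also have "\<dots> = (\<Sum>i<k. B $$ (i, p) * cofactor B i p) + c * (\<Sum>i<k. C $$ (i, p) * cofactor C i p)"
    by (simp add: sum.distrib sum_distrib_left)
  also have "\<dots> = det B + c * det C"
    by (simp only: laplace_expansion_column[OF B p] laplace_expansion_column[OF C p])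
  finally show ?thesis .
qed

text \<open>The columns q and r are adjacent, so replacing q by r keeps the order of the chosen
  columns and no sign appears. If r is chosen already, the extra determinant has two equal columns.
  The two alternatives for q and r serve the upper factors and their transposes.\<close>

lemma minor_add_col:
  assumes M: "M \<in> carrier_mat m n" and N: "N \<in> carrier_mat m n"
    and I: "I \<subseteq> {..<m}" "card I = k" and J: "J \<subseteq> {..<n}" "card J = k"
    and q: "q < n" "r < n" "r = Suc q \<or> q = Suc r"
    and N': "\<And>i j. i < m \<Longrightarrow> j < n \<Longrightarrow> N $$ (i, j) = (if j = q then M $$ (i, q) + a * M $$ (i, r) else M $$ (i, j))"
  shows "minor N I J = minor M I J + (if q \<in> J \<and> r \<notin> J then a * minor M I (insert r (J - {q})) else 0)"
proof -
  have fJ: "finite J" and fI: "finite I" using J I finite_subset by blast+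
  have pI: "pick I x < m" if "x < k" for x using pick_in_set_le[of x I] that I by auto
  have pJ: "pick J x \<in> J" "pick J x < n" if "x < k" for x using pick_in_set_le[of x J] that J by auto
  let ?X = "mat k k (\<lambda>(x, y). M $$ (pick I x, pick J y))"
  let ?Z = "mat k k (\<lambda>(x, y). N $$ (pick I x, pick J y))"
  have X: "minor M I J = det ?X" by (rule minor_eq[OF M I J])
  have Z: "minor N I J = det ?Z" by (rule minor_eq[OF N I J])
  show ?thesis
  proof (cases "q \<in> J")
    case False
    have "?Z = ?X"
    proof (rule cong_mat[OF refl refl], clarsimp)
      fix x y assume "x < k" "y < k"
      then show "N $$ (pick I x, pick J y) = M $$ (pick I x, pick J y)"
        using N'[of "pick I x" "pick J y"] pI[of x] pJ[of y] False by auto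
    qed
    then show ?thesis using X Z False by simp
  next
    case True
    then obtain p where p: "p < k" "pick J p = q"
      using pick_image[OF fJ J(2)] by (metis imageE lessThan_iff)
    have inj: "pick J x = pick J y \<Longrightarrow> x = y" if "x < k" "y < k" for x y
      using that J(2) by (metis nat_neq_iff pick_mono_le)
    define g where "g x = (if x = p then r else pick J x)" for x
    let ?Y = "mat k k (\<lambda>(x, y). M $$ (pick I x, g y))"
    have det: "det ?Z = det ?X + a * det ?Y"
    proof (rule det_col_add[OF _ _ _ p(1)])
      fix i j assume ij: "i < k" "j < k" "j \<noteq> p"
      then have "pick J j \<noteq> q" using inj[of j p] p by auto
      then show "?Z $$ (i, j) = ?X $$ (i, j) \<and> ?Y $$ (i, j) = ?X $$ (i, j)"
        using ij N'[of "pick I i" "pick J j"] pI[of i] pJ[of j] by (simp add: g_def)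
    next
      fix i assume "i < k"
      then show "?Z $$ (i, p) = ?X $$ (i, p) + a * ?Y $$ (i, p)"
        using p N'[of "pick I i" q] pI[of i] q by (simp add: g_def)
    qed auto
    show ?thesis
    proof (cases "r \<in> J")
      case r: True
      then obtain s where s: "s < k" "pick J s = r"
        using pick_image[OF fJ J(2)] by (metis imageE lessThan_iff)
      have "s \<noteq> p" using s p q by auto
      have "det ?Y = 0"
        by (rule det_identical_columns[OF _ \<open>s \<noteq> p\<close> s(1) p(1)])
          (use s p \<open>s \<noteq> p\<close> in \<open>auto simp: g_def\<close>)
      then show ?thesis using det X Z r by simp
    next
      case r: False
      have sub: "insert r (J - {q}) \<subseteq> {..<n}" using J q by auto
      have mono: "g x < g y" if "x < y" "y < k" for x y
      proof -
        have lt: "pick J x < pick J y" using that J(2) by (simp add: pick_mono_le)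
        have "pick J x \<noteq> r" "pick J y \<noteq> r" using r pJ that by (metis less_trans)+
        with lt p q that show ?thesis by (auto simp: g_def)
      qed
      have img: "g ` {..<k} = insert r (J - {q})"
      proof -
        have "g ` {..<k} = insert r (pick J ` ({..<k} - {p}))" using p by (auto simp: g_def image_iff)
        also have "pick J ` ({..<k} - {p}) = J - {q}"
          using pick_image[OF fJ J(2)] p inj by (auto simp: image_iff)
        finally show ?thesis .
      qed
      have "minor M I (insert r (J - {q})) = det ?Y"
        by (rule minor_eq'[OF M I(1) _ pick_image[OF fI I(2)] sub mono img])
          (use I(2) pick_mono_le in auto)
      then show ?thesis using det X Z r True by simp
    qed
  qed
qed

section \<open>Elementary factors acting on columns\<close>

lemma elem_upper_carrier [simp]: "elem_upper n i a \<in> carrier_mat n n"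
  by (simp add: elem_upper_def)

lemma elem_upper_dim [simp]: "dim_row (elem_upper n i a) = n" "dim_col (elem_upper n i a) = n"
  by (simp_all add: elem_upper_def)

lemma mult_elem_upper:
  assumes M: "M \<in> carrier_mat m n" and i: "Suc i < n" and xj: "x < m" "j < n"
  shows "(M * elem_upper n i a) $$ (x, j) = M $$ (x, j) + (if j = Suc i then a * M $$ (x, i) else 0)"
proof -
  have "addcol a (Suc i) i M = M * addrow_mat n a i (Suc i)"
    by (rule addcol_mat[OF M]) (use i in linarith)
  then have "M * elem_upper n i a = addcol a (Suc i) i M" unfolding elem_upper_def by (rule sym)
  moreover have "x < dim_row M" "j < dim_col M" using M xj by auto
  ultimately show ?thesis by (simp only: index_mat_addcol(1)) simp
qed

lemma mult_elem_lower:
  assumes M: "M \<in> carrier_mat m n" and i: "Suc i < n" and xj: "x < m" "j < n"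
  shows "(M * (elem_upper n i a)\<^sup>T) $$ (x, j) = M $$ (x, j) + (if j = i then a * M $$ (x, Suc i) else 0)"
proof -
  have eq: "(elem_upper n i a)\<^sup>T = addrow_mat n a (Suc i) i"
    unfolding elem_upper_def by (rule eq_matI) auto
  have "addcol a i (Suc i) M = M * addrow_mat n a (Suc i) i"
    by (rule addcol_mat[OF M i])
  then have "M * (elem_upper n i a)\<^sup>T = addcol a i (Suc i) M" unfolding eq by (rule sym)
  moreover have "x < dim_row M" "j < dim_col M" using M xj by auto
  ultimately show ?thesis by (simp only: index_mat_addcol(1)) simp
qed

text \<open>Keeps the signs and forgets the values: with the row set fixed, S tells which column
  sets give positive minors, all others giving zero. Right multiplications then act on S as images
  under relations.\<close>

definition pattern :: "nat \<Rightarrow> nat \<Rightarrow> nat set \<Rightarrow> real mat \<Rightarrow> nat set set \<Rightarrow> bool" where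
  "pattern n k I M S \<longleftrightarrow> (\<forall>J. J \<subseteq> {..<n} \<and> card J = k \<longrightarrow>
     0 \<le> minor M I J \<and> (0 < minor M I J \<longleftrightarrow> J \<in> S))"

lemma up_Image_iff:
  "J \<in> up i `` S \<longleftrightarrow> J \<in> S \<or> (i \<notin> J \<and> Suc i \<in> J \<and> insert i (J - {Suc i}) \<in> S)"
proof
  assume "J \<in> up i `` S"
  then obtain K where K: "K \<in> S" "J = K \<or> J = act i K" unfolding up_def by blast
  show "J \<in> S \<or> (i \<notin> J \<and> Suc i \<in> J \<and> insert i (J - {Suc i}) \<in> S)"
  proof (cases "i \<in> K \<and> Suc i \<notin> K \<and> J \<noteq> K")
    case True
    then have J: "J = insert (Suc i) (K - {i})" using K by (simp add: act_def)
    have "insert i (J - {Suc i}) = K" unfolding J using True by auto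
    moreover have "i \<notin> J" "Suc i \<in> J" unfolding J by auto
    ultimately show ?thesis using K by simp
  next
    case False
    then show ?thesis using K unfolding act_def by presburger
  qed
next
  assume "J \<in> S \<or> (i \<notin> J \<and> Suc i \<in> J \<and> insert i (J - {Suc i}) \<in> S)"
  then show "J \<in> up i `` S"
  proof
    assume J: "i \<notin> J \<and> Suc i \<in> J \<and> insert i (J - {Suc i}) \<in> S"
    then have "act i (insert i (J - {Suc i})) = J" by (auto simp: act_def)
    then show ?thesis using J unfolding up_def by blast
  qed (auto simp: up_def)
qed

lemma down_Image_iff:
  "J \<in> (up i)\<inverse> `` S \<longleftrightarrow> J \<in> S \<or> (i \<in> J \<and> Suc i \<notin> J \<and> insert (Suc i) (J - {i}) \<in> S)"
proof -
  have "J \<in> (up i)\<inverse> `` S \<longleftrightarrow> J \<in> S \<or> act i J \<in> S" unfolding up_def by blast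
  moreover have "i \<in> J \<and> Suc i \<notin> J \<Longrightarrow> act i J = insert (Suc i) (J - {i})"
    and "\<not> (i \<in> J \<and> Suc i \<notin> J) \<Longrightarrow> act i J = J" unfolding act_def by argo+
  ultimately show ?thesis by metis
qed

lemma card_exchange:
  fixes n :: nat
  assumes "J \<subseteq> {..<n}" "q \<in> J" "r \<notin> J"
  shows "card (insert r (J - {q})) = card J"
proof -
  have "finite J" by (rule finite_subset[OF assms(1)]) simp
  have "card (insert r (J - {q})) = Suc (card (J - {q}))" using assms \<open>finite J\<close> by (intro card_insert_disjoint) auto
  also have "\<dots> = card J" by (rule card.remove[symmetric]) (use assms \<open>finite J\<close> in auto)
  finally show ?thesis .
qed

text \<open>Both terms of the expanded minor are nonnegative, so nothing cancels and the minor is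
  positive as soon as one term is.\<close>

lemma pattern_up:
  assumes M: "M \<in> carrier_mat m n" and I: "I \<subseteq> {..<m}" "card I = k" and i: "Suc i < n" and a: "0 < a"
    and pat: "pattern n k I M S"
  shows "pattern n k I (M * elem_upper n i a) (up i `` S)"
  unfolding pattern_def
proof (intro allI impI)
  fix J assume "J \<subseteq> {..<n} \<and> card J = k"
  then have J: "J \<subseteq> {..<n}" "card J = k" by auto
  let ?K = "insert i (J - {Suc i})"
  have eq: "minor (M * elem_upper n i a) I J =
      minor M I J + (if Suc i \<in> J \<and> i \<notin> J then a * minor M I ?K else 0)"
    by (rule minor_add_col[OF M _ I J, of _ "Suc i" i a]) (use M i mult_elem_upper[OF M i] in auto)
  have 1: "0 \<le> minor M I J" "0 < minor M I J \<longleftrightarrow> J \<in> S" using pat J by (auto simp: pattern_def)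
  show "0 \<le> minor (M * elem_upper n i a) I J \<and> (0 < minor (M * elem_upper n i a) I J \<longleftrightarrow> J \<in> up i `` S)"
  proof (cases "Suc i \<in> J \<and> i \<notin> J")
    case True
    then have "?K \<subseteq> {..<n}" "card ?K = k" using J card_exchange[of J n "Suc i" i] i by auto
    then have "0 \<le> minor M I ?K" "0 < minor M I ?K \<longleftrightarrow> ?K \<in> S" using pat unfolding pattern_def by blast+
    then have 2: "0 \<le> a * minor M I ?K" "0 < a * minor M I ?K \<longleftrightarrow> ?K \<in> S"
      using a by (simp_all add: zero_less_mult_iff)
    have "minor (M * elem_upper n i a) I J = minor M I J + a * minor M I ?K" using eq True by simp
    then show ?thesis using 1 2 True unfolding up_Image_iff by (smt (verit))
  next
    case False
    then show ?thesis using 1 eq unfolding up_Image_iff by auto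
  qed
qed

lemma pattern_down:
  assumes M: "M \<in> carrier_mat m n" and I: "I \<subseteq> {..<m}" "card I = k" and i: "Suc i < n" and a: "0 < a"
    and pat: "pattern n k I M S"
  shows "pattern n k I (M * (elem_upper n i a)\<^sup>T) ((up i)\<inverse> `` S)"
  unfolding pattern_def
proof (intro allI impI)
  fix J assume "J \<subseteq> {..<n} \<and> card J = k"
  then have J: "J \<subseteq> {..<n}" "card J = k" by auto
  let ?K = "insert (Suc i) (J - {i})" and ?N = "M * (elem_upper n i a)\<^sup>T"
  have eq: "minor ?N I J = minor M I J + (if i \<in> J \<and> Suc i \<notin> J then a * minor M I ?K else 0)"
    by (rule minor_add_col[OF M _ I J, of _ i "Suc i" a]) (use M i mult_elem_lower[OF M i] in auto)
  have 1: "0 \<le> minor M I J" "0 < minor M I J \<longleftrightarrow> J \<in> S" using pat J by (auto simp: pattern_def)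
  show "0 \<le> minor ?N I J \<and> (0 < minor ?N I J \<longleftrightarrow> J \<in> (up i)\<inverse> `` S)"
  proof (cases "i \<in> J \<and> Suc i \<notin> J")
    case True
    then have "?K \<subseteq> {..<n}" "card ?K = k" using J card_exchange[of J n i "Suc i"] i by auto
    then have "0 \<le> minor M I ?K" "0 < minor M I ?K \<longleftrightarrow> ?K \<in> S" using pat unfolding pattern_def by blast+
    then have 2: "0 \<le> a * minor M I ?K" "0 < a * minor M I ?K \<longleftrightarrow> ?K \<in> S"
      using a by (simp_all add: zero_less_mult_iff)
    have "minor ?N I J = minor M I J + a * minor M I ?K" using eq True by simp
    then show ?thesis using 1 2 True unfolding down_Image_iff by (smt (verit))
  next
    case False
    then show ?thesis using 1 eq unfolding down_Image_iff by auto
  qed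
qed

lemma pattern_diag:
  assumes M: "M \<in> carrier_mat m n" and I: "I \<subseteq> {..<m}" "card I = k" and d: "\<forall>i<n. 0 < d i"
    and pat: "pattern n k I M S"
  shows "pattern n k I (M * mat_diag n d) S"
  unfolding pattern_def
proof (intro allI impI)
  fix J assume "J \<subseteq> {..<n} \<and> card J = k"
  then have J: "J \<subseteq> {..<n}" "card J = k" by auto
  have pI: "pick I x < m" if "x < k" for x using pick_in_set_le[of x I] that I by auto
  have pJ: "pick J x < n" if "x < k" for x using pick_in_set_le[of x J] that J by auto
  let ?X = "mat k k (\<lambda>(x, y). M $$ (pick I x, pick J y))"
  have "minor (M * mat_diag n d) I J = det (mat k k (\<lambda>(x, y). (M * mat_diag n d) $$ (pick I x, pick J y)))"
    by (rule minor_eq[OF _ I J]) (use M in auto)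
  also have "mat k k (\<lambda>(x, y). (M * mat_diag n d) $$ (pick I x, pick J y)) = ?X * mat_diag k (d \<circ> pick J)"
    unfolding mat_diag_mult_right[OF M] using pI pJ
    by (subst mat_diag_mult_right[of _ k]) (auto intro!: cong_mat)
  also have "det \<dots> = det ?X * det (mat_diag k (d \<circ> pick J))" by (rule det_mult) auto
  also have "det ?X = minor M I J" by (rule minor_eq[OF M I J, symmetric])
  finally have eq: "minor (M * mat_diag n d) I J = minor M I J * det (mat_diag k (d \<circ> pick J))" .
  have "det (mat_diag k (d \<circ> pick J)) = prod_list (diag_mat (mat_diag k (d \<circ> pick J)))"
    by (rule det_upper_triangular) (auto simp: mat_diag_def upper_triangular_def)
  also have "\<dots> = (\<Prod>x<k. d (pick J x))"
    by (simp add: prod_list_diag_prod mat_diag_def lessThan_atLeast0)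
  also have "0 < \<dots>" using d pJ by (intro prod_pos) auto
  finally have "0 < det (mat_diag k (d \<circ> pick J))" .
  then show "0 \<le> minor (M * mat_diag n d) I J \<and> (0 < minor (M * mat_diag n d) I J \<longleftrightarrow> J \<in> S)"
    using pat J unfolding eq pattern_def by (simp add: zero_less_mult_iff)
qed

lemma pattern_one:
  assumes I: "I \<subseteq> {..<n}" "card I = k"
  shows "pattern n k I (1\<^sub>m n) {I}"
  unfolding pattern_def
proof (intro allI impI)
  fix J assume "J \<subseteq> {..<n} \<and> card J = k"
  then have J: "J \<subseteq> {..<n}" "card J = k" by auto
  have fI: "finite I" and fJ: "finite J" using I J finite_subset by blast+
  have pI: "pick I x < n" if "x < k" for x using pick_in_set_le[of x I] that I by auto
  have pJ: "pick J x < n" "pick J x \<in> J" if "x < k" for x using pick_in_set_le[of x J] that J by auto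
  let ?X = "mat k k (\<lambda>(x, y). (1\<^sub>m n :: real mat) $$ (pick I x, pick J y))"
  have eq: "minor (1\<^sub>m n) I J = det ?X" by (rule minor_eq[OF _ I J]) simp
  show "0 \<le> minor (1\<^sub>m n) I J \<and> (0 < minor (1\<^sub>m n) I J \<longleftrightarrow> J \<in> {I})"
  proof (cases "J = I")
    case True
    have "pick I x = pick I y \<longleftrightarrow> x = y" if "x < k" "y < k" for x y
      using that I(2) by (metis nat_neq_iff pick_mono_le)
    then have "?X = 1\<^sub>m k" using True pI by (intro eq_matI) auto
    then show ?thesis using eq True by simp
  next
    case False
    then have "\<not> I \<subseteq> J" using I J fJ by (metis card_subset_eq)
    then obtain i where i: "i \<in> I" "i \<notin> J" by auto
    then obtain x where x: "x < k" "pick I x = i"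
      using pick_image[OF fI I(2)] by (metis imageE lessThan_iff)
    have z: "?X $$ (x, y) = 0" if "y < k" for y
      using x i pJ[OF that] pI[OF x(1)] that by auto
    have "det ?X = (\<Sum>y<k. ?X $$ (x, y) * cofactor ?X x y)"
      by (rule laplace_expansion_row[OF _ x(1)]) simp
    also have "\<dots> = 0" by (rule sum.neutral) (metis z lessThan_iff mult_zero_left)
    finally have "det ?X = 0" .
    then show ?thesis using eq False by simp
  qed
qed


section \<open>Sign patterns of products and Gram matrices\<close>

definition valid :: "nat \<Rightarrow> (nat \<times> real) list \<Rightarrow> bool" where
  "valid n fs \<longleftrightarrow> (\<forall>(i, a)\<in>set fs. Suc i < n \<and> 0 < a)"

lemma valid_Nil [simp]: "valid n []"
  and valid_Cons [simp]: "valid n ((i, a) # fs) \<longleftrightarrow> Suc i < n \<and> 0 < a \<and> valid n fs"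
  and valid_append [simp]: "valid n (fs @ gs) \<longleftrightarrow> valid n fs \<and> valid n gs"
  by (auto simp: valid_def)

lemma upper_product_Nil [simp]: "upper_product n [] = 1\<^sub>m n"
  and upper_product_Cons [simp]: "upper_product n ((i, a) # fs) = elem_upper n i a * upper_product n fs"
  by (simp_all add: upper_product_def)

lemma upper_product_carrier [simp]: "upper_product n fs \<in> carrier_mat n n"
proof (induction fs)
  case (Cons f fs)
  then show ?case by (cases f) (simp add: mult_carrier_mat[OF elem_upper_carrier])
qed simp

lemma upper_product_dim [simp]: "dim_row (upper_product n fs) = n" "dim_col (upper_product n fs) = n"
  by (rule carrier_matD[OF upper_product_carrier])+

lemma upper_product_append: "upper_product n (fs @ gs) = upper_product n fs * upper_product n gs"
proof (induction fs)
  case (Cons f fs)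
  obtain i a where f: "f = (i, a)" by (cases f)
  show ?case unfolding f append_Cons upper_product_Cons Cons.IH
    by (rule assoc_mult_mat[symmetric]) auto
qed (simp add: left_mult_one_mat[OF upper_product_carrier])

lemma pattern_upper_product:
  assumes "M \<in> carrier_mat m n" "I \<subseteq> {..<m}" "card I = k" "valid n fs" "pattern n k I M S"
  shows "pattern n k I (M * upper_product n fs) (reach (map fst fs) `` S)"
  using assms
proof (induction fs arbitrary: M S)
  case Nil
  then show ?case by simp
next
  case (Cons f fs)
  obtain i a where f: "f = (i, a)" by (cases f)
  have v: "Suc i < n" "0 < a" "valid n fs" using Cons.prems f by auto
  have "pattern n k I (M * elem_upper n i a) (up i `` S)"
    by (rule pattern_up[OF Cons.prems(1,2,3) v(1,2) Cons.prems(5)])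
  then have "pattern n k I (M * elem_upper n i a * upper_product n fs) (reach (map fst fs) `` (up i `` S))"
    using Cons.prems v by (intro Cons.IH) auto
  moreover have "M * elem_upper n i a * upper_product n fs = M * (elem_upper n i a * upper_product n fs)"
    by (rule assoc_mult_mat[OF Cons.prems(1)]) auto
  ultimately show ?case unfolding f by (simp only: upper_product_Cons list.map fst_conv reach_Cons relcomp_Image)
qed

lemma pattern_lower_product:
  assumes "M \<in> carrier_mat m n" "I \<subseteq> {..<m}" "card I = k" "valid n fs" "pattern n k I M S"
  shows "pattern n k I (M * (upper_product n fs)\<^sup>T) ((reach (map fst fs))\<inverse> `` S)"
  using assms
proof (induction fs)
  case Nil
  then show ?case by simp
next
  case (Cons f fs)
  obtain i a where f: "f = (i, a)" by (cases f)
  let ?P = "upper_product n fs"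
  have v: "Suc i < n" "0 < a" "valid n fs" using Cons.prems f by auto
  have "pattern n k I (M * ?P\<^sup>T) ((reach (map fst fs))\<inverse> `` S)"
    using Cons v by simp
  then have "pattern n k I (M * ?P\<^sup>T * (elem_upper n i a)\<^sup>T) ((up i)\<inverse> `` ((reach (map fst fs))\<inverse> `` S))"
    by (intro pattern_down[OF _ Cons.prems(2,3) v(1,2)]) (use Cons.prems(1) in auto)
  moreover have "M * ?P\<^sup>T * (elem_upper n i a)\<^sup>T = M * (?P\<^sup>T * (elem_upper n i a)\<^sup>T)"
    by (rule assoc_mult_mat[OF Cons.prems(1)]) auto
  moreover have "?P\<^sup>T * (elem_upper n i a)\<^sup>T = (elem_upper n i a * ?P)\<^sup>T"
    by (rule transpose_mult[symmetric]) auto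
  ultimately show ?case unfolding f
    by (simp only: upper_product_Cons list.map fst_conv reach_Cons converse_relcomp relcomp_Image)
qed

definition gram :: "nat \<Rightarrow> (nat \<Rightarrow> real) \<Rightarrow> real mat \<Rightarrow> real mat" where
  "gram n d U = U\<^sup>T * mat_diag n d * U"

lemma gram_carrier [simp]: "U \<in> carrier_mat n n \<Longrightarrow> gram n d U \<in> carrier_mat n n"
  unfolding gram_def by (auto intro!: mult_carrier_mat)

lemma gram_dim [simp]: "U \<in> carrier_mat n n \<Longrightarrow> dim_row (gram n d U) = n" "U \<in> carrier_mat n n \<Longrightarrow> dim_col (gram n d U) = n"
  by (rule carrier_matD[OF gram_carrier], assumption)+

lemma pattern_gram:
  assumes M: "M \<in> carrier_mat m n" and I: "I \<subseteq> {..<m}" "card I = k" and d: "\<forall>i<n. 0 < d i"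
    and fs: "valid n fs" and pat: "pattern n k I M S"
  shows "pattern n k I (M * gram n d (upper_product n fs))
    (((reach (map fst fs))\<inverse> O reach (map fst fs)) `` S)"
proof -
  let ?U = "upper_product n fs"
  have "pattern n k I (M * ?U\<^sup>T) ((reach (map fst fs))\<inverse> `` S)"
    by (rule pattern_lower_product[OF M I fs pat])
  then have "pattern n k I (M * ?U\<^sup>T * mat_diag n d) ((reach (map fst fs))\<inverse> `` S)"
    by (intro pattern_diag[OF _ I d]) (use M in \<open>auto intro!: mult_carrier_mat\<close>)
  then have "pattern n k I (M * ?U\<^sup>T * mat_diag n d * ?U) (reach (map fst fs) `` ((reach (map fst fs))\<inverse> `` S))"
    by (intro pattern_upper_product[OF _ I fs]) (use M in \<open>auto intro!: mult_carrier_mat\<close>)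
  moreover have "M * ?U\<^sup>T * mat_diag n d * ?U = M * gram n d ?U"
  proof -
    have c: "?U\<^sup>T \<in> carrier_mat n n" "?U\<^sup>T * mat_diag n d \<in> carrier_mat n n"
      by (auto intro!: mult_carrier_mat)
    show ?thesis
      by (simp only: assoc_mult_mat[OF M c(1) mat_diag_dim] assoc_mult_mat[OF M c(2) upper_product_carrier] gram_def)
  qed
  ultimately show ?thesis by (simp only: relcomp_Image)
qed

lemma pattern_gram_pow:
  assumes I: "I \<subseteq> {..<n}" "card I = k" and d: "\<forall>i<n. 0 < d i" and fs: "valid n fs"
  shows "pattern n k I (gram n d (upper_product n fs) ^\<^sub>m l)
    ((((reach (map fst fs))\<inverse> O reach (map fst fs)) ^^ l) `` {I})"
proof (induction l)
  case 0
  then show ?case using pattern_one[OF I] by simp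
next
  case (Suc l)
  show ?case unfolding pow_mat.simps relpow.simps relcomp_Image
    by (rule pattern_gram[OF _ I d fs Suc, unfolded relcomp_Image]) (auto intro!: pow_carrier_mat)
qed

lemma gram_pow_carrier [simp]: "U \<in> carrier_mat n n \<Longrightarrow> gram n d U ^\<^sub>m m \<in> carrier_mat n n"
  by (intro pow_carrier_mat gram_carrier)

text \<open>The minor with the first k rows and the last k columns is decisive. If it is positive,
  \<open>alternating_downset\<close> forces m upward passes to reach the top. Conversely, if they
  reach the top, then every J is reachable from \<open>{..<k}\<close>, so any I can descend to
  \<open>{..<k}\<close> and rise to any J.\<close>

lemma minors_positive_iff:
  assumes k: "k \<le> n" and d: "\<forall>i<n. 0 < d i" and fs: "valid n fs"
  shows "(\<forall>x\<in>minors k (gram n d (upper_product n fs) ^\<^sub>m m). 0 < x)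
    \<longleftrightarrow> acts (wpow m (map fst fs)) {..<k} = {n - k..<n}"
proof -
  let ?A = "gram n d (upper_product n fs) ^\<^sub>m m" and ?ws = "map fst fs"
  let ?R = "reach (map fst fs)"
  have A: "?A \<in> carrier_mat n n" by simp
  then have dims: "dim_row ?A = n" "dim_col ?A = n" by (metis carrier_matD)+
  have pos: "0 < minor ?A I J \<longleftrightarrow> (I, J) \<in> (?R\<inverse> O ?R) ^^ m"
    if "I \<subseteq> {..<n}" "card I = k" "J \<subseteq> {..<n}" "card J = k" for I J
    using pattern_gram_pow[OF that(1,2) d fs, of m] that(3,4) unfolding pattern_def by auto
  have L: "{..<k} \<subseteq> {..<n}" "card {..<k} = k" using k by auto
  have T: "{n - k..<n} \<subseteq> {..<n}" "card {n - k..<n} = k" using k by auto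
  show ?thesis
  proof
    assume "\<forall>x\<in>minors k ?A. 0 < x"
    moreover have "minor ?A {..<k} {n - k..<n} \<in> minors k ?A"
      unfolding minors_def dims using L T by blast
    ultimately have "({..<k}, {n - k..<n}) \<in> (?R\<inverse> O ?R) ^^ m" using pos[OF L T] by blast
    then have "{n - k..<n} \<in> ((?R\<inverse> O ?R) ^^ m) `` {{..<k}}" by blast
    then have le: "gale_le {n - k..<n} (acts (wpow m ?ws) {..<k})" using alternating_downset by blast
    have "\<forall>i\<in>set ?ws. Suc i < n" using fs by (auto simp: valid_def)
    then have "\<forall>i\<in>set (wpow m ?ws). Suc i < n" using set_wpow[of m ?ws] by blast
    then have "acts (wpow m ?ws) {..<k} \<subseteq> {..<n}" by (rule acts_subset[OF L(1)])
    from gale_top_eq[OF this _ le] show "acts (wpow m ?ws) {..<k} = {n - k..<n}" by simp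
  next
    assume top: "acts (wpow m ?ws) {..<k} = {n - k..<n}"
    have reach: "({..<k}, J) \<in> reach (wpow m ?ws)" if "J \<subseteq> {..<n}" "card J = k" for J
      unfolding reach_lower top using that by (rule gale_le_top)
    show "\<forall>x\<in>minors k ?A. 0 < x"
    proof
      fix x assume "x \<in> minors k ?A"
      then obtain I J where x: "x = minor ?A I J" and IJ: "I \<subseteq> {..<n}" "card I = k" "J \<subseteq> {..<n}" "card J = k"
        unfolding minors_def dims by blast
      have "(I, J) \<in> (reach (wpow m ?ws))\<inverse> O reach (wpow m ?ws)"
        using reach[OF IJ(1,2)] reach[OF IJ(3,4)] by blast
      then have "(I, J) \<in> (?R\<inverse> O ?R) ^^ m" using reach_alternating by blast
      then show "0 < x" unfolding x using pos[OF IJ] by blast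
    qed
  qed
qed

lemma minor_exponent_gram:
  assumes "k \<le> n" "\<forall>i<n. 0 < d i" "valid n fs"
  shows "minor_exponent k (gram n d (upper_product n fs)) = expo n (map fst fs) k"
  unfolding minor_exponent_def expo_def minors_positive_iff[OF assms] ..

lemma totally_nonnegative_gram:
  assumes d: "\<forall>i<n. 0 < d i" and fs: "valid n fs"
  shows "totally_nonnegative (gram n d (upper_product n fs))"
  unfolding totally_nonnegative_def
proof (intro allI impI ballI)
  fix k x assume "x \<in> minors k (gram n d (upper_product n fs))"
  then obtain I J where x: "x = minor (gram n d (upper_product n fs)) I J"
    and IJ: "I \<subseteq> {..<n}" "card I = k" "J \<subseteq> {..<n}" "card J = k"
    unfolding minors_def by auto
  have "pattern n k I (1\<^sub>m n * gram n d (upper_product n fs))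
      (((reach (map fst fs))\<inverse> O reach (map fst fs)) `` {I})"
    by (rule pattern_gram[OF _ IJ(1,2) d fs pattern_one[OF IJ(1,2)]]) simp
  moreover have "1\<^sub>m n * gram n d (upper_product n fs) = gram n d (upper_product n fs)"
    by (rule left_mult_one_mat[of _ n n]) simp
  ultimately show "0 \<le> x" unfolding x pattern_def using IJ by simp
qed

lemma corner_minor_gram:
  assumes k: "k \<le> n" and d: "\<forall>i<n. 0 < d i" and fs: "valid n fs"
  shows "minor (gram n d (upper_product n fs)) {..<k} {n - k..<n} = 0
    \<longleftrightarrow> acts (map fst fs) {..<k} \<noteq> {n - k..<n}"
proof -
  let ?A = "gram n d (upper_product n fs)" and ?R = "reach (map fst fs)"
  have L: "{..<k} \<subseteq> {..<n}" "card {..<k} = k" using k by auto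
  have T: "{n - k..<n} \<subseteq> {..<n}" "card {n - k..<n} = k" using k by auto
  have "pattern n k {..<k} (1\<^sub>m n * ?A) ((?R\<inverse> O ?R) `` {{..<k}})"
    by (rule pattern_gram[OF _ L d fs pattern_one[OF L]]) simp
  moreover have "1\<^sub>m n * ?A = ?A" by (rule left_mult_one_mat[of _ n n]) simp
  ultimately have "0 \<le> minor ?A {..<k} {n - k..<n}"
    "0 < minor ?A {..<k} {n - k..<n} \<longleftrightarrow> ({..<k}, {n - k..<n}) \<in> ?R\<inverse> O ?R"
    unfolding pattern_def using T by auto
  moreover have "({..<k}, {n - k..<n}) \<in> ?R\<inverse> O ?R \<longleftrightarrow> acts (map fst fs) {..<k} = {n - k..<n}"
  proof
    assume "({..<k}, {n - k..<n}) \<in> ?R\<inverse> O ?R"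
    then have "{n - k..<n} \<in> ((?R\<inverse> O ?R) ^^ 1) `` {{..<k}}" by simp
    then have le: "gale_le {n - k..<n} (acts (wpow 1 (map fst fs)) {..<k})" using alternating_downset by blast
    have "\<forall>i\<in>set (map fst fs). Suc i < n" using fs by (auto simp: valid_def)
    then have "acts (map fst fs) {..<k} \<subseteq> {..<n}" by (rule acts_subset[OF L(1)])
    from gale_top_eq[OF this] le show "acts (map fst fs) {..<k} = {n - k..<n}" by (simp add: wpow_def)
  next
    assume top: "acts (map fst fs) {..<k} = {n - k..<n}"
    have "({..<k}, {n - k..<n}) \<in> ?R" unfolding reach_lower top by (simp add: gale_refl)
    moreover have "({..<k}, {..<k}) \<in> ?R" unfolding reach_lower by (simp add: gale_acts)
    ultimately show "({..<k}, {n - k..<n}) \<in> ?R\<inverse> O ?R" by blast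
  qed
  ultimately show ?thesis by (metis order_less_le)
qed

section \<open>Reduced factorizations\<close>

lemma elem_upper_index:
  "x < n \<Longrightarrow> y < n \<Longrightarrow> elem_upper n i a $$ (x, y) =
    (if x = y then 1 else 0) + (if x = i \<and> y = Suc i then a else 0)"
  by (simp add: elem_upper_def)

lemma elem_upper_add:
  assumes "Suc i < n"
  shows "elem_upper n i a * elem_upper n i b = elem_upper n i (a + b)"
proof (rule eq_matI)
  fix x y assume "x < dim_row (elem_upper n i (a + b))" "y < dim_col (elem_upper n i (a + b))"
  then have xy: "x < n" "y < n" by simp_all
  show "(elem_upper n i a * elem_upper n i b) $$ (x, y) = elem_upper n i (a + b) $$ (x, y)"
    using assms xy by (simp add: mult_elem_upper[OF elem_upper_carrier assms xy] elem_upper_index)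
qed simp_all

lemma elem_upper_commute:
  assumes ij: "Suc i < n" "Suc j < n" "i \<noteq> Suc j" "j \<noteq> Suc i"
  shows "elem_upper n i a * elem_upper n j b = elem_upper n j b * elem_upper n i a"
proof (rule eq_matI)
  fix x y assume "x < dim_row (elem_upper n j b * elem_upper n i a)" "y < dim_col (elem_upper n j b * elem_upper n i a)"
  then have xy: "x < n" "y < n" by simp_all
  show "(elem_upper n i a * elem_upper n j b) $$ (x, y) = (elem_upper n j b * elem_upper n i a) $$ (x, y)"
    unfolding mult_elem_upper[OF elem_upper_carrier ij(1) xy] mult_elem_upper[OF elem_upper_carrier ij(2) xy]
    using ij xy by (simp add: elem_upper_index)
qed simp_all

text \<open>The new parameters arise by comparing entries. They are formed without subtraction, so
  positive parameters remain positive.\<close>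

lemma elem_upper_braid:
  assumes ij: "Suc i < n" "Suc j < n" "i = Suc j \<or> j = Suc i" and ac: "a + c \<noteq> 0"
  shows "elem_upper n i a * elem_upper n j b * elem_upper n i c =
    elem_upper n j (b * c / (a + c)) * elem_upper n i (a + c) * elem_upper n j (a * b / (a + c))"
proof (rule eq_matI, goal_cases)
  case (1 x y)
  then have xy: "x < n" "y < n" by simp_all
  have c: "elem_upper n p u * elem_upper n q v \<in> carrier_mat n n" for p q u v
    by (rule mult_carrier_mat[OF elem_upper_carrier elem_upper_carrier])
  have lt: "i < n" "j < n" using ij by auto
  define al be where "al = a * b / (a + c)" and "be = b * c / (a + c)"
  have "be * (a + c) = b * c" "al * (a + c) = a * b" using ac by (simp_all add: al_def be_def)
  moreover have "al + be = b"
  proof -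
    have "al + be = (b * (a + c)) / (a + c)"
      unfolding al_def be_def add_divide_distrib[symmetric] by (simp only: distrib_left mult.commute)
    then show ?thesis using ac by simp
  qed
  ultimately have ab: "be * a + be * c = b * c" "a * al + c * al = a * b" "al + be = b"
    by (simp_all add: algebra_simps)
  note e = mult_elem_upper[OF elem_upper_carrier]
  have "(i = Suc j \<longrightarrow> ?case) \<and> (j = Suc i \<longrightarrow> ?case)"
    unfolding al_def[symmetric] be_def[symmetric] mult_elem_upper[OF c ij(1) xy] mult_elem_upper[OF c ij(2) xy]
      e[OF ij(1) xy] e[OF ij(2) xy] e[OF ij(1) xy(1) lt(1)] e[OF ij(2) xy(1) lt(1)]
      e[OF ij(1) xy(1) lt(2)] e[OF ij(2) xy(1) lt(2)]
    using ij(1,2) xy lt ab by (simp add: elem_upper_index algebra_simps)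
  with ij(3) show ?case by blast
qed simp_all

abbreviation word_perm :: "(nat \<times> real) list \<Rightarrow> nat \<Rightarrow> nat" where
  "word_perm fs \<equiv> perm (map fst fs)"

definition reduced :: "nat \<Rightarrow> (nat \<times> real) list \<Rightarrow> bool" where
  "reduced n fs \<longleftrightarrow> perm_length n (map fst fs) = length fs"

lemma valid_letters: "valid n fs \<Longrightarrow> \<forall>i\<in>set (map fst fs). Suc i < n"
  by (auto simp: valid_def)

lemma reduced_Nil [simp]: "reduced n []"
  by (simp add: reduced_def)

lemma reduced_Cons:
  assumes "valid n ((i, a) # fs)"
  shows "reduced n ((i, a) # fs) \<longleftrightarrow> reduced n fs \<and> ascent i (word_perm fs)"
proof -
  have "Suc i < n" and "perm_length n (map fst fs) \<le> length fs"
    using assms perm_length_le[OF valid_letters, of n fs] by simp_all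
  then show ?thesis by (auto simp: reduced_def perm_length_Cons)
qed

lemma word_perm_Cons: "word_perm ((i, a) # fs) = pos_step i (word_perm fs)"
  by (simp add: perm_Cons)

lemma pos_step_ascent: "ascent i p \<Longrightarrow> pos_step i p = p \<circ> transpose i (Suc i)"
  by (simp add: pos_step_def ascent_def)

lemma not_ascent: "bij p \<Longrightarrow> \<not> ascent i p \<longleftrightarrow> p (Suc i) < p i"
  unfolding ascent_def by (metis bij_is_inj inj_eq n_not_Suc_n nat_neq_iff less_asym)

lemma braid_perm:
  assumes adj: "i = Suc j \<or> j = Suc i" and asc: "ascent j (p \<circ> transpose j (Suc j) \<circ> transpose i (Suc i))"
    "ascent i (p \<circ> transpose j (Suc j))" "ascent j p"
  shows "pos_step i (pos_step j (pos_step i p))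
      = p \<circ> transpose j (Suc j) \<circ> transpose i (Suc i) \<circ> transpose j (Suc j)"
    and "ascent i (pos_step j (pos_step i p))"
proof -
  let ?s = "transpose j (Suc j)" and ?t = "transpose i (Suc i)"
  have 1: "ascent i p" using adj asc by (auto simp: ascent_def transpose_def split: if_splits)
  have 2: "ascent j (p \<circ> ?t)" using adj asc by (auto simp: ascent_def transpose_def split: if_splits)
  have 3: "ascent i (p \<circ> ?t \<circ> ?s)" using adj asc by (auto simp: ascent_def transpose_def split: if_splits)
  have br: "?t \<circ> ?s \<circ> ?t = ?s \<circ> ?t \<circ> ?s" using adj by (auto simp: fun_eq_iff transpose_def)
  have step: "pos_step j (pos_step i p) = p \<circ> ?t \<circ> ?s" using 1 2 by (simp add: pos_step_ascent)
  show "ascent i (pos_step j (pos_step i p))" unfolding step by (rule 3)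
  show "pos_step i (pos_step j (pos_step i p)) = p \<circ> ?s \<circ> ?t \<circ> ?s"
    unfolding step pos_step_ascent[OF 3] using br by (simp add: o_assoc[symmetric])
qed

text \<open>The exchange property of reduced words, carried out on matrices: a descent at i allows
  the word to be rewritten, by commutations and braid relations with positive parameters, so that it
  starts with i. The induction is on the length. A first letter j far from i leaves the descent at i
  visible in the tail and commutes with the letter brought forward.\<close>

lemma exchange:
  assumes "valid n fs" "reduced n fs" "Suc i < n" "\<not> ascent i (word_perm fs)"
  shows "\<exists>b gs. valid n ((i, b) # gs) \<and> reduced n gs \<and> length fs = Suc (length gs)
    \<and> upper_product n fs = elem_upper n i b * upper_product n gs
    \<and> ascent i (word_perm gs) \<and> word_perm fs = pos_step i (word_perm gs)"
  using assms
proof (induction fs arbitrary: i rule: length_induct)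
  case (1 fs)
  note IH = 1(1)[rule_format] and v = 1(2) and red = 1(3) and i = 1(4) and desc = 1(5)
  show ?case
  proof (cases fs)
    case Nil
    with desc show ?thesis by (simp add: ascent_def)
  next
    case (Cons f gs)
    obtain j a where f: "f = (j, a)" by (cases f)
    note fs = Cons[unfolded f]
    have vg: "valid n gs" "Suc j < n" "0 < a" using v fs by simp_all
    have rg: "reduced n gs" "ascent j (word_perm gs)" using red reduced_Cons[of n j a gs] v fs by auto
    have len: "length gs < length fs" using fs by simp
    let ?p = "word_perm gs" and ?s = "transpose j (Suc j)" and ?t = "transpose i (Suc i)"
    have pfs: "word_perm fs = ?p \<circ> ?s" using rg(2) fs by (simp add: word_perm_Cons pos_step_ascent perm_Cons)
    have bp: "bij ?p" by (rule bij_perm)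
    consider (same) "j = i" | (far) "i \<noteq> j" "i \<noteq> Suc j" "j \<noteq> Suc i" | (adj) "i = Suc j \<or> j = Suc i" by blast
    then show ?thesis
    proof cases
      case same
      then show ?thesis using v fs rg by (intro exI[of _ a] exI[of _ gs]) (simp add: perm_Cons)
    next
      case far
      have "?s i = i" "?s (Suc i) = Suc i" using far by (auto simp: transpose_def)
      then have "\<not> ascent i ?p" using desc unfolding pfs ascent_def by simp
      then obtain b hs where h: "valid n ((i, b) # hs)" "reduced n hs" "length gs = Suc (length hs)"
        "upper_product n gs = elem_upper n i b * upper_product n hs" "ascent i (word_perm hs)"
        "?p = pos_step i (word_perm hs)"
        using IH[OF len vg(1) rg(1) i] by blast
      let ?q = "word_perm hs"
      have p: "?p = ?q \<circ> ?t" using h(5,6) by (simp add: pos_step_ascent)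
      have "?t j = j" "?t (Suc j) = Suc j" using far by (auto simp: transpose_def)
      then have aj: "ascent j ?q" using rg(2) unfolding p ascent_def by simp
      have ai: "ascent i (?q \<circ> ?s)" using h(5) \<open>?s i = i\<close> \<open>?s (Suc i) = Suc i\<close> by (simp add: ascent_def)
      have st: "?t \<circ> ?s = ?s \<circ> ?t" using far by (auto simp: fun_eq_iff transpose_def)
      have vh: "valid n ((j, a) # hs)" "valid n ((i, b) # (j, a) # hs)" using h(1) vg by simp_all
      have rh: "reduced n ((j, a) # hs)" using reduced_Cons[OF vh(1)] h(2) aj by simp
      have pj: "word_perm ((j, a) # hs) = ?q \<circ> ?s" by (simp add: perm_Cons pos_step_ascent[OF aj])
      have "upper_product n fs = elem_upper n j a * (elem_upper n i b * upper_product n hs)"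
        using fs h(4) by simp
      also have "\<dots> = (elem_upper n j a * elem_upper n i b) * upper_product n hs"
        by (rule assoc_mult_mat[OF elem_upper_carrier elem_upper_carrier upper_product_carrier, symmetric])
      also have "\<dots> = (elem_upper n i b * elem_upper n j a) * upper_product n hs"
        using far i vg by (simp add: elem_upper_commute)
      also have "\<dots> = elem_upper n i b * upper_product n ((j, a) # hs)"
        unfolding upper_product_Cons by (rule assoc_mult_mat[OF elem_upper_carrier elem_upper_carrier upper_product_carrier])
      finally have up: "upper_product n fs = elem_upper n i b * upper_product n ((j, a) # hs)" .
      have "word_perm fs = pos_step i (word_perm ((j, a) # hs))"
        unfolding pfs p pj pos_step_ascent[OF ai] using st by (simp add: o_assoc[symmetric])
      moreover have "length fs = Suc (length ((j, a) # hs))" using h(3) fs by simp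
      moreover have "ascent i (word_perm ((j, a) # hs))" unfolding pj by (rule ai)
      ultimately show ?thesis using vh(2) rh up by blast
    next
      \<comment> \<open>The word has descents at i and at j, so its tail can be rewritten to start
        with i and what follows to start with j. The initial letters j, i, j are then braided into
        i, j, i.\<close>
      case adj
      have d: "\<not> ascent i (?p \<circ> ?s)" using desc unfolding pfs .
      have bps: "bij (?p \<circ> ?s)" using bp by (simp add: bij_comp)
      have d': "(?p \<circ> ?s) (Suc i) < (?p \<circ> ?s) i" using d not_ascent[OF bps] by simp
      have "\<not> ascent i ?p" using adj d' rg(2) by (auto simp: ascent_def transpose_def split: if_splits)
      then obtain b hs where h: "valid n ((i, b) # hs)" "reduced n hs" "length gs = Suc (length hs)"
        "upper_product n gs = elem_upper n i b * upper_product n hs" "ascent i (word_perm hs)"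
        "?p = pos_step i (word_perm hs)"
        using IH[OF len vg(1) rg(1) i] by blast
      let ?q = "word_perm hs"
      have p: "?p = ?q \<circ> ?t" using h(5,6) by (simp add: pos_step_ascent)
      have q: "?q = ?p \<circ> ?t" unfolding p by (simp add: fun_eq_iff)
      have "\<not> ascent j ?q" unfolding q using adj d' rg(2) by (auto simp: ascent_def transpose_def split: if_splits)
      moreover have "length hs < length fs" "valid n hs" using h(1,3) len by auto
      ultimately obtain c ks where k: "valid n ((j, c) # ks)" "reduced n ks" "length hs = Suc (length ks)"
        "upper_product n hs = elem_upper n j c * upper_product n ks" "ascent j (word_perm ks)"
        "?q = pos_step j (word_perm ks)"
        using IH[of hs j] h(2) vg(2) by blast
      let ?r = "word_perm ks"
      have q': "?q = ?r \<circ> ?s" using k(5,6) by (simp add: pos_step_ascent)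
      have asc: "ascent j (?r \<circ> ?s \<circ> ?t)" "ascent i (?r \<circ> ?s)" "ascent j ?r"
        using rg(2) h(5) k(5) p q' by simp_all
      note br = braid_perm[OF adj asc]
      have pos: "0 < a" "0 < b" "0 < c" using vg h(1) k(1) by simp_all
      let ?ls = "(j, a + c) # (i, a * b / (a + c)) # ks"
      have vl: "valid n ((i, a * b / (a + c)) # ks)" "valid n ?ls" "valid n ((i, b * c / (a + c)) # ?ls)"
        using pos k(1) i by simp_all
      have ai: "ascent i ?r" and aj: "ascent j (pos_step i ?r)"
        using adj asc by (auto simp: pos_step_def ascent_def transpose_def split: if_splits)
      have rl: "reduced n ?ls"
        unfolding reduced_Cons[OF vl(2)] reduced_Cons[OF vl(1)] using k(2) ai aj by (simp add: perm_Cons)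
      have pl: "word_perm ?ls = pos_step j (pos_step i ?r)" by (simp add: perm_Cons)
      let ?K = "upper_product n ks"
      have "upper_product n fs = elem_upper n j a * (elem_upper n i b * (elem_upper n j c * ?K))"
        using fs h(4) k(4) by simp
      also have "\<dots> = (elem_upper n j a * elem_upper n i b * elem_upper n j c) * ?K"
        by (simp add: assoc_mult_mat[of _ n n _ n _ n] mult_carrier_mat[of _ n n _ n])
      also have "\<dots> = (elem_upper n i (b * c / (a + c)) * elem_upper n j (a + c) * elem_upper n i (a * b / (a + c))) * ?K"
        using elem_upper_braid[of j n i a c b] i vg adj pos by auto
      also have "\<dots> = elem_upper n i (b * c / (a + c)) * upper_product n ?ls"
        by (simp add: assoc_mult_mat[of _ n n _ n _ n] mult_carrier_mat[of _ n n _ n])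
      finally have up: "upper_product n fs = elem_upper n i (b * c / (a + c)) * upper_product n ?ls" .
      have "word_perm fs = pos_step i (word_perm ?ls)" unfolding pl br(1) pfs p q' ..
      moreover have "length fs = Suc (length ?ls)" using h(3) k(3) fs by simp
      moreover have "ascent i (word_perm ?ls)" unfolding pl by (rule br(2))
      ultimately show ?thesis using vl(3) rl up by blast
    qed
  qed
qed

text \<open>A new letter i that does not lengthen the reduced word meets a descent at i.
  \<open>exchange\<close> brings a factor with the same index to the front, and the two merge by
  adding their parameters.\<close>

lemma reduce_word:
  assumes "valid n fs"
  shows "\<exists>gs. valid n gs \<and> reduced n gs \<and> upper_product n gs = upper_product n fs"
  using assms
proof (induction fs)
  case Nil
  show ?case by (rule exI[of _ "[]"]) simp
next
  case (Cons f fs)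
  obtain i a where f: "f = (i, a)" by (cases f)
  have i: "Suc i < n" "0 < a" "valid n fs" using Cons.prems f by simp_all
  then obtain gs where g: "valid n gs" "reduced n gs" "upper_product n gs = upper_product n fs"
    using Cons.IH by blast
  show ?case
  proof (cases "ascent i (word_perm gs)")
    case True
    have v: "valid n ((i, a) # gs)" using i g by simp
    then have "reduced n ((i, a) # gs)" using reduced_Cons g True by blast
    with v g f show ?thesis by (intro exI[of _ "(i, a) # gs"]) simp
  next
    case False
    from exchange[OF g(1,2) i(1) False] obtain b hs where h: "valid n ((i, b) # hs)" "reduced n hs"
      "upper_product n gs = elem_upper n i b * upper_product n hs" "ascent i (word_perm hs)" by blast
    have v: "valid n ((i, a + b) # hs)" using h(1) i by simp
    then have r: "reduced n ((i, a + b) # hs)" using reduced_Cons h by blast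
    have "upper_product n (f # fs) = elem_upper n i a * (elem_upper n i b * upper_product n hs)"
      using f g(3) h(3) by simp
    also have "\<dots> = (elem_upper n i a * elem_upper n i b) * upper_product n hs"
      by (rule assoc_mult_mat[OF elem_upper_carrier elem_upper_carrier upper_product_carrier, symmetric])
    also have "\<dots> = upper_product n ((i, a + b) # hs)" using elem_upper_add[OF i(1)] by simp
    finally show ?thesis using v r by metis
  qed
qed

lemma acts_large:
  assumes "n \<le> k" "\<forall>i\<in>set ws. Suc i < n"
  shows "acts ws {..<k} = {..<k}"
  using assms(2)
proof (induction ws)
  case (Cons i ws)
  then have "act i {..<k} = {..<k}" using assms(1) by (simp add: act_def)
  then show ?case using Cons by simp
qed simp

text \<open>The column sets of positive minors in the first k rows form the lower set below the
  image of \<open>{..<k}\<close>. The matrix therefore determines its maximum for every k, that is,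
  the whole flag of the permutation.\<close>

lemma word_perm_unique:
  assumes fs: "valid n fs" and gs: "valid n gs" and eq: "upper_product n fs = upper_product n gs"
  shows "word_perm fs = word_perm gs"
proof (rule perm_eqI)
  fix k
  show "acts (map fst fs) {..<k} = acts (map fst gs) {..<k}"
  proof (cases "k \<le> n")
    case False
    then show ?thesis using acts_large[OF _ valid_letters[OF fs], of k] acts_large[OF _ valid_letters[OF gs], of k] by simp
  next
    case True
    have L: "{..<k} \<subseteq> {..<n}" "card {..<k} = k" using True by auto
    have pos: "0 < minor (1\<^sub>m n * upper_product n hs) {..<k} J \<longleftrightarrow> gale_le J (acts (map fst hs) {..<k})"
      if "valid n hs" "J \<subseteq> {..<n}" "card J = k" for hs J
      using pattern_upper_product[OF one_carrier_mat L that(1) pattern_one[OF L]] that(2,3) reach_lower[of k J "map fst hs"]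
      unfolding pattern_def by auto
    have le: "gale_le (acts (map fst hs) {..<k}) (acts (map fst hs') {..<k})"
      if "valid n hs" "valid n hs'" "upper_product n hs = upper_product n hs'" for hs hs'
    proof -
      have sub: "acts (map fst hs) {..<k} \<subseteq> {..<n}" by (rule acts_subset[OF L(1) valid_letters[OF that(1)]])
      have "gale_le (acts (map fst hs) {..<k}) (acts (map fst hs) {..<k})" by (simp add: gale_refl)
      then show ?thesis using pos[OF that(1) sub] pos[OF that(2) sub] that(3) by simp
    qed
    show ?thesis by (rule gale_antisym[OF le[OF fs gs eq] le[OF gs fs eq[symmetric]]])
  qed
qed

lemma upper_length_eq:
  assumes fs: "valid n fs"
  shows "upper_length (upper_product n fs) = perm_length n (map fst fs)"
  unfolding upper_length_def
proof (rule Least_equality)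
  obtain gs where g: "valid n gs" "reduced n gs" "upper_product n gs = upper_product n fs"
    using reduce_word[OF fs] by blast
  have "word_perm gs = word_perm fs" by (rule word_perm_unique[OF g(1) fs g(3)])
  then have "length gs = perm_length n (map fst fs)" using g(2) by (simp add: reduced_def perm_length_def)
  then show "\<exists>hs. length hs = perm_length n (map fst fs)
     \<and> (\<forall>(i, a)\<in>set hs. Suc i < dim_row (upper_product n fs) \<and> 0 < a)
     \<and> upper_product n fs = upper_product (dim_row (upper_product n fs)) hs"
    using g unfolding valid_def by (intro exI[of _ gs]) simp
next
  fix s assume "\<exists>hs. length hs = s
     \<and> (\<forall>(i, a)\<in>set hs. Suc i < dim_row (upper_product n fs) \<and> 0 < a)
     \<and> upper_product n fs = upper_product (dim_row (upper_product n fs)) hs"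
  then obtain hs where h: "length hs = s" "valid n hs" "upper_product n fs = upper_product n hs"
    by (auto simp: valid_def)
  have "word_perm hs = word_perm fs" by (rule word_perm_unique[OF h(2) fs h(3)[symmetric]])
  then have "perm_length n (map fst fs) = perm_length n (map fst hs)" by (simp add: perm_length_def)
  also have "\<dots> \<le> s" using perm_length_le[OF valid_letters[OF h(2)]] h(1) by simp
  finally show "perm_length n (map fst fs) \<le> s" .
qed

lemma upper_length_square:
  assumes fs: "valid n fs"
  shows "upper_length (upper_product n fs ^\<^sub>m 2) = perm_length n (map fst fs @ map fst fs)"
proof -
  have "upper_product n fs ^\<^sub>m 2 = upper_product n (fs @ fs)"
    by (simp add: numeral_2_eq_2 upper_product_append left_mult_one_mat[OF upper_product_carrier])
  then show ?thesis using upper_length_eq[of n "fs @ fs"] fs by simp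
qed

section \<open>Factorization of unit upper triangular matrices\<close>

definition unit_upper :: "nat \<Rightarrow> real mat \<Rightarrow> bool" where
  "unit_upper n U \<longleftrightarrow> U \<in> carrier_mat n n
     \<and> (\<forall>x<n. \<forall>y<n. y < x \<longrightarrow> U $$ (x, y) = 0) \<and> (\<forall>x<n. U $$ (x, x) = 1)"

lemma unit_upperD:
  assumes "unit_upper n U"
  shows "U \<in> carrier_mat n n" "x < n \<Longrightarrow> y < x \<Longrightarrow> U $$ (x, y) = 0" "x < n \<Longrightarrow> U $$ (x, x) = 1"
  using assms by (auto simp: unit_upper_def)

lemma unit_upper_one: "unit_upper n (1\<^sub>m n)"
  by (auto simp: unit_upper_def)

lemma unit_upper_elem:
  assumes U: "unit_upper n U" and i: "Suc i < n"
  shows "unit_upper n (U * elem_upper n i a)"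
proof -
  note UD = unit_upperD[OF U]
  note e = mult_elem_upper[OF UD(1) i]
  have "U * elem_upper n i a \<in> carrier_mat n n" by (rule mult_carrier_mat[OF UD(1)]) simp
  moreover have "(U * elem_upper n i a) $$ (x, y) = 0" if "x < n" "y < n" "y < x" for x y
    unfolding e[OF that(1,2)] using that UD(2)[of x y] UD(2)[of x i] by auto
  moreover have "(U * elem_upper n i a) $$ (x, x) = 1" if "x < n" for x
    unfolding e[OF that that] using that UD(3)[of x] UD(2)[of x i] by auto
  ultimately show ?thesis by (auto simp: unit_upper_def)
qed

lemma unit_upper_mult_product:
  assumes "unit_upper n U" "\<forall>(i, a)\<in>set fs. Suc i < n"
  shows "unit_upper n (U * upper_product n fs)"
  using assms
proof (induction fs arbitrary: U)
  case Nil
  then show ?case using unit_upperD(1)[OF Nil(1)] by (simp add: right_mult_one_mat)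
next
  case (Cons f fs)
  obtain i a where f: "f = (i, a)" by (cases f)
  have "unit_upper n (U * elem_upper n i a * upper_product n fs)"
    by (rule Cons.IH[OF unit_upper_elem]) (use Cons.prems f in auto)
  moreover have "U * elem_upper n i a * upper_product n fs = U * upper_product n (f # fs)"
    unfolding f upper_product_Cons
    by (rule assoc_mult_mat[OF unit_upperD(1)[OF Cons.prems(1)] elem_upper_carrier upper_product_carrier])
  ultimately show ?case by simp
qed

lemma unit_upper_product: "\<forall>(i, a)\<in>set fs. Suc i < n \<Longrightarrow> unit_upper n (upper_product n fs)"
  using unit_upper_mult_product[OF unit_upper_one] by (simp add: left_mult_one_mat[OF upper_product_carrier])

section \<open>Neville elimination\<close>

text \<open>Minors with consecutive rows and consecutive columns: the pivots and multipliers of the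
  elimination below are governed by them. The case k = 0 gives 1.\<close>

definition block_minor :: "real mat \<Rightarrow> nat \<Rightarrow> nat \<Rightarrow> nat \<Rightarrow> real" where
  "block_minor U r j k = det (mat k k (\<lambda>(a, b). U $$ (r + a, j + b)))"

lemma block_minor_1: "block_minor U r j (Suc 0) = U $$ (r, j)"
  by (simp add: block_minor_def det_single)

lemma det_column_differences:
  fixes X Y :: "real mat"
  assumes X: "X \<in> carrier_mat m m" and Y: "Y \<in> carrier_mat m m"
    and XY: "\<And>a b. a < m \<Longrightarrow> b < m \<Longrightarrow>
      Y $$ (a, b) = X $$ (a, b) - (case b of 0 \<Rightarrow> 0 | Suc c \<Rightarrow> t b * X $$ (a, c))"
  shows "det Y = det X"
proof -
  define T :: "real mat" where
    "T = mat m m (\<lambda>(c, b). (if c = b then 1 else 0) - (if Suc c = b then t b else 0))"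
  have T: "T \<in> carrier_mat m m" by (simp add: T_def)
  have "Y = X * T"
  proof (rule eq_matI)
    fix a b assume "a < dim_row (X * T)" "b < dim_col (X * T)"
    then have ab: "a < m" "b < m" using X T by auto
    have "(X * T) $$ (a, b) = (\<Sum>c\<in>{0..<m}. X $$ (a, c) * T $$ (c, b))"
      using ab X T by (simp add: scalar_prod_def)
    also have "\<dots> = (\<Sum>c\<in>{0..<m}. (if c = b then X $$ (a, c) else 0) - (if Suc c = b then t b * X $$ (a, c) else 0))"
      using ab by (intro sum.cong refl) (auto simp: T_def algebra_simps)
    also have "\<dots> = X $$ (a, b) - (\<Sum>c\<in>{0..<m}. if Suc c = b then t b * X $$ (a, c) else 0)"
      using ab by (simp add: sum_subtractf)
    also have "(\<Sum>c\<in>{0..<m}. if Suc c = b then t b * X $$ (a, c) else 0)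
        = (case b of 0 \<Rightarrow> 0 | Suc c \<Rightarrow> t b * X $$ (a, c))"
      using ab by (cases b) simp_all
    finally show "Y $$ (a, b) = (X * T) $$ (a, b)" using XY[OF ab] by simp
  qed (use X Y T in auto)
  then have "det Y = det X * det T" using det_mult[OF X T] by simp
  moreover have "det T = prod_list (diag_mat T)"
    by (rule det_upper_triangular[OF _ T]) (auto simp: upper_triangular_def T_def)
  moreover have "\<dots> = 1" by (auto simp: prod_list_diag_prod T_def)
  ultimately show ?thesis by simp
qed

text \<open>Row r is cleared to the right of the diagonal by subtracting from each column a multiple
  of its left neighbour, not of the pivot column. The neighbours are the original columns, which
  makes the whole operation invertible by a single run of factors r, ..., n - 2.\<close>

definition column_elim :: "nat \<Rightarrow> nat \<Rightarrow> real mat \<Rightarrow> real mat" where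
  "column_elim n r U = mat n n (\<lambda>(x, y). if y \<le> r then U $$ (x, y)
     else U $$ (x, y) - U $$ (r, y) / U $$ (r, y - 1) * U $$ (x, y - 1))"

definition identity_rows :: "nat \<Rightarrow> nat \<Rightarrow> real mat \<Rightarrow> bool" where
  "identity_rows n r U \<longleftrightarrow> (\<forall>x<r. \<forall>y<n. U $$ (x, y) = (if x = y then 1 else 0))"

lemma column_elim_index:
  "x < n \<Longrightarrow> y < n \<Longrightarrow> column_elim n r U $$ (x, y) = (if y \<le> r then U $$ (x, y)
     else U $$ (x, y) - U $$ (r, y) / U $$ (r, y - 1) * U $$ (x, y - 1))"
  by (simp add: column_elim_def)

lemma column_elim_product:
  assumes U: "U \<in> carrier_mat n n" and r: "r < n"
  shows "U = column_elim n r U * upper_product n (map (\<lambda>i. (i, U $$ (r, Suc i) / U $$ (r, i))) [r..<n - 1])"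
proof -
  \<comment> \<open>Interpolates between the eliminated matrix, at s = r, and U, at s = n - 1: the
    columns up to s are already restored, and factor s restores the next one.\<close>
  define V where "V s = mat n n (\<lambda>(x, y). if y \<le> s then U $$ (x, y) else column_elim n r U $$ (x, y))" for s
  have V: "V s \<in> carrier_mat n n" for s by (simp add: V_def)
  have Vdim: "dim_row (V s) = n" "dim_col (V s) = n" for s by (simp_all add: V_def)
  have V_step: "V s * elem_upper n s (U $$ (r, Suc s) / U $$ (r, s)) = V (Suc s)" if s: "r \<le> s" "s < n - 1" for s
  proof (rule eq_matI)
    have Ss: "Suc s < n" using s by simp
    fix x y assume "x < dim_row (V (Suc s))" "y < dim_col (V (Suc s))"
    then have xy: "x < n" "y < n" using V[of "Suc s"] by auto
    show "(V s * elem_upper n s (U $$ (r, Suc s) / U $$ (r, s))) $$ (x, y) = V (Suc s) $$ (x, y)"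
      unfolding mult_elem_upper[OF V Ss xy] using xy Ss s
      by (auto simp: V_def column_elim_index not_le less_Suc_eq_le)
  qed (simp_all add: Vdim)
  have "V s * upper_product n (map (\<lambda>i. (i, U $$ (r, Suc i) / U $$ (r, i))) [s..<n - 1]) = U"
    if s: "r \<le> s" "s \<le> n - 1" for s
    using s(2,1)
  proof (induction s rule: inc_induct)
    case base
    have "V (n - 1) = U" using U by (intro eq_matI) (auto simp: V_def)
    then show ?case using U by (simp add: right_mult_one_mat)
  next
    case (step s)
    let ?P = "upper_product n (map (\<lambda>i. (i, U $$ (r, Suc i) / U $$ (r, i))) [Suc s..<n - 1])"
    have "[s..<n - 1] = s # [Suc s..<n - 1]" using step.hyps by (simp add: upt_conv_Cons)
    then have "V s * upper_product n (map (\<lambda>i. (i, U $$ (r, Suc i) / U $$ (r, i))) [s..<n - 1])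
        = V s * (elem_upper n s (U $$ (r, Suc s) / U $$ (r, s)) * ?P)" by simp
    also have "\<dots> = V s * elem_upper n s (U $$ (r, Suc s) / U $$ (r, s)) * ?P"
      by (rule assoc_mult_mat[OF V elem_upper_carrier upper_product_carrier, symmetric])
    also have "\<dots> = V (Suc s) * ?P" using V_step[of s] step.hyps step.prems by simp
    also have "\<dots> = U" using step by simp
    finally show ?case .
  qed
  from this[of r] r have "V r * upper_product n (map (\<lambda>i. (i, U $$ (r, Suc i) / U $$ (r, i))) [r..<n - 1]) = U" by simp
  moreover have "V r = column_elim n r U" by (rule eq_matI) (auto simp: V_def column_elim_def)
  ultimately show ?thesis by simp
qed

lemma column_elim_unit_upper:
  assumes U: "unit_upper n U" and id: "identity_rows n r U" and r: "r < n"
    and nz: "\<And>y. r \<le> y \<Longrightarrow> y < n \<Longrightarrow> U $$ (r, y) \<noteq> 0"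
  shows "unit_upper n (column_elim n r U)" "identity_rows n (Suc r) (column_elim n r U)"
proof -
  note UD = unit_upperD[OF U]
  have I: "U $$ (x, y) = (if x = y then 1 else 0)" if "x < r" "y < n" for x y
    using id that by (auto simp: identity_rows_def)
  have "column_elim n r U $$ (x, y) = 0" if "x < n" "y < x" for x y
    using that UD(2)[of x y] UD(2)[of x "y - 1"] by (simp add: column_elim_index)
  moreover have "column_elim n r U $$ (x, x) = 1" if "x < n" for x
    using that UD(3)[of x] UD(2)[of x "x - 1"] by (simp add: column_elim_index)
  moreover have "column_elim n r U \<in> carrier_mat n n" by (simp add: column_elim_def)
  ultimately show "unit_upper n (column_elim n r U)" by (simp add: unit_upper_def)
  show "identity_rows n (Suc r) (column_elim n r U)"
    unfolding identity_rows_def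
  proof (intro allI impI)
    fix x y assume xy: "x < Suc r" "y < n"
    show "column_elim n r U $$ (x, y) = (if x = y then 1 else 0)"
    proof (cases "x < r")
      case True
      then show ?thesis using xy r I[of x y] I[of x "y - 1"] by (auto simp: column_elim_index)
    next
      case False
      then have x: "x = r" using xy by simp
      show ?thesis
      proof (cases "y \<le> r")
        case True
        then show ?thesis using x r xy UD(2)[of r y] UD(3)[of r] by (auto simp: column_elim_index)
      next
        case False
        then show ?thesis using x r xy nz[of "y - 1"] by (auto simp: column_elim_index)
      qed
    qed
  qed
qed

text \<open>The elimination acts on the columns j, j + 1, ... of the larger block without changing
  its determinant. Its first row then vanishes except for the entry at j - 1, along which the
  determinant expands; hence the block one row higher and one column further left.\<close>

lemma block_minor_column_elim:
  assumes U: "unit_upper n U" and id: "identity_rows n r U" and r: "r < n"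
    and nz: "\<And>y. r \<le> y \<Longrightarrow> y < n \<Longrightarrow> U $$ (r, y) \<noteq> 0"
    and j: "r < j" "j + k \<le> n"
  shows "block_minor U r (j - 1) (Suc k) = U $$ (r, j - 1) * block_minor (column_elim n r U) (Suc r) j k"
proof -
  let ?C = "column_elim n r U"
  let ?X = "mat (Suc k) (Suc k) (\<lambda>(a, b). U $$ (r + a, j - 1 + b))"
  let ?Y = "mat (Suc k) (Suc k) (\<lambda>(a, b). if b = 0 then U $$ (r + a, j - 1) else ?C $$ (r + a, j - 1 + b))"
  have idr: "identity_rows n (Suc r) ?C" by (rule column_elim_unit_upper(2)[OF U id r nz])
  have "det ?Y = det ?X"
  proof (rule det_column_differences[where t = "\<lambda>b. U $$ (r, j - 1 + b) / U $$ (r, j - 1 + b - 1)"])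
    fix a b assume ab: "a < Suc k" "b < Suc k"
    show "?Y $$ (a, b) = ?X $$ (a, b) - (case b of 0 \<Rightarrow> 0
        | Suc c \<Rightarrow> U $$ (r, j - 1 + b) / U $$ (r, j - 1 + b - 1) * ?X $$ (a, c))"
    proof (cases b)
      case 0
      then show ?thesis using ab by simp
    next
      case (Suc c)
      then show ?thesis using ab j by (simp add: column_elim_index)
    qed
  qed simp_all
  moreover have "det ?Y = (\<Sum>b<Suc k. ?Y $$ (0, b) * cofactor ?Y 0 b)"
    by (rule laplace_expansion_row) simp_all
  moreover have "\<dots> = ?Y $$ (0, 0) * cofactor ?Y 0 0 + (\<Sum>b<k. ?Y $$ (0, Suc b) * cofactor ?Y 0 (Suc b))"
    by (rule sum.lessThan_Suc_shift)
  moreover have "(\<Sum>b<k. ?Y $$ (0, Suc b) * cofactor ?Y 0 (Suc b)) = 0"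
  proof (intro sum.neutral ballI)
    fix b assume b: "b \<in> {..<k}"
    have "?C $$ (r, j - 1 + Suc b) = 0" using idr b j by (simp add: identity_rows_def)
    then have "?Y $$ (0, Suc b) = 0" using b by simp
    then show "?Y $$ (0, Suc b) * cofactor ?Y 0 (Suc b) = 0" by (simp only: mult_zero_left)
  qed
  moreover have "cofactor ?Y 0 0 = block_minor ?C (Suc r) j k"
  proof -
    have "mat_delete ?Y 0 0 = mat k k (\<lambda>(a, b). ?C $$ (Suc r + a, j + b))"
      unfolding mat_delete_def using j by (intro eq_matI) auto
    then show ?thesis by (simp add: cofactor_def block_minor_def)
  qed
  moreover have "?Y $$ (0, 0) = U $$ (r, j - 1)" by simp
  ultimately show ?thesis by (simp only: block_minor_def add_0_right)
qed

text \<open>The part of the prescribed order still to be produced when the rows before r are those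
  of the identity. Eliminating row r splits off its last run.\<close>

definition suffix_order :: "nat \<Rightarrow> nat \<Rightarrow> nat list" where
  "suffix_order n r = concat (map (\<lambda>p. [p..<n - 1]) (rev [r..<n - 1]))"

lemma factor_order_suffix: "factor_order n = suffix_order n 0"
  by (simp add: factor_order_def suffix_order_def)

lemma suffix_order_Suc: "r < n - 1 \<Longrightarrow> suffix_order n r = suffix_order n (Suc r) @ [r..<n - 1]"
  by (simp add: suffix_order_def upt_conv_Cons)

lemma suffix_order_letters: "\<forall>i\<in>set (suffix_order n r). Suc i < n"
  by (auto simp: suffix_order_def less_diff_conv)

text \<open>Each entry of row r from the diagonal on is a block minor of order one, so all pivots
  and multipliers are positive. By \<open>block_minor_column_elim\<close> the hypothesis on minors
  passes to the next row after elimination.\<close>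

lemma positive_factorization:
  assumes "r \<le> n - 1" "n > 0" "unit_upper n U" "identity_rows n r U"
    and "\<And>j k. r \<le> j \<Longrightarrow> j + k \<le> n \<Longrightarrow> 0 < block_minor U r j k"
  shows "\<exists>ts. length ts = length (suffix_order n r) \<and> (\<forall>t\<in>set ts. 0 < t)
    \<and> U = upper_product n (zip (suffix_order n r) ts)"
  using assms
proof (induction r arbitrary: U rule: inc_induct)
  case base
  have "U = 1\<^sub>m n"
  proof (rule eq_matI)
    fix x y assume "x < dim_row (1\<^sub>m n :: real mat)" "y < dim_col (1\<^sub>m n :: real mat)"
    then have xy: "x < n" "y < n" by simp_all
    show "U $$ (x, y) = 1\<^sub>m n $$ (x, y)"
    proof (cases "x < n - 1")
      case True
      then show ?thesis using base xy by (simp add: identity_rows_def)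
    next
      case False
      then have "y = x \<or> y < x" using xy by linarith
      then show ?thesis using unit_upperD[OF base(2)] xy by auto
    qed
  qed (use unit_upperD(1)[OF base(2)] in auto)
  moreover have "suffix_order n (n - 1) = []" by (simp add: suffix_order_def)
  ultimately show ?case by (intro exI[of _ "[]"]) simp
next
  case (step r)
  note U = step.prems(2) and id = step.prems(3) and pos = step.prems(4)
  have r: "r < n" using step by simp
  have entry: "0 < U $$ (r, y)" if "r \<le> y" "y < n" for y
    using pos[of y "Suc 0"] that by (simp add: block_minor_1)
  then have nz: "U $$ (r, y) \<noteq> 0" if "r \<le> y" "y < n" for y using that by fastforce
  let ?C = "column_elim n r U" and ?t = "\<lambda>i. U $$ (r, Suc i) / U $$ (r, i)"
  have "\<exists>ts. length ts = length (suffix_order n (Suc r)) \<and> (\<forall>t\<in>set ts. 0 < t)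
      \<and> ?C = upper_product n (zip (suffix_order n (Suc r)) ts)"
  proof (rule step.IH[OF step.prems(1) column_elim_unit_upper[OF U id r nz]])
    fix j k assume j: "Suc r \<le> j" "j + k \<le> n"
    have "0 < block_minor U r (j - 1) (Suc k)" using pos[of "j - 1" "Suc k"] j by simp
    also have "\<dots> = U $$ (r, j - 1) * block_minor ?C (Suc r) j k"
      by (rule block_minor_column_elim[OF U id r nz]) (use j in auto)
    finally have "0 < U $$ (r, j - 1) * block_minor ?C (Suc r) j k" .
    moreover have "0 < U $$ (r, j - 1)" using entry[of "j - 1"] j r by simp
    ultimately show "0 < block_minor ?C (Suc r) j k" by (rule zero_less_mult_pos)
  qed
  then obtain ts where ts: "length ts = length (suffix_order n (Suc r))" "\<forall>t\<in>set ts. 0 < t"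
    "?C = upper_product n (zip (suffix_order n (Suc r)) ts)" by blast
  let ?us = "ts @ map ?t [r..<n - 1]"
  have zip: "zip (suffix_order n r) ?us = zip (suffix_order n (Suc r)) ts @ map (\<lambda>i. (i, ?t i)) [r..<n - 1]"
    using ts(1) step.hyps by (simp add: suffix_order_Suc zip_map2 zip_same_conv_map)
  have "U = ?C * upper_product n (map (\<lambda>i. (i, ?t i)) [r..<n - 1])"
    by (rule column_elim_product[OF unit_upperD(1)[OF U] r])
  then have "U = upper_product n (zip (suffix_order n r) ?us)"
    unfolding zip upper_product_append using ts(3) by simp
  moreover have "\<forall>t\<in>set ?us. 0 < t" using ts(2) entry by auto
  moreover have "length ?us = length (suffix_order n r)" using ts(1) step.hyps by (simp add: suffix_order_Suc)
  ultimately show ?case by blast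
qed


section \<open>Limits of factorizations\<close>

lemma tendsto_mult_product:
  fixes M :: "nat \<Rightarrow> real mat" and w :: "nat \<Rightarrow> nat" and a :: "nat \<Rightarrow> nat \<Rightarrow> real"
  assumes "\<And>m. M m \<in> carrier_mat n n" "M' \<in> carrier_mat n n"
    and "\<And>x y. x < n \<Longrightarrow> y < n \<Longrightarrow> (\<lambda>m. M m $$ (x, y)) \<longlonglongrightarrow> M' $$ (x, y)"
    and "\<And>q. q \<in> set qs \<Longrightarrow> Suc (w q) < n" "\<And>q. q \<in> set qs \<Longrightarrow> (\<lambda>m. a m q) \<longlonglongrightarrow> b q"
    and "x < n" "y < n"
  shows "(\<lambda>m. (M m * upper_product n (map (\<lambda>q. (w q, a m q)) qs)) $$ (x, y))
    \<longlonglongrightarrow> (M' * upper_product n (map (\<lambda>q. (w q, b q)) qs)) $$ (x, y)"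
  using assms
proof (induction qs arbitrary: M M')
  case Nil
  have "M m * 1\<^sub>m n = M m" for m by (rule right_mult_one_mat[OF Nil(1)])
  moreover have "M' * 1\<^sub>m n = M'" by (rule right_mult_one_mat[OF Nil(2)])
  ultimately show ?case using Nil by simp
next
  case (Cons q qs)
  have q: "Suc (w q) < n" "(\<lambda>m. a m q) \<longlonglongrightarrow> b q" using Cons.prems(4,5) by auto
  have 1: "M m * elem_upper n (w q) (a m q) \<in> carrier_mat n n" for m
    by (rule mult_carrier_mat[OF Cons.prems(1) elem_upper_carrier])
  have 2: "M' * elem_upper n (w q) (b q) \<in> carrier_mat n n"
    by (rule mult_carrier_mat[OF Cons.prems(2) elem_upper_carrier])
  have 3: "(\<lambda>m. (M m * elem_upper n (w q) (a m q)) $$ (x, y)) \<longlonglongrightarrow> (M' * elem_upper n (w q) (b q)) $$ (x, y)"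
    if xy: "x < n" "y < n" for x y
    unfolding mult_elem_upper[OF Cons.prems(1) q(1) xy] mult_elem_upper[OF Cons.prems(2) q(1) xy]
    using Cons.prems(3)[OF xy] Cons.prems(3)[of x "w q"] q xy
    by (auto intro!: tendsto_add tendsto_mult)
  have "(\<lambda>m. (M m * elem_upper n (w q) (a m q) * upper_product n (map (\<lambda>q. (w q, a m q)) qs)) $$ (x, y))
    \<longlonglongrightarrow> (M' * elem_upper n (w q) (b q) * upper_product n (map (\<lambda>q. (w q, b q)) qs)) $$ (x, y)"
    by (rule Cons.IH[OF 1 2 3]) (use Cons.prems in auto)
  then show ?case
    by (simp only: list.map upper_product_Cons
        assoc_mult_mat[OF Cons.prems(1) elem_upper_carrier upper_product_carrier]
        assoc_mult_mat[OF Cons.prems(2) elem_upper_carrier upper_product_carrier])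
qed

lemma elem_upper_0 [simp]: "elem_upper n i 0 = 1\<^sub>m n"
  by (rule eq_matI) (auto simp: elem_upper_def)

lemma upper_product_drop_zeros:
  "upper_product n (filter (\<lambda>(i, a). a \<noteq> 0) fs) = upper_product n fs"
proof (induction fs)
  case (Cons f fs)
  obtain i a where f: "f = (i, a)" by (cases f)
  show ?case using Cons by (cases "a = 0") (simp_all add: f left_mult_one_mat[OF upper_product_carrier])
qed simp

lemma superdiagonal_snoc:
  assumes fs: "\<forall>(i, a)\<in>set fs. Suc i < n" and ij: "Suc i < n" "Suc j < n"
  shows "upper_product n (fs @ [(j, b)]) $$ (i, Suc i) = upper_product n fs $$ (i, Suc i) + (if i = j then b else 0)"
proof -
  have u: "unit_upper n (upper_product n fs)" by (rule unit_upper_product[OF fs])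
  have "upper_product n (fs @ [(j, b)]) = upper_product n fs * elem_upper n j b"
    by (simp add: upper_product_append right_mult_one_mat[OF elem_upper_carrier])
  then have "upper_product n (fs @ [(j, b)]) $$ (i, Suc i)
      = upper_product n fs $$ (i, Suc i) + (if Suc i = Suc j then b * upper_product n fs $$ (i, j) else 0)"
    using mult_elem_upper[OF upper_product_carrier ij(2) _ ij(1), of i fs b] ij by simp
  then show ?thesis using unit_upperD(3)[OF u, of j] ij by (cases "i = j") simp_all
qed

text \<open>In a product of unit upper triangular matrices the superdiagonals add, so the entry at
  (i, i + 1) is the sum of the nonnegative parameters of index i.\<close>

lemma superdiagonal_ge:
  assumes "\<forall>(i, a)\<in>set fs. Suc i < n \<and> 0 \<le> a" "Suc i < n"
  shows "0 \<le> upper_product n fs $$ (i, Suc i)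
    \<and> (\<forall>a. (i, a) \<in> set fs \<longrightarrow> a \<le> upper_product n fs $$ (i, Suc i))"
  using assms
proof (induction fs rule: rev_induct)
  case (snoc f fs)
  obtain j b where f: "f = (j, b)" by (cases f)
  have j: "Suc j < n" "0 \<le> b" and v: "\<forall>(i, a)\<in>set fs. Suc i < n \<and> 0 \<le> a" using snoc.prems f by auto
  have v': "\<forall>(i, a)\<in>set fs. Suc i < n" using v by auto
  show ?case
    unfolding f superdiagonal_snoc[OF v' snoc.prems(2) j(1)]
    using snoc.IH[OF v snoc.prems(2)] j(2) by (auto simp: add_increasing2)
qed simp

text \<open>Bolzano-Weierstrass for finitely many coordinates, refining the subsequence one
  coordinate at a time.\<close>

lemma bounded_convergent_subsequence:
  fixes f :: "nat \<Rightarrow> nat \<Rightarrow> real"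
  assumes "\<And>q. q < N \<Longrightarrow> Bseq (\<lambda>m. f m q)"
  shows "\<exists>s l. strict_mono s \<and> (\<forall>q<N. (\<lambda>m. f (s m) q) \<longlonglongrightarrow> l q)"
  using assms
proof (induction N)
  case 0
  show ?case by (intro exI[of _ id]) (simp add: strict_mono_def)
next
  case (Suc N)
  then obtain s l where s: "strict_mono (s :: nat \<Rightarrow> nat)" "\<And>q. q < N \<Longrightarrow> (\<lambda>m. f (s m) q) \<longlonglongrightarrow> l q" by auto
  obtain r where r: "strict_mono (r :: nat \<Rightarrow> nat)" "monoseq (\<lambda>m. f (s (r m)) N)"
    using seq_monosub[of "\<lambda>m. f (s m) N"] by auto
  have "Bseq (\<lambda>m. f m N)" using Suc.prems by simp
  then have "Bseq (\<lambda>m. f (s (r m)) N)" by (auto simp: Bseq_def)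
  then have "convergent (\<lambda>m. f (s (r m)) N)" using r(2) by (rule Bseq_monoseq_convergent)
  then obtain c where c: "(\<lambda>m. f (s (r m)) N) \<longlonglongrightarrow> c" by (auto simp: convergent_def)
  have "(\<lambda>m. f ((s \<circ> r) m) q) \<longlonglongrightarrow> (l(N := c)) q" if "q < Suc N" for q
  proof (cases "q = N")
    case True
    then show ?thesis using c by simp
  next
    case False
    then have "(\<lambda>m. f (s m) q) \<longlonglongrightarrow> l q" using s(2) that by simp
    from LIMSEQ_subseq_LIMSEQ[OF this r(1)] show ?thesis using False by (simp add: o_def)
  qed
  moreover have "strict_mono (s \<circ> r)" using s(1) r(1) by (rule strict_mono_o)
  ultimately show ?case by blast
qed

lemma map_index_zip:
  "length ts = length ws \<Longrightarrow> map (\<lambda>q. (ws ! q, ts ! q)) [0..<length ws] = zip ws ts"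
  by (rule nth_equalityI) auto

lemma minor_principal_unit_upper:
  assumes U: "unit_upper n U" and k: "k \<le> n"
  shows "minor U {..<k} {..<k} = 1"
proof -
  let ?X = "mat k k (\<lambda>(a, b). U $$ (a, b))"
  have "minor U {..<k} {..<k} = det ?X"
    by (rule minor_eq'[OF unit_upperD(1)[OF U]]) (use k in auto)
  also have "\<dots> = prod_list (diag_mat ?X)"
    by (rule det_upper_triangular[of _ k]) (use unit_upperD(2)[OF U] k in \<open>auto simp: upper_triangular_def\<close>)
  also have "\<dots> = 1" using unit_upperD(3)[OF U] k by (auto simp: prod_list_diag_prod intro!: prod.neutral)
  finally show ?thesis .
qed

lemma minor_block:
  assumes U: "U \<in> carrier_mat n n" and j: "j + k \<le> n"
  shows "minor U {..<k} {j..<j + k} = block_minor U 0 j k"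
proof -
  have "minor U {..<k} {j..<j + k} = det (mat k k (\<lambda>(a, b). U $$ (a, j + b)))"
    by (rule minor_eq'[OF U]) (use j in \<open>auto simp: image_add_atLeastLessThan' lessThan_atLeast0\<close>)
  then show ?thesis by (simp add: block_minor_def)
qed

text \<open>Multiplying by a product of small elementary factors makes all block minors positive; the
  parameters of the resulting factorizations are bounded by superdiagonal entries, so they have a
  limit point.\<close>

lemma nonnegative_factorization:
  assumes n: "n > 0" and U: "unit_upper n U"
    and nonneg: "\<And>k J. k \<le> n \<Longrightarrow> J \<subseteq> {..<n} \<Longrightarrow> card J = k \<Longrightarrow> 0 \<le> minor U {..<k} J"
  shows "\<exists>fs. valid n fs \<and> U = upper_product n fs"
proof -
  \<comment> \<open>By \<open>acts_wpow_n\<close>, n copies of the full word take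
    \<open>{..<k}\<close> to the top, so every column set of size k is reachable from
    \<open>{..<k}\<close>, where the minor of U is 1.\<close>
  define ws where "ws = wpow n [0..<n - 1]"
  define fo where "fo = suffix_order n 0"
  define e where "e m = 1 / real (Suc m)" for m
  define V where "V m = U * upper_product n (map (\<lambda>i. (i, e m)) ws)" for m
  have letters: "\<forall>i\<in>set ws. Suc i < n" unfolding ws_def using set_wpow[of n "[0..<n - 1]"] by fastforce
  have e: "0 < e m" for m by (simp add: e_def)
  have UC: "U \<in> carrier_mat n n" by (rule unit_upperD(1)[OF U])
  have VU: "unit_upper n (V m)" for m
    unfolding V_def by (rule unit_upper_mult_product[OF U]) (use letters in auto)
  have "\<exists>ts. length ts = length fo \<and> (\<forall>t\<in>set ts. 0 < t) \<and> V m = upper_product n (zip fo ts)" for m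
    unfolding fo_def
  proof (rule positive_factorization[OF _ n VU])
    show "identity_rows n 0 (V m)" by (simp add: identity_rows_def)
    fix j k :: nat assume j: "j + k \<le> n"
    have L: "{..<k} \<subseteq> {..<n}" "card {..<k} = k" using j by auto
    let ?S = "{J. 0 < minor U {..<k} J}"
    have "pattern n k {..<k} U ?S" using nonneg[of k] j by (auto simp: pattern_def)
    then have pat: "pattern n k {..<k} (V m) (reach (map fst (map (\<lambda>i. (i, e m)) ws)) `` ?S)"
      unfolding V_def
      by (intro pattern_upper_product[OF UC L]) (use letters e in \<open>auto simp: valid_def\<close>)
    have J: "{j..<j + k} \<subseteq> {..<n}" "card {j..<j + k} = k" using j by auto
    have top: "acts ws {..<k} = {n - k..<n}" unfolding ws_def
      by (rule acts_wpow_n) (use j in \<open>auto simp: lessThan_atLeast0\<close>)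
    have "({..<k}, {j..<j + k}) \<in> reach ws" unfolding reach_lower top by (rule gale_le_top[OF J])
    moreover have "{..<k} \<in> ?S" using minor_principal_unit_upper[OF U, of k] j by simp
    ultimately have "{j..<j + k} \<in> reach ws `` ?S" by blast
    then have "0 < minor (V m) {..<k} {j..<j + k}"
      using pat J unfolding pattern_def by (simp add: o_def)
    then show "0 < block_minor (V m) 0 j k" using minor_block[OF unit_upperD(1)[OF VU] j] by simp
  qed simp
  then obtain ts where ts: "\<And>m. length (ts m) = length fo" "\<And>m t. t \<in> set (ts m) \<Longrightarrow> 0 < t"
    "\<And>m. V m = upper_product n (zip fo (ts m))" by metis
  have e0: "e \<longlonglongrightarrow> 0"
    unfolding e_def using LIMSEQ_inverse_real_of_nat by (simp add: inverse_eq_divide)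
  have Vlim: "(\<lambda>m. V m $$ (x, y)) \<longlonglongrightarrow> U $$ (x, y)" if xy: "x < n" "y < n" for x y
  proof -
    have "(\<lambda>m. (U * upper_product n (map (\<lambda>q. (q, e m)) ws)) $$ (x, y))
      \<longlonglongrightarrow> (U * upper_product n (map (\<lambda>q. (q, 0)) ws)) $$ (x, y)"
      by (rule tendsto_mult_product[where w = "\<lambda>q. q" and a = "\<lambda>m q. e m" and b = "\<lambda>q. 0"])
        (use letters e0 UC xy in auto)
    moreover have "upper_product n (map (\<lambda>q. (q, 0)) ws) = 1\<^sub>m n"
      using upper_product_drop_zeros[of n "map (\<lambda>q. (q, 0)) ws"] by (simp add: filter_map o_def)
    ultimately show ?thesis unfolding V_def by (simp add: right_mult_one_mat[OF UC])
  qed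
  have fol: "Suc (fo ! q) < n" if "q < length fo" for q
    using that suffix_order_letters[of n 0] nth_mem unfolding fo_def by blast
  have bdd: "Bseq (\<lambda>m. ts m ! q)" if q: "q < length fo" for q
  proof -
    have "convergent (\<lambda>m. V m $$ (fo ! q, Suc (fo ! q)))"
      using Vlim[of "fo ! q" "Suc (fo ! q)"] fol[OF q] by (auto simp: convergent_def)
    then have B: "Bseq (\<lambda>m. V m $$ (fo ! q, Suc (fo ! q)))" by (rule convergent_imp_Bseq)
    have dom: "norm (ts m ! q) \<le> norm (V m $$ (fo ! q, Suc (fo ! q)))" for m
    proof -
      have "Suc i < n \<and> 0 \<le> a" if "(i, a) \<in> set (zip fo (ts m))" for i a
        using suffix_order_letters[of n 0] ts(2)[of a m] set_zip_leftD[OF that] set_zip_rightD[OF that]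
        unfolding fo_def by simp
      then have v: "\<forall>(i, a)\<in>set (zip fo (ts m)). Suc i < n \<and> 0 \<le> a" by blast
      have "(fo ! q, ts m ! q) \<in> set (zip fo (ts m))" using q ts(1) by (auto simp: set_zip)
      then have "ts m ! q \<le> V m $$ (fo ! q, Suc (fo ! q))"
        using superdiagonal_ge[OF v fol[OF q]] ts(3) by simp
      moreover have "0 < ts m ! q" using ts(2)[of "ts m ! q" m] ts(1)[of m] q by simp
      ultimately show ?thesis by simp
    qed
    then have "eventually (\<lambda>m. norm (ts m ! q) \<le> norm (V m $$ (fo ! q, Suc (fo ! q)))) sequentially" by simp
    from Bseq_eventually_mono[OF this B] show ?thesis .
  qed
  obtain s l where s: "strict_mono s" "\<And>q. q < length fo \<Longrightarrow> (\<lambda>m. ts (s m) ! q) \<longlonglongrightarrow> l q"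
    using bounded_convergent_subsequence[of "length fo" "\<lambda>m q. ts m ! q"] bdd by auto
  define gs where "gs = map (\<lambda>q. (fo ! q, l q)) [0..<length fo]"
  have "U = upper_product n gs"
  proof (rule eq_matI)
    fix x y assume "x < dim_row (upper_product n gs)" "y < dim_col (upper_product n gs)"
    then have xy: "x < n" "y < n" by simp_all
    have "(\<lambda>m. (1\<^sub>m n * upper_product n (map (\<lambda>q. (fo ! q, ts (s m) ! q)) [0..<length fo])) $$ (x, y))
      \<longlonglongrightarrow> (1\<^sub>m n * upper_product n (map (\<lambda>q. (fo ! q, l q)) [0..<length fo])) $$ (x, y)"
      by (rule tendsto_mult_product[where w = "\<lambda>q. fo ! q" and a = "\<lambda>m q. ts (s m) ! q" and b = l])
        (use s(2) fol xy in auto)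
    moreover have "1\<^sub>m n * upper_product n (map (\<lambda>q. (fo ! q, ts (s m) ! q)) [0..<length fo]) = V (s m)" for m
      using map_index_zip[OF ts(1)[of "s m"]] ts(3)[of "s m"] by (simp add: left_mult_one_mat[OF upper_product_carrier])
    ultimately have "(\<lambda>m. V (s m) $$ (x, y)) \<longlonglongrightarrow> upper_product n gs $$ (x, y)"
      by (simp add: gs_def left_mult_one_mat[OF upper_product_carrier])
    moreover have "(\<lambda>m. V (s m) $$ (x, y)) \<longlonglongrightarrow> U $$ (x, y)"
      using LIMSEQ_subseq_LIMSEQ[OF Vlim[OF xy] s(1)] by (simp add: o_def)
    ultimately show "U $$ (x, y) = upper_product n gs $$ (x, y)" by (metis LIMSEQ_unique)
  qed (use UC in auto)
  \<comment> \<open>Limits of positive parameters may be zero. Such factors are identities and are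
    deleted, which leaves positive parameters only.\<close>
  then have "U = upper_product n (filter (\<lambda>(i, a). a \<noteq> 0) gs)" by (simp add: upper_product_drop_zeros)
  moreover have "valid n (filter (\<lambda>(i, a). a \<noteq> 0) gs)"
  proof -
    have "0 \<le> l q" if "q < length fo" for q
    proof (rule LIMSEQ_le_const[OF s(2)[OF that]])
      show "\<exists>N. \<forall>m\<ge>N. 0 \<le> ts (s m) ! q" using ts(1,2) that by (metis less_imp_le nth_mem)
    qed
    then have "0 < l q" if "q < length fo" "l q \<noteq> 0" for q using that by (metis order_le_neq_trans)
    then show ?thesis using fol by (auto simp: valid_def gs_def)
  qed
  ultimately show ?thesis by blast
qed

section \<open>Gram matrices: leading minors and uniqueness\<close>

lemma gram_index:
  assumes V: "V \<in> carrier_mat n n" and W: "W \<in> carrier_mat n n" and xy: "x < n" "y < n"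
  shows "(V\<^sup>T * mat_diag n d * W) $$ (x, y) = (\<Sum>l<n. V $$ (l, x) * d l * W $$ (l, y))"
proof -
  have "V\<^sup>T * mat_diag n d = mat n n (\<lambda>(i, j). V\<^sup>T $$ (i, j) * d j)"
    by (rule mat_diag_mult_right) (use V in simp)
  then show ?thesis using V W xy by (simp add: scalar_prod_def lessThan_atLeast0)
qed

text \<open>Since the transpose of U is lower triangular, the first k rows of the Gram matrix
  involve only the first k rows of U. They are obtained from these by a lower triangular factor
  whose determinant is the product of the first k entries of d.\<close>

lemma leading_minor_gram:
  assumes U: "unit_upper n U" and d: "\<forall>i<n. 0 < d i" and J: "J \<subseteq> {..<n}" "card J = k" and k: "k \<le> n"
  shows "\<exists>c>0. minor (gram n d U) {..<k} J = c * minor U {..<k} J"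
proof -
  note UD = unit_upperD[OF U]
  have fJ: "finite J" using J(1) by (rule finite_subset) simp
  have pJ: "pick J b < n" if "b < k" for b using pick_in_set_le[of b J] that J by auto
  have eq: "minor M {..<k} J = det (mat k k (\<lambda>(a, b). M $$ (a, pick J b)))" if "M \<in> carrier_mat n n" for M
    by (rule minor_eq'[OF that _ _ _ J(1) _ pick_image[OF fJ J(2)]]) (use k J(2) pick_mono_le in auto)
  let ?T = "mat k k (\<lambda>(a, l). U $$ (l, a) * d l)" and ?X = "mat k k (\<lambda>(a, b). U $$ (a, pick J b))"
  have "mat k k (\<lambda>(a, b). gram n d U $$ (a, pick J b)) = ?T * ?X"
  proof (rule eq_matI)
    fix a b assume "a < dim_row (?T * ?X)" "b < dim_col (?T * ?X)"
    then have ab: "a < k" "b < k" by simp_all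
    have "gram n d U $$ (a, pick J b) = (\<Sum>l<n. U $$ (l, a) * d l * U $$ (l, pick J b))"
      unfolding gram_def by (rule gram_index[OF UD(1) UD(1)]) (use ab k pJ in auto)
    also have "\<dots> = (\<Sum>l<k. U $$ (l, a) * d l * U $$ (l, pick J b))"
      by (rule sum.mono_neutral_right) (use k ab UD(2) in auto)
    finally show "mat k k (\<lambda>(a, b). gram n d U $$ (a, pick J b)) $$ (a, b) = (?T * ?X) $$ (a, b)"
      using ab by (simp add: scalar_prod_def lessThan_atLeast0)
  qed simp_all
  then have "minor (gram n d U) {..<k} J = det ?T * minor U {..<k} J"
    using eq[OF gram_carrier[OF UD(1)]] eq[OF UD(1)] det_mult[of ?T k ?X] by simp
  moreover have "0 < det ?T"
  proof -
    have "det ?T = prod_list (diag_mat ?T)"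
      by (rule det_lower_triangular[of k]) (use UD(2) k in auto)
    also have "\<dots> = (\<Prod>l<k. d l)"
      using UD(3) k by (simp add: prod_list_diag_prod lessThan_atLeast0)
    also have "0 < \<dots>" using d k by (intro prod_pos) auto
    finally show ?thesis .
  qed
  ultimately show ?thesis by blast
qed

text \<open>Rows are compared by induction: those before r contribute equal sums and those after r
  vanish by triangularity, so row r is determined up to a factor, which the unit diagonals fix. V
  and W may differ, since a basic factorization may have different parameters on its two
  sides.\<close>

lemma gram_factorization_unique:
  assumes U: "unit_upper n U" and V: "unit_upper n V" and W: "unit_upper n W"
    and d: "\<forall>i<n. 0 < d i" and e: "\<forall>i<n. 0 < e i"
    and eq: "gram n d U = V\<^sup>T * mat_diag n e * W"
  shows "W = U"
proof -
  note UD = unit_upperD[OF U] and VD = unit_upperD[OF V] and WD = unit_upperD[OF W]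
  have row: "\<forall>y<n. U $$ (r, y) = V $$ (r, y) \<and> U $$ (r, y) = W $$ (r, y) \<and> d r = e r" if "r < n" for r
    using that
  proof (induction r rule: less_induct)
    case (less r)
    have E: "(\<Sum>l<n. U $$ (l, x) * d l * U $$ (l, y)) = (\<Sum>l<n. V $$ (l, x) * e l * W $$ (l, y))"
      if "x < n" "y < n" for x y
      using gram_index[OF UD(1) UD(1) that, of d] gram_index[OF VD(1) WD(1) that, of e] eq by (simp add: gram_def)
    have split: "(\<Sum>l<n. f l) = (\<Sum>l<r. f l) + f r" if "\<And>l. r < l \<Longrightarrow> l < n \<Longrightarrow> f l = 0" for f :: "nat \<Rightarrow> real"
    proof -
      have "(\<Sum>l<n. f l) = (\<Sum>l<Suc r. f l)"
        by (rule sum.mono_neutral_right) (use that less.prems in auto)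
      then show ?thesis by simp
    qed
    have prev: "(\<Sum>l<r. U $$ (l, x) * d l * U $$ (l, y)) = (\<Sum>l<r. V $$ (l, x) * e l * W $$ (l, y))"
      if "x < n" "y < n" for x y
    proof (rule sum.cong[OF refl])
      fix l assume "l \<in> {..<r}"
      then have "\<forall>y<n. U $$ (l, y) = V $$ (l, y) \<and> U $$ (l, y) = W $$ (l, y) \<and> d l = e l"
        using less.prems by (intro less.IH) simp_all
      then show "U $$ (l, x) * d l * U $$ (l, y) = V $$ (l, x) * e l * W $$ (l, y)" using that by metis
    qed
    have 1: "d r * U $$ (r, y) = e r * W $$ (r, y)" if y: "y < n" for y
      using E[OF less.prems y] prev[OF less.prems y] split[of "\<lambda>l. U $$ (l, r) * d l * U $$ (l, y)"]
        split[of "\<lambda>l. V $$ (l, r) * e l * W $$ (l, y)"] UD(2,3) VD(2,3) less.prems by simp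
    have 2: "U $$ (r, y) * d r = V $$ (r, y) * e r" if y: "y < n" for y
      using E[OF y less.prems] prev[OF y less.prems] split[of "\<lambda>l. U $$ (l, y) * d l * U $$ (l, r)"]
        split[of "\<lambda>l. V $$ (l, y) * e l * W $$ (l, r)"] UD(2,3) WD(2,3) less.prems by simp
    have de: "d r = e r" using 1[OF less.prems] UD(3) WD(3) less.prems by simp
    have "d r \<noteq> 0" using d less.prems by fastforce
    then show ?case using 1 2 de by (metis mult.commute mult_cancel_left)
  qed
  show ?thesis
  proof (rule eq_matI)
    fix x y assume "x < dim_row U" "y < dim_col U"
    then show "W $$ (x, y) = U $$ (x, y)" using row UD(1) by (metis carrier_matD)
  qed (use UD(1) WD(1) in auto)
qed

section \<open>Coxeter words and basic oscillatory matrices\<close>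

lemma elem_upper_commute_product:
  assumes "Suc r < n" "\<forall>(j, b)\<in>set fs. Suc j < n \<and> j \<noteq> Suc r \<and> r \<noteq> Suc j"
  shows "elem_upper n r c * upper_product n fs = upper_product n fs * elem_upper n r c"
  using assms(2)
proof (induction fs)
  case Nil
  show ?case by (simp add: left_mult_one_mat[OF elem_upper_carrier] right_mult_one_mat[OF elem_upper_carrier])
next
  case (Cons f fs)
  obtain j b where f: "f = (j, b)" by (cases f)
  have j: "Suc j < n" "j \<noteq> Suc r" "r \<noteq> Suc j" using Cons.prems f by auto
  note C = elem_upper_carrier and P = upper_product_carrier
  have "elem_upper n r c * (elem_upper n j b * upper_product n fs)
      = (elem_upper n r c * elem_upper n j b) * upper_product n fs"
    by (rule assoc_mult_mat[OF C C P, symmetric])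
  also have "\<dots> = (elem_upper n j b * elem_upper n r c) * upper_product n fs"
    using elem_upper_commute[OF assms(1) j(1) j(3) j(2)] by simp
  also have "\<dots> = elem_upper n j b * (elem_upper n r c * upper_product n fs)"
    by (rule assoc_mult_mat[OF C C P])
  also have "\<dots> = elem_upper n j b * (upper_product n fs * elem_upper n r c)" using Cons by simp
  also have "\<dots> = (elem_upper n j b * upper_product n fs) * elem_upper n r c"
    by (rule assoc_mult_mat[OF C P C, symmetric])
  finally show ?case by (simp add: f)
qed

text \<open>In a word containing each letter once, the letter \<open>r\<close> commutes with all smaller letters except
  \<open>r - 1\<close>, so it can be moved to the front (then \<open>r \<in> S\<close>) or to the end of the word below it.\<close>

definition coxeter_list :: "nat set \<Rightarrow> nat \<Rightarrow> nat list" where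
  "coxeter_list S r = rev (filter (\<lambda>i. i \<in> S) [0..<r]) @ filter (\<lambda>i. i \<notin> S) [0..<r]"

lemma set_coxeter_list: "set (coxeter_list S r) = {..<r}"
  by (auto simp: coxeter_list_def)

lemma distinct_coxeter_list: "distinct (coxeter_list S r)"
  by (auto simp: coxeter_list_def)

lemma coxeter_list_cong: "(\<And>i. i < r \<Longrightarrow> i \<in> S \<longleftrightarrow> i \<in> S') \<Longrightarrow> coxeter_list S r = coxeter_list S' r"
  unfolding coxeter_list_def by (intro arg_cong2[of _ _ _ _ append] arg_cong[of _ _ rev] filter_cong) auto

lemma coxeter_list_Suc:
  "r \<in> S \<Longrightarrow> coxeter_list S (Suc r) = r # coxeter_list S r"
  "r \<notin> S \<Longrightarrow> coxeter_list S (Suc r) = coxeter_list S r @ [r]"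
  by (simp_all add: coxeter_list_def)

lemma coxeter_normal_form:
  assumes "r \<le> n - 1" "distinct (map fst fs)" "set (map fst fs) = {..<r}" "valid n fs"
  shows "\<exists>S a. 0 \<notin> S \<and> (\<forall>i<r. 0 < a i)
    \<and> upper_product n fs = upper_product n (map (\<lambda>i. (i, a i)) (coxeter_list S r))"
  using assms
proof (induction r arbitrary: fs)
  case 0
  then have "fs = []" by simp
  then show ?case by (intro exI[of _ "{}"]) (simp add: coxeter_list_def)
next
  case (Suc r)
  have r: "Suc r < n" using Suc.prems(1) by linarith
  have "r \<in> set (map fst fs)" unfolding Suc.prems(3) by simp
  then obtain c where "(r, c) \<in> set fs" by auto
  then obtain xs ys where fs: "fs = xs @ (r, c) # ys" by (meson split_list)
  have c: "0 < c" and v: "valid n xs" "valid n ys" using Suc.prems(4) fs by simp_all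
  have d: "distinct (map fst (xs @ ys))" "r \<notin> set (map fst (xs @ ys))" using Suc.prems(2) fs by auto
  have "set (map fst (xs @ ys)) = set (map fst fs) - {r}" using d(2) fs by auto
  then have s: "set (map fst (xs @ ys)) = {..<r}" unfolding Suc.prems(3) by auto
  then have small: "j < r" if "(j, b) \<in> set (xs @ ys)" for j b using that by (force simp: image_iff)
  obtain S a where S: "0 \<notin> S" "\<forall>i<r. 0 < a i"
    "upper_product n (xs @ ys) = upper_product n (map (\<lambda>i. (i, a i)) (coxeter_list S r))"
    using Suc.IH[OF _ d(1) s] Suc.prems(1) v by auto
  have upd: "map (\<lambda>i. (i, (a(r := c)) i)) (coxeter_list T r) = map (\<lambda>i. (i, a i)) (coxeter_list T r)" for T
    using set_coxeter_list[of T r] by (intro map_cong) auto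
  have pos: "\<forall>i<Suc r. 0 < (a(r := c)) i" using S(2) c by (auto simp: less_Suc_eq)
  let ?X = "upper_product n xs" and ?Y = "upper_product n ys" and ?E = "elem_upper n r c"
  note C = elem_upper_carrier and P = upper_product_carrier
  have fsX: "upper_product n fs = ?X * (?E * ?Y)" using fs by (simp add: upper_product_append)
  show ?case
  \<comment> \<open>Among the letters up to r, only r - 1 fails to commute with r, and it occurs
    once. So r commutes with all of \<open>xs\<close> if r - 1 lies in \<open>ys\<close>, and with
    all of \<open>ys\<close> otherwise. The letter 0 is sent to the end, which keeps 0 out of
    S.\<close>
  proof (cases "r \<noteq> 0 \<and> r - 1 \<in> set (map fst ys)")
    case True
    have "\<forall>(j, b)\<in>set xs. Suc j < n \<and> j \<noteq> Suc r \<and> r \<noteq> Suc j"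
    proof clarify
      fix j b assume jb: "(j, b) \<in> set xs"
      have "Suc j < n" using v(1) jb by (auto simp: valid_def)
      moreover have "j \<noteq> Suc r" using small[of j b] jb by auto
      moreover have "r \<noteq> Suc j"
      proof
        assume "r = Suc j"
        then have "j \<in> set (map fst ys)" using True by simp
        moreover have "j \<in> set (map fst xs)" using jb by force
        ultimately show False using d(1) by auto
      qed
      ultimately show "Suc j < n \<and> j \<noteq> Suc r \<and> r \<noteq> Suc j" by blast
    qed
    from elem_upper_commute_product[OF r this, of c] have com: "?X * ?E = ?E * ?X" by simp
    have "upper_product n fs = (?X * ?E) * ?Y" unfolding fsX by (rule assoc_mult_mat[OF P C P, symmetric])
    also have "\<dots> = ?E * (?X * ?Y)" unfolding com by (rule assoc_mult_mat[OF C P P])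
    also have "\<dots> = ?E * upper_product n (map (\<lambda>i. (i, a i)) (coxeter_list S r))"
      using S(3) by (simp add: upper_product_append)
    finally have eq: "upper_product n fs = upper_product n ((r, c) # map (\<lambda>i. (i, a i)) (coxeter_list S r))" by simp
    let ?S = "insert r S"
    have "coxeter_list ?S (Suc r) = r # coxeter_list S r"
      using coxeter_list_Suc(1)[of r ?S] coxeter_list_cong[of r ?S S] by simp
    then have "map (\<lambda>i. (i, (a(r := c)) i)) (coxeter_list ?S (Suc r)) = (r, c) # map (\<lambda>i. (i, a i)) (coxeter_list S r)"
      using upd[of S] by simp
    then show ?thesis using eq pos S(1) True by (intro exI[of _ ?S] exI[of _ "a(r := c)"]) simp
  next
    case False
    have "\<forall>(j, b)\<in>set ys. Suc j < n \<and> j \<noteq> Suc r \<and> r \<noteq> Suc j"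
    proof clarify
      fix j b assume jb: "(j, b) \<in> set ys"
      have "Suc j < n" using v(2) jb by (auto simp: valid_def)
      moreover have "j \<noteq> Suc r" using small[of j b] jb by auto
      moreover have "r \<noteq> Suc j" using False jb by force
      ultimately show "Suc j < n \<and> j \<noteq> Suc r \<and> r \<noteq> Suc j" by blast
    qed
    from elem_upper_commute_product[OF r this, of c] have com: "?E * ?Y = ?Y * ?E" .
    have "upper_product n fs = (?X * ?Y) * ?E" unfolding fsX com by (rule assoc_mult_mat[OF P P C, symmetric])
    also have "\<dots> = upper_product n (map (\<lambda>i. (i, a i)) (coxeter_list S r)) * ?E"
      using S(3) by (simp add: upper_product_append)
    finally have eq: "upper_product n fs = upper_product n (map (\<lambda>i. (i, a i)) (coxeter_list S r) @ [(r, c)])"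
      by (simp add: upper_product_append right_mult_one_mat[OF C])
    let ?S = "S - {r}"
    have "coxeter_list ?S (Suc r) = coxeter_list S r @ [r]"
      using coxeter_list_Suc(2)[of r ?S] coxeter_list_cong[of r ?S S] by simp
    then have "map (\<lambda>i. (i, (a(r := c)) i)) (coxeter_list ?S (Suc r)) = map (\<lambda>i. (i, a i)) (coxeter_list S r) @ [(r, c)]"
      using upd[of S] by simp
    then show ?thesis using eq pos S(1) by (intro exI[of _ ?S] exI[of _ "a(r := c)"]) simp
  qed
qed

section \<open>Basic parameter lists\<close>

lemma ex1_index_iff_filter:
  "(\<exists>!j. j < length xs \<and> P (xs ! j)) \<longleftrightarrow> length (filter P xs) = 1"
proof -
  have "(\<exists>!j. j < length xs \<and> P (xs ! j)) \<longleftrightarrow> (\<exists>j. {j. j < length xs \<and> P (xs ! j)} = {j})"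
    unfolding Ex1_def set_eq_iff mem_Collect_eq singleton_iff by blast
  then show ?thesis by (simp add: length_filter_conv_card card_1_singleton_iff)
qed

lemma basic_parameters_iff:
  "basic_parameters n as \<longleftrightarrow> length as = length (factor_order n) \<and> (\<forall>a\<in>set as. 0 \<le> a)
     \<and> (\<forall>i<n - 1. length (filter (\<lambda>(q, b). q = i \<and> 0 < b) (zip (factor_order n) as)) = 1)"
proof (cases "length as = length (factor_order n)")
  case True
  have "(\<exists>!j. j < length as \<and> factor_order n ! j = i \<and> 0 < as ! j)
      \<longleftrightarrow> length (filter (\<lambda>(q, b). q = i \<and> 0 < b) (zip (factor_order n) as)) = 1" for i
    unfolding ex1_index_iff_filter[symmetric] using True by (simp cong: conj_cong)
  then show ?thesis by (simp add: basic_parameters_def)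
qed (simp add: basic_parameters_def)

lemma zip_concat_map:
  "zip (concat (map (\<lambda>p. [p..<m]) ps)) (concat (map (\<lambda>p. map (g p) [p..<m]) ps))
    = concat (map (\<lambda>p. map (\<lambda>i. (i, g p i)) [p..<m]) ps)"
  by (induction ps) (simp_all add: zip_map2 zip_same_conv_map)

lemma filter_single: "distinct xs \<Longrightarrow> filter (\<lambda>i. i = x) xs = (if x \<in> set xs then [x] else [])"
  by (induction xs) auto

lemma length_concat_upt:
  "length (concat (map (\<lambda>p. map (g p) [p..<m]) ps)) = length (concat (map (\<lambda>p. [p..<m]) ps))"
  by (induction ps) simp_all

lemma coxeter_basic:
  assumes n: "2 \<le> n" and S: "0 \<notin> S" and a: "\<forall>i<n - 1. 0 < a i"
  shows "\<exists>as. basic_parameters n as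
    \<and> upper_product n (map (\<lambda>i. (i, a i)) (coxeter_list S (n - 1))) = upper_product n (zip (factor_order n) as)"
proof -
  \<comment> \<open>A letter in S takes its parameter at the head of the run starting with it, the
    other letters in the final run, which starts with 0. The runs come with decreasing starting
    points, so the positive factors spell S downwards and then its complement upwards, as in
    \<open>coxeter_list\<close>.\<close>
  define g where "g p i = (if (p = i \<and> i \<in> S) \<or> (p = 0 \<and> i \<notin> S) then a i else 0)" for p i
  define as where "as = concat (map (\<lambda>p. map (g p) [p..<n - 1]) (rev [0..<n - 1]))"
  let ?z = "zip (factor_order n) as" and ?b = "\<lambda>p. map (\<lambda>i. (i, g p i)) [p..<n - 1]"
  have z: "?z = concat (map ?b (rev [0..<n - 1]))" unfolding factor_order_def as_def by (rule zip_concat_map)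
  have an: "a i \<noteq> 0" if "i < n - 1" for i using a that by fastforce
  have block: "filter (\<lambda>(i, b). b \<noteq> 0) (?b p) = (if p \<in> S then [(p, a p)] else [])" if p: "0 < p" "p < n - 1" for p
  proof -
    have "filter (\<lambda>(i, b). b \<noteq> 0) (?b p) = map (\<lambda>i. (i, g p i)) (filter (\<lambda>i. g p i \<noteq> 0) [p..<n - 1])"
      by (simp add: filter_map o_def)
    also have "filter (\<lambda>i. g p i \<noteq> 0) [p..<n - 1] = filter (\<lambda>i. i = p) (filter (\<lambda>i. p \<in> S) [p..<n - 1])"
      unfolding filter_filter using p an by (intro filter_cong) (auto simp: g_def)
    also have "\<dots> = (if p \<in> S then [p] else [])" using p by (simp add: filter_single)
    finally show ?thesis using p by (simp add: g_def)
  qed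
  have block0: "filter (\<lambda>(i, b). b \<noteq> 0) (?b 0) = map (\<lambda>i. (i, a i)) (filter (\<lambda>i. i \<notin> S) [0..<n - 1])"
  proof -
    have "filter (\<lambda>(i, b). b \<noteq> 0) (?b 0) = map (\<lambda>i. (i, g 0 i)) (filter (\<lambda>i. g 0 i \<noteq> 0) [0..<n - 1])"
      by (simp add: filter_map o_def)
    also have "filter (\<lambda>i. g 0 i \<noteq> 0) [0..<n - 1] = filter (\<lambda>i. i \<notin> S) [0..<n - 1]"
      using S an by (intro filter_cong) (auto simp: g_def)
    finally show ?thesis by (auto simp: g_def)
  qed
  have "rev [0..<n - 1] = rev [1..<n - 1] @ [0]" using n by (simp add: upt_conv_Cons)
  then have "filter (\<lambda>(i, b). b \<noteq> 0) ?z
      = concat (map (\<lambda>p. filter (\<lambda>(i, b). b \<noteq> 0) (?b p)) (rev [1..<n - 1])) @ filter (\<lambda>(i, b). b \<noteq> 0) (?b 0)"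
    unfolding z by (simp add: filter_concat o_def)
  also have "concat (map (\<lambda>p. filter (\<lambda>(i, b). b \<noteq> 0) (?b p)) (rev [1..<n - 1]))
      = concat (map (\<lambda>p. if p \<in> S then [(p, a p)] else []) (rev [1..<n - 1]))"
    by (intro arg_cong[of _ _ concat] map_cong refl block) auto
  also have "\<dots> = map (\<lambda>i. (i, a i)) (filter (\<lambda>i. i \<in> S) (rev [1..<n - 1]))"
  proof -
    have "concat (map (\<lambda>p. if p \<in> S then [(p, a p)] else []) xs) = map (\<lambda>i. (i, a i)) (filter (\<lambda>i. i \<in> S) xs)" for xs
      by (induction xs) simp_all
    then show ?thesis .
  qed
  also have "filter (\<lambda>i. i \<in> S) (rev [1..<n - 1]) = rev (filter (\<lambda>i. i \<in> S) [0..<n - 1])"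
    using n S by (simp add: rev_filter upt_conv_Cons)
  finally have nz: "filter (\<lambda>(i, b). b \<noteq> 0) ?z = map (\<lambda>i. (i, a i)) (coxeter_list S (n - 1))"
    unfolding block0 coxeter_list_def by simp
  have nonneg: "0 \<le> g p i" if "i < n - 1" for p i using a that by (auto simp: g_def intro: less_imp_le)
  have "basic_parameters n as"
    unfolding basic_parameters_iff
  proof (intro conjI ballI allI impI)
    show "length as = length (factor_order n)" unfolding as_def factor_order_def by (rule length_concat_upt)
    show "0 \<le> b" if "b \<in> set as" for b using that nonneg by (auto simp: as_def)
    fix i assume i: "i < n - 1"
    have zn: "0 \<le> b" if "(q, b) \<in> set ?z" for q b using that nonneg unfolding z by auto
    have "filter (\<lambda>(q, b). q = i \<and> 0 < b) ?z = filter (\<lambda>(q, b). q = i) (filter (\<lambda>(q, b). b \<noteq> 0) ?z)"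
      unfolding filter_filter using zn by (intro filter_cong) (auto simp: order_less_le)
    also have "\<dots> = map (\<lambda>i. (i, a i)) (filter (\<lambda>q. q = i) (coxeter_list S (n - 1)))"
      unfolding nz by (simp add: filter_map o_def)
    also have "\<dots> = [(i, a i)]"
      using i by (simp add: filter_single distinct_coxeter_list set_coxeter_list)
    finally show "length (filter (\<lambda>(q, b). q = i \<and> 0 < b) ?z) = 1" by simp
  qed
  moreover have "upper_product n (map (\<lambda>i. (i, a i)) (coxeter_list S (n - 1))) = upper_product n ?z"
    unfolding nz[symmetric] by (rule upper_product_drop_zeros)
  ultimately show ?thesis by blast
qed

lemma basic_word:
  assumes as: "basic_parameters n as"
  obtains fs where "valid n fs" "length fs = n - 1" "upper_product n (zip (factor_order n) as) = upper_product n fs"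
proof
  let ?z = "zip (factor_order n) as"
  let ?fs = "filter (\<lambda>(q, b). 0 < b) ?z"
  have len: "length as = length (factor_order n)" and nonneg: "\<And>a. a \<in> set as \<Longrightarrow> 0 \<le> a"
    and one: "\<And>i. i < n - 1 \<Longrightarrow> length (filter (\<lambda>(q, b). q = i \<and> 0 < b) ?z) = 1"
    using as by (auto simp: basic_parameters_iff)
  have zn: "0 \<le> b" "Suc q < n" if "(q, b) \<in> set ?z" for q b
    using nonneg[OF set_zip_rightD[OF that]] set_zip_leftD[OF that] suffix_order_letters[of n 0]
    by (auto simp: factor_order_suffix)
  show v: "valid n ?fs" using zn(2) by (auto simp: valid_def)
  have eq: "?fs = filter (\<lambda>(q, b). b \<noteq> 0) ?z" using zn(1) by (intro filter_cong) (auto simp: order_less_le)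
  show "upper_product n ?z = upper_product n ?fs" unfolding eq by (rule upper_product_drop_zeros[symmetric])
  have "count_list (map fst ?fs) i = 1" if i: "i < n - 1" for i
  proof -
    have "count_list (map fst ?fs) i = length (filter (\<lambda>(q, b). q = i \<and> 0 < b) ?z)"
      by (induction "?z" rule: list.induct) (auto simp: count_list_eq_length_filter filter_map filter_filter o_def split_def conj_commute eq_commute)
    then show ?thesis using one[OF i] by simp
  qed
  then have "(\<Sum>i\<in>{..<n - 1}. count_list (map fst ?fs) i) = n - 1" by simp
  moreover have "(\<Sum>i\<in>{..<n - 1}. count_list (map fst ?fs) i) = length (map fst ?fs)"
    by (rule sum_count_set) (use valid_letters[OF v] in \<open>auto simp: less_diff_conv\<close>)
  ultimately show "length ?fs = n - 1" by simp
qed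

section \<open>Oscillation and basic oscillatory Gram matrices\<close>

lemma acts_absent_letter:
  assumes "i \<notin> set ws"
  shows "acts ws {..<Suc i} = {..<Suc i}"
  using assms
proof (induction ws)
  case (Cons j ws)
  then have ne: "j \<noteq> i" and IH: "acts ws {..<Suc i} = {..<Suc i}" by simp_all
  from ne have "\<not> (j \<in> {..<Suc i} \<and> Suc j \<notin> {..<Suc i})" by simp
  then have "act j {..<Suc i} = {..<Suc i}" unfolding act_def by (rule if_not_P)
  with IH show ?case by simp
qed simp

text \<open>A missing letter i would fix the set of the first i + 1 places in every pass, so no
  power could have all its minors of order i + 1 positive.\<close>

lemma oscillatory_letters:
  assumes d: "\<forall>i<n. 0 < d i" and fs: "valid n fs" and osc: "oscillatory (gram n d (upper_product n fs))"
  shows "set (map fst fs) = {..<n - 1}"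
proof
  show "set (map fst fs) \<subseteq> {..<n - 1}" using valid_letters[OF fs] by (auto simp: less_diff_conv)
  obtain m where "1 \<le> m" and tp: "totally_positive (gram n d (upper_product n fs) ^\<^sub>m m)"
    using osc by (auto simp: oscillatory_def)
  show "{..<n - 1} \<subseteq> set (map fst fs)"
  proof
    fix i assume "i \<in> {..<n - 1}"
    then have i: "Suc i < n" by (simp add: less_diff_conv)
    show "i \<in> set (map fst fs)"
    proof (rule ccontr)
      assume "i \<notin> set (map fst fs)"
      then have "i \<notin> set (wpow m (map fst fs))" using set_wpow by blast
      then have "acts (wpow m (map fst fs)) {..<Suc i} = {..<Suc i}" by (rule acts_absent_letter)
      moreover have "acts (wpow m (map fst fs)) {..<Suc i} = {n - Suc i..<n}"
      proof (rule minors_positive_iff[OF less_imp_le[OF i] d fs, THEN iffD1])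
        have "1 \<le> Suc i" by simp
        then show "\<forall>x\<in>minors (Suc i) (gram n d (upper_product n fs) ^\<^sub>m m). 0 < x"
          using tp unfolding totally_positive_def by blast
      qed
      ultimately have "{..<Suc i} = {n - Suc i..<n}" by simp
      moreover have "0 \<in> {..<Suc i}" by simp
      ultimately show False using i by auto
    qed
  qed
qed

lemma invertible_gram:
  assumes U: "unit_upper n U" and d: "\<forall>i<n. 0 < d i"
  shows "invertible_mat (gram n d U)"
proof -
  let ?A = "gram n d U"
  have A: "?A \<in> carrier_mat n n" by (rule gram_carrier[OF unit_upperD(1)[OF U]])
  obtain c where "0 < c" "minor ?A {..<n} {..<n} = c * minor U {..<n} {..<n}"
    using leading_minor_gram[OF U d, of "{..<n}" n] by auto
  then have "0 < minor ?A {..<n} {..<n}" using minor_principal_unit_upper[OF U] by simp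
  moreover have "minor ?A {..<n} {..<n} = det ?A"
  proof -
    have "minor ?A {..<n} {..<n} = det (mat n n (\<lambda>(a, b). ?A $$ (a, b)))"
      by (rule minor_eq'[OF A]) auto
    also have "mat n n (\<lambda>(a, b). ?A $$ (a, b)) = ?A" using A by (intro eq_matI) auto
    finally show ?thesis .
  qed
  ultimately have "det ?A \<noteq> 0" by simp
  from det_non_zero_imp_unit[OF A this, of "()"] obtain B where "B \<in> carrier_mat n n" "?A * B = 1\<^sub>m n" "B * ?A = 1\<^sub>m n"
    by (auto simp: Units_def ring_mat_def)
  then show ?thesis using A unfolding invertible_mat_def inverts_mat_def by auto
qed

lemma transpose_gram: "U \<in> carrier_mat n n \<Longrightarrow> (gram n d U)\<^sup>T = gram n d U"
proof (rule eq_matI)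
  fix x y assume U: "U \<in> carrier_mat n n" and "x < dim_row (gram n d U)" "y < dim_col (gram n d U)"
  then have xy: "x < n" "y < n" by simp_all
  have "gram n d U $$ (y, x) = gram n d U $$ (x, y)"
    unfolding gram_def gram_index[OF U U xy] gram_index[OF U U xy(2,1)] by (simp add: ac_simps)
  then show "(gram n d U)\<^sup>T $$ (x, y) = gram n d U $$ (x, y)" using U xy by simp
qed simp_all

lemma basic_oscillatory_gram:
  assumes d: "\<forall>i<n. 0 < d i" and fs: "valid n fs"
    and as: "basic_parameters n as" "upper_product n fs = upper_product n (zip (factor_order n) as)"
  shows "basic_oscillatory (gram n d (upper_product n fs))"
proof -
  let ?U = "upper_product n fs"
  have u: "unit_upper n ?U" using fs by (intro unit_upper_product) (auto simp: valid_def)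
  have dim: "dim_row (gram n d ?U) = n" by simp
  show ?thesis
    unfolding basic_oscillatory_def Let_def dim
  proof (intro conjI exI)
    show "invertible_mat (gram n d ?U)" by (rule invertible_gram[OF u d])
    show "totally_nonnegative (gram n d ?U)" by (rule totally_nonnegative_gram[OF d fs])
    show "basic_parameters n as" "basic_parameters n as" "\<forall>i<n. 0 < d i" using as d by auto
    show "gram n d ?U = (upper_product n (zip (factor_order n) as))\<^sup>T * mat_diag n d * upper_product n (zip (factor_order n) as)"
      unfolding gram_def as(2) ..
  qed
qed

lemma distinct_word_basic:
  assumes n: "2 \<le> n" and fs: "valid n fs" "distinct (map fst fs)" "set (map fst fs) = {..<n - 1}"
  shows "\<exists>as. basic_parameters n as \<and> upper_product n fs = upper_product n (zip (factor_order n) as)"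
proof -
  obtain S a where "0 \<notin> S" "\<forall>i<n - 1. 0 < a i"
    "upper_product n fs = upper_product n (map (\<lambda>i. (i, a i)) (coxeter_list S (n - 1)))"
    using coxeter_normal_form[OF order_refl fs(2,3,1)] by blast
  then show ?thesis using coxeter_basic[OF n] by metis
qed

theorem theorem3p8:
  fixes n :: nat and A U :: "real mat" and d :: "nat \<Rightarrow> real"
  assumes "n \<ge> 2"
    and "A \<in> carrier_mat n n" and "U \<in> carrier_mat n n"
    and "transpose_mat A = A" and "oscillatory A"
    and "unit_upper_triangular U" and "\<forall>i<n. 0 < d i"
    and "A = transpose_mat U * mat_diag n d * U"
  shows
    "(\<exists>B \<in> carrier_mat n n. transpose_mat B = B \<and> basic_oscillatory B
        \<and> (\<forall>k\<in>{1..<n}. minor_exponent k A \<le> minor_exponent k B))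
     \<and> (\<forall>k\<in>{1..<n}. minor_exponent k A + minor_exponent (n - k) A \<le> n)
     \<and> (\<Sum>k=1..n-1. minor_exponent k A) + upper_length U \<le> (n choose 2) + (n - 1)
     \<and> ((\<Sum>k=1..n-1. minor_exponent k A) + upper_length U = (n choose 2) + (n - 1)
          \<longleftrightarrow> int (upper_length (U ^\<^sub>m 2)) - int (upper_length U)
               = int (card {k. 1 \<le> k \<and> k < n \<and> minor A {..<k} {n-k..<n} = 0}))
     \<and> (\<Sum>k=1..n-1. minor_exponent k A) \<le> n choose 2
     \<and> ((\<Sum>k=1..n-1. minor_exponent k A) = n choose 2 \<longleftrightarrow> basic_oscillatory A)
     \<and> ((\<Sum>k=1..n-1. minor_exponent k A) = n choose 2
          \<longleftrightarrow> (\<forall>k\<in>{1..<n}. minor_exponent k A + minor_exponent (n - k) A = n))"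
proof -
  note n = assms(1) and UC = assms(3) and osc = assms(5) and d = assms(7)
  have AU: "A = gram n d U" using assms(8) by (simp add: gram_def)
  have U: "unit_upper n U"
    using assms(3,6) by (auto simp: unit_upper_def unit_upper_triangular_def upper_triangular_def)
  have tnn: "totally_nonnegative A" using osc by (simp add: oscillatory_def)
  \<comment> \<open>The hypotheses give signs for the minors of A only. Those in leading rows are
    positive multiples of the corresponding minors of U, and these are what the factorization
    requires.\<close>
  have nonneg: "0 \<le> minor U {..<k} J" if k: "k \<le> n" and J: "J \<subseteq> {..<n}" "card J = k" for k J
  proof (cases "k = 0")
    case True
    then have "J = {}" using J finite_subset[OF J(1)] by simp
    then show ?thesis using True by (simp add: minor_def submatrix_def)
  next
    case False
    obtain c where c: "0 < c" "minor A {..<k} J = c * minor U {..<k} J"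
      using leading_minor_gram[OF U d J k] AU by blast
    have "minor A {..<k} J \<in> minors k A"
    proof -
      have "{..<k} \<subseteq> {..<dim_row A}" "J \<subseteq> {..<dim_col A}" "card {..<k} = k"
        using k J(1) assms(2) by auto
      then show ?thesis unfolding minors_def using J(2) by blast
    qed
    moreover have "1 \<le> k" using False by simp
    ultimately have "0 \<le> minor A {..<k} J" using tnn unfolding totally_nonnegative_def by blast
    then show ?thesis using c by (simp add: zero_le_mult_iff)
  qed
  have n0: "0 < n" using n by simp
  obtain fs where fs: "valid n fs" "U = upper_product n fs"
    using nonnegative_factorization[OF n0 U nonneg] by blast
  define ws where "ws = map fst fs"
  \<comment> \<open>This and the formulas for the exponents are stated for an arbitrary word of U,
    because reduced words replace \<open>fs\<close> later.\<close>
  have full: "set (map fst gs) = {..<n - 1}" if "valid n gs" "U = upper_product n gs" for gs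
    using oscillatory_letters[OF d that(1)] osc AU that(2) by simp
  have ws: "set ws = {..<n - 1}" unfolding ws_def by (rule full[OF fs])
  have ex: "minor_exponent k A = expo n (map fst gs) k" if "k \<le> n" "valid n gs" "U = upper_product n gs" for k gs
    using minor_exponent_gram[OF that(1) d that(2)] AU that(3) by simp
  have exw: "minor_exponent k A = expo n ws k" if "k \<le> n" for k
    unfolding ws_def by (rule ex[OF that fs])
  let ?S = "\<Sum>k=1..n-1. minor_exponent k A"
  have S: "?S = (\<Sum>k=1..n-1. expo n (map fst gs) k)" if "valid n gs" "U = upper_product n gs" for gs
    by (intro sum.cong refl ex that) auto
  have Sw: "?S = (\<Sum>k=1..n-1. expo n ws k)" unfolding ws_def by (rule S[OF fs])
  have len: "upper_length U = perm_length n ws" unfolding fs(2) ws_def by (rule upper_length_eq[OF fs(1)])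
  have len2: "upper_length (U ^\<^sub>m 2) = perm_length n (ws @ ws)"
    unfolding fs(2) ws_def by (rule upper_length_square[OF fs(1)])
  have zeros: "card {k. 1 \<le> k \<and> k < n \<and> minor A {..<k} {n-k..<n} = 0} = card (unfinished n ws)"
  proof -
    have iff: "minor A {..<k} {n-k..<n} = 0 \<longleftrightarrow> acts ws {..<k} \<noteq> {n - k..<n}" if "k < n" for k
      unfolding ws_def AU fs(2) by (rule corner_minor_gram[OF less_imp_le[OF that] d fs(1)])
    have "{k. 1 \<le> k \<and> k < n \<and> minor A {..<k} {n-k..<n} = 0} = Suc ` unfinished n ws"
    proof (intro equalityI subsetI)
      fix k assume k: "k \<in> {k. 1 \<le> k \<and> k < n \<and> minor A {..<k} {n-k..<n} = 0}"
      then obtain i where i: "k = Suc i" by (cases k) auto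
      with k have "i \<in> unfinished n ws" using iff[of k] by (simp add: unfinished_def)
      with i show "k \<in> Suc ` unfinished n ws" by blast
    next
      fix k assume "k \<in> Suc ` unfinished n ws"
      then obtain i where "k = Suc i" "i \<in> unfinished n ws" by blast
      then show "k \<in> {k. 1 \<le> k \<and> k < n \<and> minor A {..<k} {n-k..<n} = 0}"
        using iff[of k] by (simp add: unfinished_def)
    qed
    then show ?thesis by (simp add: card_image)
  qed
  have sum_le: "?S + upper_length U \<le> (n choose 2) + (n - 1)"
    unfolding Sw len by (rule expo_sum(1)[OF n ws])
  have len_ge: "n - 1 \<le> upper_length U" unfolding len by (rule expo_sum(3)[OF n ws])
  have S_le: "?S \<le> n choose 2" using sum_le len_ge by linarith
  have pair: "minor_exponent k A + minor_exponent (n - k) A \<le> n" if k: "1 \<le> k" "k < n" for k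
    using expo_add_le[OF k ws] exw[of k] exw[of "n - k"] k by simp
  \<comment> \<open>A reduced word of length n - 1 that contains all n - 1 letters contains each of
    them once.\<close>
  have short: "\<exists>gs. valid n gs \<and> U = upper_product n gs \<and> distinct (map fst gs)" if eq: "upper_length U = n - 1"
  proof -
    obtain gs where g: "valid n gs" "reduced n gs" "upper_product n gs = upper_product n fs"
      using reduce_word[OF fs(1)] by blast
    have gU: "U = upper_product n gs" using g(3) fs(2) by simp
    have "length gs = upper_length U" using g(2) upper_length_eq[OF g(1)] gU by (simp add: reduced_def)
    then have "card (set (map fst gs)) = length (map fst gs)" using full[OF g(1) gU] eq by simp
    then have "distinct (map fst gs)" by (rule card_distinct)
    with g gU show ?thesis by blast
  qed
  have max_iff_length: "?S = n choose 2 \<longleftrightarrow> upper_length U = n - 1"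
  proof
    assume "?S = n choose 2"
    then show "upper_length U = n - 1" using sum_le len_ge by linarith
  next
    assume eq: "upper_length U = n - 1"
    then obtain gs where g: "valid n gs" "U = upper_product n gs" "distinct (map fst gs)" using short by blast
    have "upper_length U = perm_length n (map fst gs)" unfolding g(2) by (rule upper_length_eq[OF g(1)])
    then show "?S = n choose 2"
      using expo_sum_distinct[OF n full[OF g(1,2)] g(3)] S[OF g(1,2)] eq by linarith
  qed
  have max_iff_basic: "?S = n choose 2 \<longleftrightarrow> basic_oscillatory A"
    unfolding max_iff_length
  proof
    assume "upper_length U = n - 1"
    then obtain gs where g: "valid n gs" "U = upper_product n gs" "distinct (map fst gs)" using short by blast
    obtain as where "basic_parameters n as" "upper_product n gs = upper_product n (zip (factor_order n) as)"
      using distinct_word_basic[OF n g(1,3) full[OF g(1,2)]] by blast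
    then show "basic_oscillatory A" unfolding AU g(2) by (rule basic_oscillatory_gram[OF d g(1)])
  next
    assume "basic_oscillatory A"
    moreover have "dim_row A = n" using assms(2) by simp
    ultimately obtain as bs e where p: "basic_parameters n as" "basic_parameters n bs" "\<forall>i<n. 0 < e i"
      "A = (upper_product n (zip (factor_order n) as))\<^sup>T * mat_diag n e * upper_product n (zip (factor_order n) bs)"
      unfolding basic_oscillatory_def Let_def by auto
    have u: "unit_upper n (upper_product n (zip (factor_order n) cs))" for cs
      using suffix_order_letters[of n 0]
      by (intro unit_upper_product) (auto dest: set_zip_leftD simp: factor_order_suffix)
    \<comment> \<open>The factors of a basic factorization need not be related to U a priori;
      uniqueness identifies the right one with U, which thus has a word of length n - 1.\<close>
    have "upper_product n (zip (factor_order n) bs) = U"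
      by (rule gram_factorization_unique[OF U u u d p(3)]) (use p(4) AU in simp)
    moreover obtain gs where g: "valid n gs" "length gs = n - 1"
      "upper_product n (zip (factor_order n) bs) = upper_product n gs"
      using basic_word[OF p(2)] by blast
    ultimately have "upper_length U = perm_length n (map fst gs)" using upper_length_eq[OF g(1)] by simp
    also have "\<dots> \<le> n - 1" using perm_length_le[OF valid_letters[OF g(1)]] g(2) by simp
    finally show "upper_length U = n - 1" using len_ge by simp
  qed
  have max_iff_pair: "?S = n choose 2 \<longleftrightarrow> (\<forall>k\<in>{1..<n}. minor_exponent k A + minor_exponent (n - k) A = n)"
  proof -
    \<comment> \<open>Adding the sum to its reflection turns the total bound into the n - 1 pair
      bounds added up, since twice n choose 2 is n(n - 1). Equality then holds term by term.\<close>
    have "(\<Sum>k=1..n-1. minor_exponent (n - k) A) = ?S"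
      by (rule sum.reindex_bij_witness[of _ "\<lambda>k. n - k" "\<lambda>k. n - k"]) (use n in auto)
    then have twice: "(\<Sum>k=1..n-1. minor_exponent k A + minor_exponent (n - k) A) = 2 * ?S"
      by (simp add: sum.distrib)
    have choose: "2 * (n choose 2) = (\<Sum>k=1..n-1. n)"
    proof -
      have "even (n * (n - 1))" by (cases "even n") auto
      then show ?thesis using choose_two[of n] by (simp add: mult.commute)
    qed
    have le: "minor_exponent k A + minor_exponent (n - k) A \<le> n" if "k \<in> {1..n-1}" for k
      using pair[of k] that n by auto
    have "?S = n choose 2 \<longleftrightarrow> (\<Sum>k=1..n-1. minor_exponent k A + minor_exponent (n - k) A) = (\<Sum>k=1..n-1. n)"
      unfolding twice choose[symmetric] by simp
    also have "\<dots> \<longleftrightarrow> (\<forall>k\<in>{1..n-1}. minor_exponent k A + minor_exponent (n - k) A = n)"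
    proof
      assume eq: "(\<Sum>k=1..n-1. minor_exponent k A + minor_exponent (n - k) A) = (\<Sum>k=1..n-1. n)"
      show "\<forall>k\<in>{1..n-1}. minor_exponent k A + minor_exponent (n - k) A = n"
      proof (rule ccontr)
        assume "\<not> (\<forall>k\<in>{1..n-1}. minor_exponent k A + minor_exponent (n - k) A = n)"
        then obtain k where k: "k \<in> {1..n-1}" "minor_exponent k A + minor_exponent (n - k) A < n"
          using le by (metis order_le_neq_trans)
        have "(\<Sum>k=1..n-1. minor_exponent k A + minor_exponent (n - k) A) < (\<Sum>k=1..n-1. n)"
          by (rule sum_strict_mono_ex1) (use le k in auto)
        with eq show False by simp
      qed
    qed simp
    also have "\<dots> \<longleftrightarrow> (\<forall>k\<in>{1..<n}. minor_exponent k A + minor_exponent (n - k) A = n)"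
      by (rule ball_cong) (use n in auto)
    finally show ?thesis .
  qed
  have dominated: "\<exists>B \<in> carrier_mat n n. transpose_mat B = B \<and> basic_oscillatory B
        \<and> (\<forall>k\<in>{1..<n}. minor_exponent k A \<le> minor_exponent k B)"
  proof -
    \<comment> \<open>The exponents depend on the word alone, so all parameters and diagonal entries
      of B are set to 1.\<close>
    define gs where "gs = map (\<lambda>i. (i, 1 :: real)) (remdups ws)"
    have gw: "map fst gs = remdups ws" by (simp add: gs_def o_def)
    have g: "valid n gs" using full_valid[OF ws] by (auto simp: gs_def valid_def)
    obtain as where as: "basic_parameters n as" "upper_product n gs = upper_product n (zip (factor_order n) as)"
      using distinct_word_basic[OF n g] gw ws by auto
    have one: "\<forall>i<n. 0 < (1 :: real)" by simp
    let ?B = "gram n (\<lambda>_. 1) (upper_product n gs)"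
    have "minor_exponent k A \<le> minor_exponent k ?B" if k: "1 \<le> k" "k < n" for k
      using expo_remdups[OF k ws] exw[of k] minor_exponent_gram[OF less_imp_le[OF k(2)] one g] gw k by simp
    moreover have "basic_oscillatory ?B" by (rule basic_oscillatory_gram[OF one g as])
    moreover have "?B\<^sup>T = ?B" by (rule transpose_gram) simp
    moreover have "?B \<in> carrier_mat n n" by simp
    ultimately show ?thesis by (intro bexI[of _ ?B]) auto
  qed
  have equality: "?S + upper_length U = (n choose 2) + (n - 1)
      \<longleftrightarrow> int (upper_length (U ^\<^sub>m 2)) - int (upper_length U)
               = int (card {k. 1 \<le> k \<and> k < n \<and> minor A {..<k} {n-k..<n} = 0})"
    unfolding zeros len2 unfolding Sw len by (rule expo_sum_eq_iff[OF n ws])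
  show ?thesis
    using dominated pair sum_le equality S_le max_iff_basic max_iff_pair by (intro conjI ballI) auto
qed

end
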